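(* Let $n\in\mathbb N$. Assume $f\in C^{[n/2]+4}(\mathbb R^n\times(0,\infty))$, $t^2f(x,t)\in C(\mathbb R^n\times[0,\infty))$, and for some $T>0$, \[ |\partial_x^\alpha f(x,t)|+|t\,\partial_t\partial_x^\beta f(x,t)|\le C_\alpha t^{-2}\quad\text{for all }t\in(0,T),\ x\in\mathbb R^n, \] for all $|\alpha|\le[n/2]+4$, $|\beta|\le[n/2]+3$. Let $f_0(x):=\lim_{t\to0}t^2f(x,t)$ and assume $f_0\in C^{[n/2]+4}(\mathbb R^n)$ and that for some $\varepsilon>0$, \[ |\partial_x^\alpha(tf(x,t)-t^{-1}f_0(x))|+|t\,\partial_t\partial_x^\beta(tf(x,t)-t^{-1}f_0(x))|\le C_\alpha t^{\varepsilon-1}\quad\text{for all }t\in(0,T),\ x\in\mathbb R^n, \] for all $|\alpha|\le[n/2]+2$, $|\beta|\le[n/2]+1$. Let $\tau(t):=\int_0^t\ln s\,ds$ and $\phi(t):=3t^{1/3}$. Then the function \[ \psi(x,t)=\frac1t f_0(x)\tau(t)+\frac1{18t}\int_0^t dl\int_0^{\phi(t)-\phi(l)}dr\,\big(\phi^2(t)+\phi^2(l)-r^2\big)\Big(l\,v_f(x,r;l)-l^{-1}v_{f_0}(x,r)+l^{-4/3}\tau(l)\Delta v_{f_0}(x,r)\Big) \] solves \[ \psi_{tt}-t^{-4/3}\Delta\psi+2t^{-1}\psi_t=f(x,t),\ t>0,\ x\in\mathbb R^n,\qquad \lim_{t\to0}t\psi(x,t)=0,\quad \lim_{t\to0}\big(t\psi_t(x,t)+\psi(x,t)-f_0(x)\ln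 t\big)=0. \]
   Context: $\Delta=\sum_{i=1}^n\partial_{x_i}^2$ and $[n/2]$ is the integer part of $n/2$. For a function $h(x,b)$ of $x\in\mathbb R^n$ and a parameter $b$, $v_h(x,r;b)$ denotes the solution $v$ of the Cauchy problem for the free wave equation $v_{rr}-\Delta v=0$, $v(x,0)=h(x,b)$, $v_r(x,0)=0$, evaluated at time $r$. If $h=h(x)$ does not depend on a parameter, one writes $v_h(x,r)$. *)

theory Defs
  imports "HOL-Analysis.Analysis"
begin

definition pdir :: "'a::euclidean_space \<Rightarrow> ('a \<Rightarrow> real) \<Rightarrow> 'a \<Rightarrow> real" where
  "pdir b g x = deriv (\<lambda>s. g (x + s *\<^sub>R b)) 0"

(* iterated partial derivative  \<partial>^\<alpha>, the multi-index \<alpha> given as a list of basis directions *)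
fun diter :: "'a::euclidean_space list \<Rightarrow> ('a \<Rightarrow> real) \<Rightarrow> 'a \<Rightarrow> real" where
  "diter [] g = g"
| "diter (b # bs) g = pdir b (diter bs g)"

definition Ck :: "nat \<Rightarrow> 'a::euclidean_space set \<Rightarrow> ('a \<Rightarrow> real) \<Rightarrow> bool" where
  "Ck k S g \<longleftrightarrow>
     (\<forall>bs. set bs \<subseteq> Basis \<and> length bs \<le> k \<longrightarrow>
        continuous_on S (diter bs g) \<and>
        (length bs < k \<longrightarrow> (\<forall>b\<in>Basis. \<forall>x\<in>S. (\<lambda>s. diter bs g (x + s *\<^sub>R b)) differentiable (at 0))))"

definition lap :: "('a::euclidean_space \<Rightarrow> real) \<Rightarrow> 'a \<Rightarrow> real" where
  "lap g x = (\<Sum>b\<in>Basis. pdir b (pdir b g) x)"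

definition is_wave_sol :: "('a::euclidean_space \<Rightarrow> real) \<Rightarrow> ('a \<Rightarrow> real \<Rightarrow> real) \<Rightarrow> bool" where
  "is_wave_sol h v \<longleftrightarrow>
     Ck 2 UNIV (\<lambda>(x, r). v x r) \<and>
     (\<forall>x r. deriv (\<lambda>s. deriv (\<lambda>s'. v x s') s) r = lap (\<lambda>y. v y r) x) \<and>
     (\<forall>x. v x 0 = h x) \<and>
     (\<forall>x. deriv (\<lambda>r. v x r) 0 = 0)"

definition wave_sol :: "('a::euclidean_space \<Rightarrow> real) \<Rightarrow> 'a \<Rightarrow> real \<Rightarrow> real" where
  "wave_sol h = (THE v. is_wave_sol h v)"

definition tau :: "real \<Rightarrow> real" where
  "tau t = integral {0..t} ln"

definition phi :: "real \<Rightarrow> real" where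
  "phi t = 3 * t powr (1/3)"

definition psi :: "('a::euclidean_space \<Rightarrow> real \<Rightarrow> real) \<Rightarrow> ('a \<Rightarrow> real) \<Rightarrow> 'a \<Rightarrow> real \<Rightarrow> real" where
  "psi f f0 x t = 1 / t * f0 x * tau t
     + 1 / (18 * t) * integral {0..t} (\<lambda>l. integral {0..phi t - phi l} (\<lambda>r.
         (phi t ^ 2 + phi l ^ 2 - r ^ 2) *
         (l * wave_sol (\<lambda>y. f y l) x r - 1 / l * wave_sol f0 x r
          + l powr (-4/3) * tau l * lap (\<lambda>y. wave_sol f0 y r) x)))"

end

theory Submission
  imports Defs
begin

text \<open>
  Put \<open>w = t \<psi> - f\<^sub>0 \<tau>\<close>. The equation for \<open>\<psi>\<close> becomes \<open>w\<^sub>t\<^sub>t - t\<^bsup>-4/3\<^esup> \<Delta>w = F\<close> with \<open>F = t f - f\<^sub>0/t + t\<^bsup>-4/3\<^esup> \<tau> \<Delta>f\<^sub>0\<close>, and the double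
  integral is Duhamel's formula for it: the kernel \<open>\<phi>(t)\<^sup>2 + \<phi>(l)\<^sup>2 - r\<^sup>2\<close> turns a free wave with data \<open>F(\<cdot>, l)\<close> into the solution with
  vanishing value and velocity \<open>F(\<cdot>, l)\<close> at \<open>t = l\<close>. The hypotheses make the integrand \<open>O(l\<^bsup>\<delta>-1\<^esup>)\<close> as \<open>l \<rightarrow> 0\<close>, together with its derivatives
  of order two.

  The free wave is constructed from the average \<open>u\<close> of \<open>h(x + r y)\<close> over the unit ball with weight \<open>(1 - |y|\<^sup>2)\<^sup>a\<close>, which satisfies the
  Euler-Poisson-Darboux equation \<open>r u\<^sub>r\<^sub>r + k u\<^sub>r = r \<Delta>u\<close> with \<open>k = n + 1 + 2 a\<close>. The operator \<open>1 + r \<partial>\<^sub>r / (k - 1)\<close> lowers \<open>k\<close> by two, and \<open>k = 0\<close> is the wave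
  equation; choosing \<open>k = 2 ([n/2] + 1)\<close> costs \<open>[n/2] + 1\<close> derivatives of the data. Uniqueness, needed because the wave is
  specified by \<open>THE\<close>, follows from a weighted energy estimate.
\<close>

section \<open>Iterated partial derivatives\<close>

text \<open>In the variable s = \<open>phi t\<close> the operator acting on w is t^(-4/3) times w_ss
  - (2/s) w_s - Laplace w, that is, Euler-Poisson-Darboux with parameter -2. An even parameter is
  linked to the wave equation by differentiations only, which is why the kernel is a polynomial in
  r. Subtracting f0 tau is forced: t f behaves like f0/t, which is not integrable at 0. The price is
  the term t^(-4/3) tau Laplace f0, of size t^(-1/3) |ln t|, which is integrable. The obstacle is
  the count of derivatives. Put m = [n/2] + 1. Two derivatives of a wave cost m + 2 derivatives of
  its data, but t f - f0/t is controlled only up to order m + 1. Integration by parts in r replaces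
  the wave by its r-primitive, which is r times a solution with parameter 2 and costs m - 1, so that
  two derivatives cost exactly m + 1. In the correction term Laplace v = v_rr has the primitive v_r,
  of order m + 1; two derivatives of it cost m + 3 = [n/2] + 4, exactly the regularity of
  f0.\<close>

lemma diter_append: "diter (as @ bs) g = diter as (diter bs g)"
  by (induction as) auto

lemma Ck_0: "Ck 0 S g \<longleftrightarrow> continuous_on S g"
  by (auto simp: Ck_def)

text \<open>The last entry of the list is the derivative applied first; peeling it off turns the
  definition by lists into a recursion on \<open>k\<close>, the form in which all later regularity
  proofs use it.\<close>

lemma Ck_Suc:
  "Ck (Suc k) S g \<longleftrightarrow> continuous_on S g \<and>
     (\<forall>b\<in>Basis. (\<forall>x\<in>S. (\<lambda>s. g (x + s *\<^sub>R b)) differentiable (at 0)) \<and> Ck k S (pdir b g))"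
  (is "?L = ?R")
proof
  assume L: ?L
  show ?R
  proof (intro conjI ballI)
    show "continuous_on S g" using L by (auto simp: Ck_def dest: spec[of _ "[]"])
    fix b :: 'a assume b: "b \<in> Basis"
    show "(\<lambda>s. g (x + s *\<^sub>R b)) differentiable at 0" if "x \<in> S" for x
      using L b that unfolding Ck_def by (auto dest!: spec[of _ "[]"])
    have "continuous_on S (diter bs (pdir b g)) \<and>
        (length bs < k \<longrightarrow> (\<forall>ba\<in>Basis. \<forall>x\<in>S. (\<lambda>s. diter bs (pdir b g) (x + s *\<^sub>R ba)) differentiable at 0))"
      if "set bs \<subseteq> Basis \<and> length bs \<le> k" for bs
      using L that b unfolding Ck_def
      by (auto simp: diter_append dest!: spec[of _ "bs @ [b]"])
    then show "Ck k S (pdir b g)" unfolding Ck_def by blast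
  qed
next
  assume R: ?R
  show ?L unfolding Ck_def
  proof (intro allI impI)
    fix bs :: "'a list" assume bs: "set bs \<subseteq> Basis \<and> length bs \<le> Suc k"
    show "continuous_on S (diter bs g) \<and> (length bs < Suc k \<longrightarrow>
         (\<forall>b\<in>Basis. \<forall>x\<in>S. (\<lambda>s. diter bs g (x + s *\<^sub>R b)) differentiable at 0))"
    proof (cases bs rule: rev_cases)
      case Nil then show ?thesis using R by auto
    next
      case (snoc cs b)
      have "Ck k S (pdir b g)" using R bs snoc by auto
      then have "continuous_on S (diter cs (pdir b g)) \<and>
        (length cs < k \<longrightarrow> (\<forall>ba\<in>Basis. \<forall>x\<in>S. (\<lambda>s. diter cs (pdir b g) (x + s *\<^sub>R ba)) differentiable at 0))"
        using bs snoc unfolding Ck_def by auto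
      then show ?thesis using snoc by (auto simp: diter_append)
    qed
  qed
qed

lemma Ck_mono: "Ck k S g \<Longrightarrow> j \<le> k \<Longrightarrow> Ck j S g"
  by (force simp: Ck_def)

lemma Ck_diter: "Ck (k + length bs) S g \<Longrightarrow> set bs \<subseteq> Basis \<Longrightarrow> Ck k S (diter bs g)"
proof (induction bs arbitrary: g rule: rev_induct)
  case (snoc b bs)
  then show ?case by (auto simp: diter_append Ck_Suc)
qed auto

section \<open>Partial derivatives as a relation, and closure properties of C^k\<close>

definition has_pd :: "'a::euclidean_space \<Rightarrow> ('a \<Rightarrow> real) \<Rightarrow> real \<Rightarrow> 'a \<Rightarrow> bool" where
  "has_pd b g d x \<longleftrightarrow> ((\<lambda>s. g (x + s *\<^sub>R b)) has_real_derivative d) (at 0)"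

lemma has_pd_pdir: "has_pd b g d x \<Longrightarrow> pdir b g x = d"
  by (simp add: has_pd_def pdir_def DERIV_imp_deriv)

lemma has_pd_differentiable: "has_pd b g d x \<Longrightarrow> (\<lambda>s. g (x + s *\<^sub>R b)) differentiable (at 0)"
  unfolding has_pd_def using real_differentiable_def by blast

lemma differentiable_has_pd: "(\<lambda>s. g (x + s *\<^sub>R b)) differentiable (at 0) \<Longrightarrow> has_pd b g (pdir b g x) x"
  unfolding has_pd_def pdir_def by (metis DERIV_deriv_iff_real_differentiable)

lemma Ck_has_pd: "Ck (Suc k) S g \<Longrightarrow> b \<in> Basis \<Longrightarrow> x \<in> S \<Longrightarrow> has_pd b g (pdir b g x) x"
  by (simp add: Ck_Suc differentiable_has_pd)

lemma Ck_continuous: "Ck k S g \<Longrightarrow> continuous_on S g"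
  using Ck_mono[of k S g 0] by (simp add: Ck_0)

lemma eventually_open_line:
  assumes "open S" "(x::'a::real_normed_vector) \<in> S"
  shows "\<forall>\<^sub>F s in nhds 0. x + s *\<^sub>R b \<in> S"
proof -
  have "((\<lambda>s. x + s *\<^sub>R b) \<longlongrightarrow> x + 0 *\<^sub>R b) (nhds 0)"
    by (intro tendsto_intros filterlim_ident)
  then show ?thesis using assms topological_tendstoD[of _ "x" "nhds 0" S] by auto
qed

lemma has_pd_cong_open:
  assumes "open S" "x \<in> S" "\<And>y. y \<in> S \<Longrightarrow> g y = g' y"
  shows "has_pd b g d x \<longleftrightarrow> has_pd b g' d x"
  unfolding has_pd_def
proof (rule DERIV_cong_ev)
  show "\<forall>\<^sub>F s in nhds 0. g (x + s *\<^sub>R b) = g' (x + s *\<^sub>R b)"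
    using eventually_open_line[OF assms(1,2), of b] by eventually_elim (use assms in auto)
qed auto

lemma pdir_cong_open:
  assumes "open S" "x \<in> S" "\<And>y. y \<in> S \<Longrightarrow> g y = g' y"
  shows "pdir b g x = pdir b g' x"
proof -
  have "((\<lambda>s. g (x + s *\<^sub>R b)) has_field_derivative d) (at 0) = ((\<lambda>s. g' (x + s *\<^sub>R b)) has_field_derivative d) (at 0)" for d
    using has_pd_cong_open[OF assms(1,2), of g g'] assms(3) by (simp add: has_pd_def)
  then show ?thesis by (simp add: pdir_def deriv_def)
qed

lemma Ck_cong_open:
  assumes "open S" "\<And>y. y \<in> S \<Longrightarrow> g y = g' y" "Ck k S g"
  shows "Ck k S g'"
  using assms(2,3)
proof (induction k arbitrary: g g')
  case 0
  then show ?case by (simp add: Ck_0 cong: continuous_on_cong)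
next
  case (Suc k)
  have c: "continuous_on S g'" using Ck_continuous[OF Suc.prems(2)] Suc.prems(1) continuous_on_cong by metis
  show ?case unfolding Ck_Suc
  proof (intro conjI ballI c)
    fix b :: 'a and x assume b: "b \<in> Basis" and x: "x \<in> S"
    show "(\<lambda>s. g' (x + s *\<^sub>R b)) differentiable at 0"
      using Ck_has_pd[OF Suc.prems(2) b x] has_pd_cong_open[OF assms(1) x, of g g'] Suc.prems(1)
      by (blast intro: has_pd_differentiable)
  next
    fix b :: 'a assume b: "b \<in> Basis"
    show "Ck k S (pdir b g')"
    proof (rule Suc.IH[of "pdir b g"])
      show "pdir b g y = pdir b g' y" if "y \<in> S" for y
        by (rule pdir_cong_open[OF assms(1) that Suc.prems(1)])
      show "Ck k S (pdir b g)" using Suc.prems(2) b by (simp add: Ck_Suc)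
    qed
  qed
qed

text \<open>Lets regularity be proved with explicit candidates for the derivatives. \<open>S\<close>
  must be open because the candidates agree with \<open>pdir\<close> only on \<open>S\<close>, while
  further derivatives look at neighbouring points.\<close>

lemma Ck_SucI:
  assumes "open S" "continuous_on S g"
    "\<And>b x. b \<in> Basis \<Longrightarrow> x \<in> S \<Longrightarrow> has_pd b g (g' b x) x"
    "\<And>b. b \<in> Basis \<Longrightarrow> Ck k S (g' b)"
  shows "Ck (Suc k) S g"
  unfolding Ck_Suc
proof (intro conjI ballI assms(2))
  fix b :: 'a assume b: "b \<in> Basis"
  show "(\<lambda>s. g (x + s *\<^sub>R b)) differentiable at 0" if "x \<in> S" for x
    using assms(3)[OF b that] has_pd_differentiable by blast
  show "Ck k S (pdir b g)"
    by (rule Ck_cong_open[OF assms(1) _ assms(4)[OF b]]) (use assms(3)[OF b] has_pd_pdir in force)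
qed

lemma has_pd_add: "has_pd b f d x \<Longrightarrow> has_pd b g e x \<Longrightarrow> has_pd b (\<lambda>y. f y + g y) (d + e) x"
  unfolding has_pd_def by (intro derivative_intros)

lemma has_pd_mult: "has_pd b f d x \<Longrightarrow> has_pd b g e x \<Longrightarrow> has_pd b (\<lambda>y. f y * g y) (d * g x + f x * e) x"
  unfolding has_pd_def by (auto intro!: derivative_eq_intros)

lemma has_pd_const: "has_pd b (\<lambda>y. c) 0 x"
  unfolding has_pd_def by simp

lemma Ck_const: "Ck k S (\<lambda>y. c)"
proof (induction k arbitrary: c)
  case (Suc k)
  have "pdir b (\<lambda>y. c) = (\<lambda>y. 0)" for b :: 'a by (auto intro!: has_pd_pdir has_pd_const)
  then show ?case using Suc by (auto simp: Ck_Suc)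
qed (auto simp: Ck_0)

lemma Ck_add:
  assumes "open S" "Ck k S f" "Ck k S g"
  shows "Ck k S (\<lambda>y. f y + g y)"
  using assms(2,3)
proof (induction k arbitrary: f g)
  case 0 then show ?case by (auto simp: Ck_0 intro: continuous_intros)
next
  case (Suc k)
  have p: "Ck k S (pdir b f)" "Ck k S (pdir b g)" if "b \<in> Basis" for b
    using Suc.prems that by (auto simp: Ck_Suc)
  show ?case
    by (rule Ck_SucI[OF assms(1), where g' = "\<lambda>b y. pdir b f y + pdir b g y"])
       (use Suc p in \<open>auto intro!: continuous_intros has_pd_add intro: Ck_has_pd dest: Ck_continuous\<close>)
qed

lemma Ck_mult:
  assumes "open S" "Ck k S f" "Ck k S g"
  shows "Ck k S (\<lambda>y. f y * g y)"
  using assms(2,3)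
proof (induction k arbitrary: f g)
  case 0 then show ?case by (auto simp: Ck_0 intro: continuous_intros)
next
  case (Suc k)
  have m: "Ck k S f" "Ck k S g" using Suc.prems Ck_mono by fastforce+
  have p: "Ck k S (pdir b f)" "Ck k S (pdir b g)" if "b \<in> Basis" for b
    using Suc.prems that by (auto simp: Ck_Suc)
  show ?case
    by (rule Ck_SucI[OF assms(1), where g' = "\<lambda>b y. pdir b f y * g y + f y * pdir b g y"])
       (use Suc m p in \<open>auto intro!: continuous_intros has_pd_mult Ck_add[OF assms(1)] intro: Ck_has_pd dest: Ck_continuous\<close>)
qed

lemma has_pd_line:
  assumes "\<And>x. has_pd b g (g' x) x"
  shows "((\<lambda>s. g (x + s *\<^sub>R b)) has_real_derivative g' (x + s *\<^sub>R b)) (at s)"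
proof -
  have "((\<lambda>u. g ((x + s *\<^sub>R b) + u *\<^sub>R b)) has_real_derivative g' (x + s *\<^sub>R b)) (at 0)"
    using assms[of "x + s *\<^sub>R b"] by (simp add: has_pd_def)
  then have "((\<lambda>u. g (x + (u + s) *\<^sub>R b)) has_real_derivative g' (x + s *\<^sub>R b)) (at 0)"
    by (simp add: algebra_simps)
  then show ?thesis using DERIV_shift[of "\<lambda>u. g (x + u *\<^sub>R b)" _ 0 s] by simp
qed

text \<open>The first partial derivative is required at the single point \<open>(x, x)\<close> only;
  continuity of the second one makes the function differentiable there as a function of two
  variables, and the chain rule along the diagonal applies. The asymmetry matters for integrals in
  which t is both an endpoint and a parameter.\<close>

lemma DERIV_diagonal:
  fixes f :: "real \<Rightarrow> real \<Rightarrow> real"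
  assumes X: "open X" "convex X" "x \<in> X"
    and fx: "((\<lambda>s. f s x) has_real_derivative d) (at x)"
    and ft: "\<And>s t. s \<in> X \<Longrightarrow> t \<in> X \<Longrightarrow> ((\<lambda>t. f s t) has_real_derivative ft s t) (at t)"
    and c: "continuous_on (X \<times> X) (\<lambda>(s, t). ft s t)"
  shows "((\<lambda>s. f s s) has_real_derivative (d + ft x x)) (at x)"
proof -
  have "((\<lambda>(s, t). f s t) has_derivative (\<lambda>(ts, tt). (\<lambda>h. d * h) ts + blinfun_mult_right (ft x x) tt)) (at (x, x) within X \<times> X)"
  proof (rule has_derivative_partialsI[where fy = "\<lambda>s t. blinfun_mult_right (ft s t)"])
    show "((\<lambda>s. f s x) has_derivative (\<lambda>h. d * h)) (at x within X)"
      using fx has_field_derivative_imp_has_derivative has_derivative_at_withinI by (metis has_field_derivative_def)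
    show "((\<lambda>y. f s y) has_derivative blinfun_apply (blinfun_mult_right (ft s t))) (at t within X)" if "s \<in> X" "t \<in> X" for s t
      using ft[OF that] has_derivative_at_withinI
      by (auto simp: has_field_derivative_def)
    have "continuous_on (X \<times> X) (\<lambda>(s, t). blinfun_mult_right (ft s t))"
      using bounded_linear.continuous_on[OF bounded_linear_blinfun_mult_right c]
      by (simp add: case_prod_unfold)
    then show "continuous (at (x, x) within X \<times> X) (\<lambda>(s, t). blinfun_mult_right (ft s t))"
      using X by (auto simp: continuous_on_eq_continuous_within)
  qed (use X in auto)
  then have D: "((\<lambda>(s, t). f s t) has_derivative (\<lambda>(ts, tt). d * ts + ft x x * tt)) (at (x, x))"
    using at_within_open[of "(x,x)" "X \<times> X"] X by (simp add: open_Times)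
  have "((\<lambda>s. (s, s)) has_derivative (\<lambda>h. (h, h))) (at x)"
    by (auto intro!: derivative_eq_intros)
  from has_derivative_compose[OF this D] have "((\<lambda>s. f s s) has_derivative (\<lambda>h. d * h + ft x x * h)) (at x)"
    by simp
  moreover have "(\<lambda>h. d * h + ft x x * h) = (*) (d + ft x x)" by (auto simp: algebra_simps)
  ultimately show ?thesis by (simp add: has_field_derivative_def)
qed

text \<open>Induction over the coordinates: the movement along the new coordinate and the movement
  along the previous ones get separate time variables, which \<open>DERIV_diagonal\<close> then
  identifies.\<close>

lemma directional_derivative_aux:
  fixes g :: "'a::euclidean_space \<Rightarrow> real"
  assumes B: "finite B" "B \<subseteq> Basis"
    and p: "\<And>b x. b \<in> Basis \<Longrightarrow> has_pd b g (g' b x) x"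
    and c: "\<And>b. b \<in> Basis \<Longrightarrow> continuous_on UNIV (g' b)"
  shows "((\<lambda>s. g (x + s *\<^sub>R (\<Sum>b\<in>B. (y \<bullet> b) *\<^sub>R b))) has_real_derivative
          (\<Sum>b\<in>B. (y \<bullet> b) * g' b (x + s *\<^sub>R (\<Sum>b\<in>B. (y \<bullet> b) *\<^sub>R b)))) (at s)"
  using B
proof (induction B arbitrary: x s rule: finite_induct)
  case (insert a F)
  let ?Y = "\<Sum>b\<in>F. (y \<bullet> b) *\<^sub>R b"
  let ?f = "\<lambda>s t. g (x + s *\<^sub>R ?Y + (t * (y \<bullet> a)) *\<^sub>R a)"
  have a: "a \<in> Basis" using insert by auto
  have 1: "((\<lambda>s. ?f s s) has_real_derivative
     ((\<Sum>b\<in>F. (y \<bullet> b) * g' b (x + (s * (y \<bullet> a)) *\<^sub>R a + s *\<^sub>R ?Y)) + (\<lambda>s t. (y \<bullet> a) * g' a (x + s *\<^sub>R ?Y + (t * (y \<bullet> a)) *\<^sub>R a)) s s)) (at s)"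
  proof (rule DERIV_diagonal[where X = UNIV and f = ?f and ft = "\<lambda>s t. (y \<bullet> a) * g' a (x + s *\<^sub>R ?Y + (t * (y \<bullet> a)) *\<^sub>R a)"])
    show "((\<lambda>u. ?f u s) has_real_derivative (\<Sum>b\<in>F. (y \<bullet> b) * g' b (x + (s * (y \<bullet> a)) *\<^sub>R a + s *\<^sub>R ?Y))) (at s)"
      using insert.IH[of "x + (s * (y \<bullet> a)) *\<^sub>R a" s] insert.prems by (simp add: algebra_simps)
    show "((\<lambda>t. ?f s t) has_real_derivative (y \<bullet> a) * g' a (x + s *\<^sub>R ?Y + (t * (y \<bullet> a)) *\<^sub>R a)) (at t)" for s t
    proof -
      have "((\<lambda>t. t * (y \<bullet> a)) has_real_derivative (y \<bullet> a)) (at t)" by (auto intro!: derivative_eq_intros)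
      from DERIV_chain2[OF has_pd_line[where b=a and g=g and g'="g' a" and x="x + s *\<^sub>R ?Y", OF p[OF a]] this] show ?thesis
        by (simp add: mult.commute)
    qed
    have "continuous_on UNIV (\<lambda>z::real\<times>real. g' a (x + fst z *\<^sub>R ?Y + (snd z * (y \<bullet> a)) *\<^sub>R a))"
      by (rule continuous_on_compose2[OF c[OF a]]) (auto intro!: continuous_intros)
    then show "continuous_on (UNIV \<times> UNIV) (\<lambda>(s, t). (y \<bullet> a) * g' a (x + s *\<^sub>R ?Y + (t * (y \<bullet> a)) *\<^sub>R a))"
      by (auto simp: case_prod_unfold intro!: continuous_intros)
  qed auto
  have 2: "x + s *\<^sub>R (\<Sum>b\<in>insert a F. (y \<bullet> b) *\<^sub>R b) = x + s *\<^sub>R ?Y + (s * (y \<bullet> a)) *\<^sub>R a" for s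
    using insert by (simp add: algebra_simps)
  show ?case using 1 insert.hyps unfolding 2 by (simp add: algebra_simps)
qed simp

lemma directional_derivative:
  fixes g :: "'a::euclidean_space \<Rightarrow> real"
  assumes p: "\<And>b x. b \<in> Basis \<Longrightarrow> has_pd b g (g' b x) x"
    and c: "\<And>b. b \<in> Basis \<Longrightarrow> continuous_on UNIV (g' b)"
  shows "((\<lambda>s. g (x + s *\<^sub>R y)) has_real_derivative (\<Sum>b\<in>Basis. (y \<bullet> b) * g' b (x + s *\<^sub>R y))) (at s)"
  using directional_derivative_aux[OF finite_Basis order_refl assms, of x y s]
  by (simp add: euclidean_representation)

lemma double_difference_mvt:
  fixes p :: "real \<Rightarrow> real \<Rightarrow> real"
  assumes t: "\<And>s t. ((\<lambda>t. p s t) has_real_derivative pt s t) (at t)"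
    and ts: "\<And>s t. ((\<lambda>s. pt s t) has_real_derivative pts s t) (at s)"
    and h: "h > 0"
  obtains \<xi> \<eta> where "0 < \<xi>" "\<xi> < h" "0 < \<eta>" "\<eta> < h" "p h h - p h 0 - p 0 h + p 0 0 = h * h * pts \<xi> \<eta>"
proof -
  have "((\<lambda>t. p h t - p 0 t) has_real_derivative pt h t - pt 0 t) (at t)" for t
    by (intro derivative_intros t)
  from MVT2[OF h, of "\<lambda>t. p h t - p 0 t" "\<lambda>t. pt h t - pt 0 t", OF this]
  obtain \<eta> where \<eta>: "0 < \<eta>" "\<eta> < h" "(p h h - p 0 h) - (p h 0 - p 0 0) = h * (pt h \<eta> - pt 0 \<eta>)" by auto
  from MVT2[OF h, of "\<lambda>s. pt s \<eta>" "\<lambda>s. pts s \<eta>", OF ts]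
  obtain \<xi> where \<xi>: "0 < \<xi>" "\<xi> < h" "pt h \<eta> - pt 0 \<eta> = h * pts \<xi> \<eta>" by auto
  show ?thesis by (rule that[of \<xi> \<eta>]) (use \<eta> \<xi> in \<open>simp_all add: algebra_simps\<close>)
qed

text \<open>The double difference over a square of side h is h^2 times either mixed derivative at
  some point of the square. Letting h tend to 0, continuity at the corner identifies the
  two.\<close>

lemma mixed_partials_real:
  fixes p :: "real \<Rightarrow> real \<Rightarrow> real"
  assumes t: "\<And>s t. ((\<lambda>t. p s t) has_real_derivative pt s t) (at t)"
    and ts: "\<And>s t. ((\<lambda>s. pt s t) has_real_derivative pts s t) (at s)"
    and s: "\<And>s t. ((\<lambda>s. p s t) has_real_derivative ps s t) (at s)"
    and st: "\<And>s t. ((\<lambda>t. ps s t) has_real_derivative pst s t) (at t)"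
    and c1: "continuous_on UNIV (\<lambda>(s, t). pts s t)" and c2: "continuous_on UNIV (\<lambda>(s, t). pst s t)"
  shows "pts 0 0 = pst 0 0"
proof -
  define H where "H n = inverse (real (Suc n))" for n
  have H0: "H n > 0" for n by (simp add: H_def)
  have Hl: "H \<longlonglongrightarrow> 0" using LIMSEQ_inverse_real_of_nat by (simp add: H_def[abs_def])
  have "\<forall>n. \<exists>\<xi> \<eta> \<xi>' \<eta>'. 0 < \<xi> \<and> \<xi> < H n \<and> 0 < \<eta> \<and> \<eta> < H n \<and> 0 < \<xi>' \<and> \<xi>' < H n \<and> 0 < \<eta>' \<and> \<eta>' < H n
       \<and> pts \<xi> \<eta> = pst \<xi>' \<eta>'"
  proof
    fix n
    obtain \<xi> \<eta> where 1: "0 < \<xi>" "\<xi> < H n" "0 < \<eta>" "\<eta> < H n"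
      "p (H n) (H n) - p (H n) 0 - p 0 (H n) + p 0 0 = H n * H n * pts \<xi> \<eta>"
      using double_difference_mvt[of p pt pts, OF t ts H0] by metis
    obtain \<eta>' \<xi>' where 2: "0 < \<xi>'" "\<xi>' < H n" "0 < \<eta>'" "\<eta>' < H n"
      "p (H n) (H n) - p 0 (H n) - p (H n) 0 + p 0 0 = H n * H n * pst \<xi>' \<eta>'"
      using double_difference_mvt[of "\<lambda>t s. p s t" "\<lambda>t s. ps s t" "\<lambda>t s. pst s t", OF s st H0] by metis
    have "H n * H n * pts \<xi> \<eta> = H n * H n * pst \<xi>' \<eta>'" using 1(5) 2(5) by linarith
    then have "pts \<xi> \<eta> = pst \<xi>' \<eta>'" using H0[of n] by simp
    then show "\<exists>\<xi> \<eta> \<xi>' \<eta>'. 0 < \<xi> \<and> \<xi> < H n \<and> 0 < \<eta> \<and> \<eta> < H n \<and> 0 < \<xi>' \<and> \<xi>' < H n \<and> 0 < \<eta>' \<and> \<eta>' < H n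
       \<and> pts \<xi> \<eta> = pst \<xi>' \<eta>'" using 1 2 by blast
  qed
  then obtain a b c d where *: "0 < a n" "a n < H n" "0 < b n" "b n < H n" "0 < c n" "c n < H n" "0 < d n" "d n < H n"
    "pts (a n) (b n) = pst (c n) (d n)" for n by metis
  have lim: "e \<longlonglongrightarrow> 0" if "\<And>n. 0 < e n" "\<And>n. e n < H n" for e
    by (rule tendsto_sandwich[OF _ _ tendsto_const Hl]) (auto intro!: always_eventually less_imp_le that)
  have "(\<lambda>n. (\<lambda>(s, t). pts s t) (a n, b n)) \<longlonglongrightarrow> (\<lambda>(s, t). pts s t) (0, 0)"
    by (rule continuous_on_tendsto_compose[OF c1]) (auto intro!: tendsto_Pair lim *)
  moreover have "(\<lambda>n. (\<lambda>(s, t). pst s t) (c n, d n)) \<longlonglongrightarrow> (\<lambda>(s, t). pst s t) (0, 0)"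
    by (rule continuous_on_tendsto_compose[OF c2]) (auto intro!: tendsto_Pair lim *)
  ultimately show ?thesis using * LIMSEQ_unique by auto
qed

lemma pdir_commute:
  fixes g :: "'a::euclidean_space \<Rightarrow> real"
  assumes g: "Ck 2 UNIV g" and ab: "a \<in> Basis" "b \<in> Basis"
  shows "pdir a (pdir b g) x = pdir b (pdir a g) x"
proof -
  have g1: "Ck (Suc (Suc 0)) UNIV g" using g by (simp add: numeral_2_eq_2)
  have pg: "Ck (Suc 0) UNIV (pdir c g)" if "c \<in> Basis" for c using g1 that by (simp add: Ck_Suc[of "Suc 0"])
  have cc: "continuous_on UNIV (pdir c (pdir c' g))" if "c \<in> Basis" "c' \<in> Basis" for c c'
    using pg[OF that(2)] that(1) by (auto simp: Ck_Suc Ck_0)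
  have com: "continuous_on UNIV (\<lambda>(s, t). k (x + s *\<^sub>R a + t *\<^sub>R b))" if "continuous_on UNIV k" for k :: "'a \<Rightarrow> real"
    unfolding case_prod_unfold by (rule continuous_on_compose2[OF that]) (auto intro!: continuous_intros)
  have l: "((\<lambda>s. k (y + s *\<^sub>R c)) has_real_derivative pdir c k (y + s *\<^sub>R c)) (at s)"
    if "Ck (Suc n) UNIV k" "c \<in> Basis" for k n c s y
    by (rule has_pd_line) (use that in \<open>auto intro: Ck_has_pd\<close>)
  have l': "((\<lambda>s. k (x + s *\<^sub>R a + t *\<^sub>R b)) has_real_derivative pdir a k (x + s *\<^sub>R a + t *\<^sub>R b)) (at s)"
    if "Ck (Suc n) UNIV k" for k n s t
    using l[OF that ab(1), of "x + t *\<^sub>R b" s] by (simp add: algebra_simps)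
  have "(\<lambda>s t. pdir a (pdir b g) (x + s *\<^sub>R a + t *\<^sub>R b)) 0 0 = (\<lambda>s t. pdir b (pdir a g) (x + s *\<^sub>R a + t *\<^sub>R b)) 0 0"
    by (rule mixed_partials_real[where p = "\<lambda>s t. g (x + s *\<^sub>R a + t *\<^sub>R b)"
          and pt = "\<lambda>s t. pdir b g (x + s *\<^sub>R a + t *\<^sub>R b)" and ps = "\<lambda>s t. pdir a g (x + s *\<^sub>R a + t *\<^sub>R b)"])
       (use l[OF g1] l'[OF g1] l[OF pg] l'[OF pg] ab com cc in auto)
  then show ?thesis by simp
qed

section \<open>Integrals depending on a parameter\<close>

text \<open>Dominated convergence along sequences. Continuity is asked for almost every
  \<open>y\<close> only, because the parameter will later include an endpoint of integration, where
  an indicator jumps.\<close>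

lemma lint_continuous_on:
  fixes F :: "'p::metric_space \<Rightarrow> 'b \<Rightarrow> real"
  assumes m: "\<And>p. p \<in> S \<Longrightarrow> F p \<in> borel_measurable M"
    and c: "\<And>p. p \<in> S \<Longrightarrow> AE y in M. continuous (at p within S) (\<lambda>p. F p y)"
    and b: "\<And>p0. p0 \<in> S \<Longrightarrow> \<exists>e>0. \<exists>g. integrable M g \<and> (\<forall>p\<in>S \<inter> ball p0 e. \<forall>y. \<bar>F p y\<bar> \<le> g y)"
  shows "continuous_on S (\<lambda>p. integral\<^sup>L M (F p))"
proof -
  have "((\<lambda>p. integral\<^sup>L M (F p)) \<longlongrightarrow> integral\<^sup>L M (F p0)) (at p0 within S)" if p0: "p0 \<in> S" for p0
  proof -
    obtain e g where e: "e > 0" and g: "integrable M g" and bd: "\<And>p y. p \<in> S \<inter> ball p0 e \<Longrightarrow> \<bar>F p y\<bar> \<le> g y"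
      using b[OF p0] by blast
    have w: "at p0 within S = at p0 within (S \<inter> ball p0 e)"
      by (rule at_within_nhd[where S = "ball p0 e"]) (use e in auto)
    show ?thesis unfolding w tendsto_at_iff_sequentially comp_def
    proof (intro allI impI)
      fix X assume X: "\<forall>i. X i \<in> S \<inter> ball p0 e - {p0}" and Xl: "X \<longlonglongrightarrow> p0"
      show "(\<lambda>i. integral\<^sup>L M (F (X i))) \<longlonglongrightarrow> integral\<^sup>L M (F p0)"
      proof (rule integral_dominated_convergence[where w = g])
        show "AE y in M. (\<lambda>i. F (X i) y) \<longlonglongrightarrow> F p0 y"
          using c[OF p0]
        proof eventually_elim
          case (elim y)
          then have "((\<lambda>p. F p y) \<longlongrightarrow> F p0 y) (at p0 within S)" by (simp add: continuous_within)
          then show ?case unfolding tendsto_at_iff_sequentially comp_def using X Xl by blast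
        qed
      qed (use X p0 m g bd in auto)
    qed
  qed
  then show ?thesis by (simp add: continuous_on_def)
qed

lemma lint_has_derivative:
  fixes F :: "real \<Rightarrow> 'b \<Rightarrow> real"
  assumes e: "e > 0"
    and i: "\<And>s. \<bar>s - s0\<bar> < e \<Longrightarrow> integrable M (F s)"
    and d: "\<And>s y. \<bar>s - s0\<bar> < e \<Longrightarrow> ((\<lambda>s. F s y) has_real_derivative F' s y) (at s)"
    and b: "\<And>s y. \<bar>s - s0\<bar> < e \<Longrightarrow> \<bar>F' s y\<bar> \<le> g y"
    and g: "integrable M g" and m: "F' s0 \<in> borel_measurable M"
  shows "((\<lambda>s. integral\<^sup>L M (F s)) has_real_derivative integral\<^sup>L M (F' s0)) (at s0)"
proof -
  have w: "at s0 within UNIV = at s0 within ball s0 e"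
    by (rule at_within_nhd[where S = "ball s0 e"]) (use e in auto)
  \<comment> \<open>By the mean value theorem every difference quotient is a value of the derivative
    at a nearby parameter, so the bound on the derivative also dominates the quotients.\<close>
  have q: "\<bar>(F s y - F s0 y) / (s - s0)\<bar> \<le> g y" if s: "\<bar>s - s0\<bar> < e" "s \<noteq> s0" for s y
  proof -
    have "\<exists>z. \<bar>z - s0\<bar> < e \<and> F s y - F s0 y = (s - s0) * F' z y"
    proof (cases "s0 < s")
      case True
      obtain z where "s0 < z" "z < s" "F s y - F s0 y = (s - s0) * F' z y"
        using MVT2[OF True, of "\<lambda>s. F s y" "\<lambda>s. F' s y"] d s True by auto
      then show ?thesis using s by (intro exI[of _ z]) auto
    next
      case False
      then have lt: "s < s0" using s by auto
      obtain z where "s < z" "z < s0" "F s0 y - F s y = (s0 - s) * F' z y"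
        using MVT2[OF lt, of "\<lambda>s. F s y" "\<lambda>s. F' s y"] d s lt by auto
      then show ?thesis using s by (intro exI[of _ z]) (auto simp: algebra_simps)
    qed
    then obtain z where "\<bar>z - s0\<bar> < e" "F s y - F s0 y = (s - s0) * F' z y" by blast
    then show ?thesis using b[of z y] s by simp
  qed
  have "((\<lambda>s. (integral\<^sup>L M (F s) - integral\<^sup>L M (F s0)) / (s - s0)) \<longlongrightarrow> integral\<^sup>L M (F' s0)) (at s0)"
    unfolding w tendsto_at_iff_sequentially comp_def
  proof (intro allI impI)
    fix X assume X: "\<forall>i. X i \<in> ball s0 e - {s0}" and Xl: "X \<longlonglongrightarrow> s0"
    have Xe: "\<bar>X i - s0\<bar> < e" "X i \<noteq> s0" for i using X[rule_format, of i] by (auto simp: dist_real_def)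
    have lim: "(\<lambda>i. \<integral>y. (F (X i) y - F s0 y) / (X i - s0) \<partial>M) \<longlonglongrightarrow> integral\<^sup>L M (F' s0)"
    proof (rule integral_dominated_convergence[where w = g])
      show "AE y in M. (\<lambda>i. (F (X i) y - F s0 y) / (X i - s0)) \<longlonglongrightarrow> F' s0 y"
      proof (rule AE_I2)
        fix y
        have "((\<lambda>s. (F s y - F s0 y) / (s - s0)) \<longlongrightarrow> F' s0 y) (at s0)"
          using d[of s0 y] e by (simp add: has_field_derivative_iff)
        then show "(\<lambda>i. (F (X i) y - F s0 y) / (X i - s0)) \<longlonglongrightarrow> F' s0 y"
          unfolding tendsto_at_iff_sequentially comp_def using Xe Xl by auto
      qed
    qed (use q Xe i[of s0] i[OF Xe(1)] e m g in auto)
    have eq: "(\<integral>y. (F (X i) y - F s0 y) / (X i - s0) \<partial>M) = (integral\<^sup>L M (F (X i)) - integral\<^sup>L M (F s0)) / (X i - s0)" for i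
      using i[of s0] i[OF Xe(1)] e by simp
    show "(\<lambda>i. (integral\<^sup>L M (F (X i)) - integral\<^sup>L M (F s0)) / (X i - s0)) \<longlonglongrightarrow> integral\<^sup>L M (F' s0)"
      using lim unfolding eq .
  qed
  then show ?thesis by (simp add: has_field_derivative_iff)
qed

section \<open>Weighted integrals over the unit ball\<close>

definition ball_weight :: "('a::euclidean_space \<Rightarrow> real) \<Rightarrow> bool" where
  "ball_weight q \<longleftrightarrow> q \<in> borel_measurable borel \<and> (\<exists>C. \<forall>y. \<bar>q y\<bar> \<le> C * indicator (cball 0 1) y)"

text \<open>A weight needs no continuity: in odd dimension the one used below is the indicator
  function of the open unit ball.\<close>

lemma ball_weight_bound: "ball_weight q \<Longrightarrow> \<exists>C\<ge>0. \<forall>y. \<bar>q y\<bar> \<le> C * indicator (cball 0 1) y"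
proof -
  assume "ball_weight q"
  then obtain C where C: "\<And>y. \<bar>q y\<bar> \<le> C * indicator (cball 0 1) y" by (auto simp: ball_weight_def)
  have "C \<ge> 0" using C[of 0] by simp
  with C show ?thesis by auto
qed

lemma ball_weight_mult_coord: "ball_weight q \<Longrightarrow> b \<in> Basis \<Longrightarrow> ball_weight (\<lambda>y. (y \<bullet> b) * q y)"
proof -
  assume a: "ball_weight q" and b: "b \<in> Basis"
  obtain C where C: "C \<ge> 0" "\<And>y. \<bar>q y\<bar> \<le> C * indicator (cball 0 1) y" using ball_weight_bound[OF a] by auto
  have "\<bar>(y \<bullet> b) * q y\<bar> \<le> C * indicator (cball 0 1) y" for y
  proof (cases "y \<in> cball 0 1")
    case True
    have "\<bar>y \<bullet> b\<bar> \<le> 1" using Basis_le_norm[OF b, of y] True by simp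
    then have "\<bar>y \<bullet> b\<bar> * \<bar>q y\<bar> \<le> 1 * C" using C(2)[of y] True by (intro mult_mono) auto
    then show ?thesis using True by (simp add: abs_mult)
  qed (use C(2)[of y] in auto)
  then show ?thesis using a by (auto simp: ball_weight_def)
qed

lemma integrable_indicator_cball: "integrable lborel (\<lambda>y::'a::euclidean_space. c * indicator (cball 0 d) y :: real)"
  by (intro integrable_mult_right integrable_real_indicator) (use emeasure_bounded_finite[OF bounded_cball[of "0::'a" d]] in \<open>simp_all add: top.not_eq_extremum\<close>)

lemma ball_weight_integrable:
  assumes q: "ball_weight q" and k: "continuous_on UNIV k"
  shows "integrable lborel (\<lambda>y::'a::euclidean_space. q y * k y)"
proof -
  obtain C where C: "C \<ge> 0" "\<And>y. \<bar>q y\<bar> \<le> C * indicator (cball 0 1) y" using ball_weight_bound[OF q] by auto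
  have "compact (k ` cball 0 1)" using k by (intro compact_continuous_image) (auto intro: continuous_on_subset)
  then obtain B where B: "\<And>y. y \<in> cball 0 1 \<Longrightarrow> \<bar>k y\<bar> \<le> B"
    using compact_imp_bounded bounded_iff by (metis image_eqI real_norm_def)
  have m: "q \<in> borel_measurable borel" "k \<in> borel_measurable borel"
    using q k by (auto simp: ball_weight_def intro: borel_measurable_continuous_onI)
  show ?thesis
  proof (rule Bochner_Integration.integrable_bound[OF integrable_indicator_cball[of "C * B" 1]])
    show "AE y in lborel. norm (q y * k y) \<le> norm (C * B * indicator (cball 0 1) y)"
    proof (rule AE_I2)
      fix y :: 'a
      show "norm (q y * k y) \<le> norm (C * B * indicator (cball 0 1) y)"
      proof (cases "y \<in> cball 0 1")
        case True
        then have "\<bar>q y\<bar> * \<bar>k y\<bar> \<le> C * B" using C(2)[of y] B[OF True] C(1) by (intro mult_mono) auto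
        then show ?thesis using True by (simp add: abs_mult) (metis abs_ge_self abs_mult order_trans)
      qed (use C(2)[of y] in auto)
    qed
  qed (use m in auto)
qed

lemma bounded_on_tube:
  fixes k :: "'a::euclidean_space \<times> real \<Rightarrow> real"
  assumes k: "continuous_on (UNIV \<times> L) k" and L: "open L" "l0 \<in> L"
  obtains e B where "e > 0" "e \<le> 1" "\<And>x r l y. dist x x0 < e \<Longrightarrow> \<bar>r - r0\<bar> < e \<Longrightarrow> \<bar>l - l0\<bar> < e \<Longrightarrow> y \<in> cball 0 1 \<Longrightarrow>
      l \<in> L \<and> \<bar>k (x + r *\<^sub>R y, l)\<bar> \<le> B"
proof -
  obtain e0 where e0: "e0 > 0" "cball l0 e0 \<subseteq> L" using L open_contains_cball by blast
  define e where "e = min e0 1"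
  have e: "e > 0" "e \<le> 1" "cball l0 e \<subseteq> L" using e0 by (auto simp: e_def)
  have "compact (k ` (cball x0 (2 + \<bar>r0\<bar>) \<times> cball l0 e))"
    using e by (intro compact_continuous_image continuous_on_subset[OF k] compact_Times) auto
  then obtain B where B: "\<And>z. z \<in> cball x0 (2 + \<bar>r0\<bar>) \<times> cball l0 e \<Longrightarrow> \<bar>k z\<bar> \<le> B"
    using compact_imp_bounded bounded_iff by (metis image_eqI real_norm_def)
  show ?thesis
  proof (rule that[OF e(1,2), of B])
    fix x r l and y :: 'a
    assume *: "dist x x0 < e" "\<bar>r - r0\<bar> < e" "\<bar>l - l0\<bar> < e" "y \<in> cball 0 1"
    have "norm (x + r *\<^sub>R y - x0) \<le> norm (x - x0) + \<bar>r\<bar> * norm y"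
      using norm_triangle_ineq[of "x - x0" "r *\<^sub>R y"] by (simp add: algebra_simps)
    also have "\<dots> \<le> 1 + (\<bar>r0\<bar> + 1) * 1" using * e by (intro add_mono mult_mono) (auto simp: dist_norm)
    finally have "x + r *\<^sub>R y \<in> cball x0 (2 + \<bar>r0\<bar>)" by (simp add: dist_norm norm_minus_commute)
    moreover have "l \<in> cball l0 e" using * by (simp add: dist_real_def)
    ultimately show "l \<in> L \<and> \<bar>k (x + r *\<^sub>R y, l)\<bar> \<le> B" using B e by blast
  qed
qed

lemma ball_average_continuous:
  fixes k :: "'a::euclidean_space \<times> real \<Rightarrow> real"
  assumes q: "ball_weight q" and k: "continuous_on (UNIV \<times> L) k" and L: "open L"
  shows "continuous_on (UNIV \<times> UNIV \<times> L) (\<lambda>(x, r, l). \<integral>y. q y * k (x + r *\<^sub>R y, l) \<partial>lborel)"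
  unfolding case_prod_unfold
proof (rule lint_continuous_on)
  obtain C where C: "C \<ge> 0" "\<And>y. \<bar>q y\<bar> \<le> C * indicator (cball 0 1) y" using ball_weight_bound[OF q] by auto
  fix p :: "'a \<times> real \<times> real" assume p: "p \<in> UNIV \<times> UNIV \<times> L"
  have "continuous_on UNIV (\<lambda>y. k (fst p + fst (snd p) *\<^sub>R y, snd (snd p)))"
    by (rule continuous_on_compose2[OF k]) (use p in \<open>auto intro!: continuous_intros\<close>)
  then have "integrable lborel (\<lambda>y. q y * k (fst p + fst (snd p) *\<^sub>R y, snd (snd p)))" by (rule ball_weight_integrable[OF q])
  then show "(\<lambda>y. q y * k (fst p + fst (snd p) *\<^sub>R y, snd (snd p))) \<in> borel_measurable lborel" by (rule borel_measurable_integrable)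
  have "continuous_on (UNIV \<times> UNIV \<times> L) (\<lambda>p. k (fst p + fst (snd p) *\<^sub>R y, snd (snd p)))" for y
    by (rule continuous_on_compose2[OF k]) (auto intro!: continuous_intros)
  then show "AE y in lborel. continuous (at p within UNIV \<times> UNIV \<times> L) (\<lambda>p. q y * k (fst p + fst (snd p) *\<^sub>R y, snd (snd p)))"
    using p by (intro AE_I2 continuous_intros) (auto simp: continuous_on_eq_continuous_within)
  obtain x0 r0 l0 where p': "p = (x0, r0, l0)" by (cases p) auto
  obtain e B where eB: "e > 0" "\<And>x r l y. dist x x0 < e \<Longrightarrow> \<bar>r - r0\<bar> < e \<Longrightarrow> \<bar>l - l0\<bar> < e \<Longrightarrow> y \<in> cball 0 1 \<Longrightarrow>
      l \<in> L \<and> \<bar>k (x + r *\<^sub>R y, l)\<bar> \<le> B"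
    by (rule bounded_on_tube[OF k L, of l0 x0 r0]) (use p p' in auto)
  show "\<exists>e>0. \<exists>g. integrable lborel g \<and> (\<forall>p\<in>UNIV \<times> UNIV \<times> L \<inter> ball p e. \<forall>y. \<bar>q y * k (fst p + fst (snd p) *\<^sub>R y, snd (snd p))\<bar> \<le> g y)"
  proof (intro exI[of _ e] conjI eB(1) exI[of _ "\<lambda>y. C * B * indicator (cball 0 1) y"] integrable_indicator_cball ballI allI)
    fix p' and y :: 'a assume "p' \<in> UNIV \<times> UNIV \<times> L \<inter> ball p e"
    moreover obtain x r l where p1: "p' = (x, r, l)" by (cases p') auto
    ultimately have d: "dist (x0, r0, l0) (x, r, l) < e" using p' by auto
    have d1: "dist x x0 < e" using dist_fst_le[of "(x0, r0, l0)" "(x, r, l)"] d by (simp add: dist_commute)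
    have d2: "dist (r0, l0) (r, l) < e" using dist_snd_le[of "(x0, r0, l0)" "(x, r, l)"] d by simp
    have d3: "\<bar>r - r0\<bar> < e" "\<bar>l - l0\<bar> < e"
      using dist_fst_le[of "(r0, l0)" "(r, l)"] dist_snd_le[of "(r0, l0)" "(r, l)"] d2 by (auto simp: dist_real_def)
    show "\<bar>q y * k (fst p' + fst (snd p') *\<^sub>R y, snd (snd p'))\<bar> \<le> C * B * indicator (cball 0 1) y"
    proof (cases "y \<in> cball 0 1")
      case True
      then have "\<bar>q y\<bar> * \<bar>k (x + r *\<^sub>R y, l)\<bar> \<le> C * B" using C(2)[of y] eB(2)[OF d1 d3 True] C(1) by (intro mult_mono) auto
      then show ?thesis using True p1 by (simp add: abs_mult)
    qed (use C(2)[of y] in auto)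
  qed
qed

lemma ball_average_derivative:
  fixes k :: "'a::euclidean_space \<Rightarrow> real"
  assumes q: "ball_weight q" and k: "continuous_on UNIV k"
    and d: "\<And>y s. y \<in> cball 0 1 \<Longrightarrow> ((\<lambda>s. k (X s + R s *\<^sub>R y)) has_real_derivative k' s y) (at s)"
    and c: "continuous_on UNIV (\<lambda>(s, y). k' s y)"
  shows "((\<lambda>s. \<integral>y. q y * k (X s + R s *\<^sub>R y) \<partial>lborel) has_real_derivative (\<integral>y. q y * k' s0 y \<partial>lborel)) (at s0)"
proof -
  obtain C where C: "C \<ge> 0" "\<And>y. \<bar>q y\<bar> \<le> C * indicator (cball 0 1) y" using ball_weight_bound[OF q] by auto
  have "compact ((\<lambda>(s, y). k' s y) ` (cball s0 1 \<times> cball 0 1))"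
    by (intro compact_continuous_image continuous_on_subset[OF c] compact_Times) auto
  then obtain B where B: "\<And>z. z \<in> cball s0 1 \<times> cball 0 1 \<Longrightarrow> \<bar>(\<lambda>(s, y). k' s y) z\<bar> \<le> B"
    using compact_imp_bounded bounded_iff by (metis image_eqI real_norm_def)
  have q0: "q y = 0" if "y \<notin> cball 0 1" for y using C(2)[of y] that by auto
  show ?thesis
  proof (rule lint_has_derivative[where e = 1 and g = "\<lambda>y. C * B * indicator (cball 0 1) y"])
    show "integrable lborel (\<lambda>y. q y * k (X s + R s *\<^sub>R y))" for s
      by (rule ball_weight_integrable[OF q], rule continuous_on_compose2[OF k]) (auto intro!: continuous_intros)
    show "((\<lambda>s. q y * k (X s + R s *\<^sub>R y)) has_real_derivative q y * k' s y) (at s)" for s y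
    proof (cases "y \<in> cball 0 1")
      case True then show ?thesis by (intro DERIV_cmult d)
    next
      case False then show ?thesis by (simp add: q0)
    qed
    have "continuous_on UNIV (\<lambda>y. (\<lambda>(s, y). k' s y) (s0, y))"
      by (rule continuous_on_compose2[OF c]) (auto intro!: continuous_intros)
    from ball_weight_integrable[OF q this] show "(\<lambda>y. q y * k' s0 y) \<in> borel_measurable lborel" by auto
    show "\<bar>q y * k' s y\<bar> \<le> C * B * indicator (cball 0 1) y" if "\<bar>s - s0\<bar> < 1" for s y
    proof (cases "y \<in> cball 0 1")
      case True
      then have "\<bar>q y\<bar> * \<bar>k' s y\<bar> \<le> C * B"
        using C(2)[of y] B[of "(s, y)"] C(1) that by (intro mult_mono) (auto simp: dist_real_def abs_minus_commute)
      then show ?thesis using True by (simp add: abs_mult)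
    qed (simp add: q0)
  qed (rule integrable_indicator_cball | simp)+
qed

section \<open>Integration by parts through translation invariance\<close>

lemma lborel_integral_translation:
  fixes X :: "'a::euclidean_space \<Rightarrow> real"
  shows "(\<integral>y. X (y + c) \<partial>lborel) = (\<integral>y. X y \<partial>lborel)"
proof (cases "X \<in> borel_measurable borel")
  case True
  have "(\<integral>y. X y \<partial>lborel) = (\<integral>y. X y \<partial>(distr lborel borel ((+) c)))" by (simp add: lborel_distr_plus)
  also have "\<dots> = (\<integral>y. X (c + y) \<partial>lborel)" by (rule integral_distr) (use True in auto)
  finally show ?thesis by (simp add: add.commute)
next
  case False
  \<comment> \<open>Measurability is invariant under translation, so in this case neither function
    is integrable and both integrals have the default value 0.\<close>
  have "(\<lambda>y. X (y + c)) \<notin> borel_measurable borel"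
  proof
    assume "(\<lambda>y. X (y + c)) \<in> borel_measurable borel"
    then have "(\<lambda>y. (\<lambda>y. X (y + c)) (y - c)) \<in> borel_measurable borel" by measurable
    then show False using False by simp
  qed
  then have "\<not> integrable lborel (\<lambda>y. X (y + c))" "\<not> integrable lborel X"
    using False by (auto dest: borel_measurable_integrable)
  then show ?thesis by (simp add: not_integrable_integral_eq)
qed

text \<open>The integral of \<open>X (y + s *\<^sub>R b)\<close> does not depend on s.
  Differentiating it under the integral sign at s = 0 gives the claim without iterated
  integrals.\<close>

lemma lborel_integral_partial_zero:
  fixes X :: "'a::euclidean_space \<Rightarrow> real"
  assumes p: "\<And>y. has_pd b X (X' y) y" and c: "continuous_on UNIV X" and c': "continuous_on UNIV X'"
    and s: "\<And>y. y \<notin> cball 0 A \<Longrightarrow> X y = 0" "\<And>y. y \<notin> cball 0 A \<Longrightarrow> X' y = 0"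
  shows "(\<integral>y. X' y \<partial>lborel) = 0" "integrable lborel X'"
proof -
  \<comment> \<open>A ball of this radius contains the supports of all translates with |s| <
    1.\<close>
  define D where "D = \<bar>A\<bar> + norm b"
  have i: "integrable lborel (\<lambda>y. Z y)" if "continuous_on UNIV Z" "\<And>y. y \<notin> cball 0 E \<Longrightarrow> Z y = 0" for Z :: "'a \<Rightarrow> real" and E
  proof -
    have "integrable lborel (\<lambda>y. indicator (cball 0 E) y *\<^sub>R Z y)"
      using that by (intro borel_integrable_compact) (auto intro: continuous_on_subset)
    moreover have "(\<lambda>y. indicator (cball 0 E) y *\<^sub>R Z y) = Z" using that by (auto simp: fun_eq_iff indicator_def)
    ultimately show ?thesis by simp
  qed
  show "integrable lborel X'" by (rule i[OF c' s(2)])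
  have "compact (X' ` cball 0 A)" using c' by (intro compact_continuous_image) (auto intro: continuous_on_subset)
  then obtain B where B: "\<And>y. y \<in> cball 0 A \<Longrightarrow> \<bar>X' y\<bar> \<le> B"
    using compact_imp_bounded bounded_iff by (metis image_eqI real_norm_def)
  have B': "\<bar>X' y\<bar> \<le> \<bar>B\<bar>" for y using B[of y] s(2)[of y] by (cases "y \<in> cball 0 A") auto
  have d1: "((\<lambda>s. \<integral>y. X (y + s *\<^sub>R b) \<partial>lborel) has_real_derivative (\<integral>y. X' (y + 0 *\<^sub>R b) \<partial>lborel)) (at 0)"
  proof (rule lint_has_derivative[where e = 1 and g = "\<lambda>y. \<bar>B\<bar> * indicator (cball 0 D) y" and F' = "\<lambda>s y. X' (y + s *\<^sub>R b)"])
    fix s :: real assume s1: "\<bar>s - 0\<bar> < 1"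
    have z: "y + s *\<^sub>R b \<notin> cball 0 A" if "y \<notin> cball 0 D" for y
    proof
      assume "y + s *\<^sub>R b \<in> cball 0 A"
      then have "norm (y + s *\<^sub>R b) \<le> \<bar>A\<bar>" by auto
      moreover have "norm y \<le> norm (y + s *\<^sub>R b) + \<bar>s\<bar> * norm b"
        using norm_triangle_ineq4[of "y + s *\<^sub>R b" "s *\<^sub>R b"] by simp
      moreover have "\<bar>s\<bar> * norm b \<le> 1 * norm b" using s1 by (intro mult_right_mono) auto
      ultimately show False using that by (simp add: D_def)
    qed
    show "integrable lborel (\<lambda>y. X (y + s *\<^sub>R b))"
      by (rule i[where E = D], rule continuous_on_compose2[OF c]) (auto intro!: continuous_intros s z)
    show "((\<lambda>s. X (y + s *\<^sub>R b)) has_real_derivative X' (y + s *\<^sub>R b)) (at s)" for y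
      by (rule has_pd_line[OF p])
    show "\<bar>X' (y + s *\<^sub>R b)\<bar> \<le> \<bar>B\<bar> * indicator (cball 0 D) y" for y
      using B'[of "y + s *\<^sub>R b"] s(2)[OF z, of y] by (cases "y \<in> cball 0 D") auto
  next
    show "integrable lborel (\<lambda>y::'a. \<bar>B\<bar> * indicator (cball 0 D) y :: real)" by (rule integrable_indicator_cball)
    show "(\<lambda>y. X' (y + 0 *\<^sub>R b)) \<in> borel_measurable lborel"
      using c' by (auto intro: borel_measurable_continuous_onI)
  qed simp
  have tr: "(\<lambda>s. \<integral>y. X (y + s *\<^sub>R b) \<partial>lborel) = (\<lambda>s. \<integral>y. X y \<partial>lborel)"
    by (rule ext) (rule lborel_integral_translation)
  have d0: "((\<lambda>s. \<integral>y. X (y + s *\<^sub>R b) \<partial>lborel) has_real_derivative 0) (at 0)"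
    unfolding tr by simp
  have "(\<integral>y. X' (y + 0 *\<^sub>R b) \<partial>lborel) = 0" by (rule DERIV_unique[OF d1 d0])
  then show "(\<integral>y. X' y \<partial>lborel) = 0" by simp
qed

section \<open>Weighted averages over balls\<close>

definition avg :: "'a::euclidean_space list \<Rightarrow> ('a \<Rightarrow> real) \<Rightarrow> ('a \<Rightarrow> real) \<Rightarrow> 'a \<Rightarrow> real \<Rightarrow> real" where
  "avg bs q h x r = (\<integral>y. q y * diter bs h (x + r *\<^sub>R y) \<partial>lborel)"

text \<open>Operators acting on the data \<open>h\<close>. Differentiating \<open>A h\<close> in space or in \<open>r\<close> stays in the class and raises the
  order \<open>N\<close> by one, so regularity, continuity in parameters and bounds of all derivatives of a wave are read off from \<open>N\<close>.\<close>

inductive avgop :: "nat \<Rightarrow> (('a::euclidean_space \<Rightarrow> real) \<Rightarrow> 'a \<Rightarrow> real \<Rightarrow> real) \<Rightarrow> bool" where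
  avg: "ball_weight q \<Longrightarrow> set bs \<subseteq> Basis \<Longrightarrow> length bs \<le> N \<Longrightarrow> avgop N (avg bs q)"
| add: "avgop N A \<Longrightarrow> avgop N B \<Longrightarrow> avgop N (\<lambda>h x r. A h x r + B h x r)"
| scale: "avgop N A \<Longrightarrow> avgop N (\<lambda>h x r. c * A h x r)"
| mult_r: "avgop N A \<Longrightarrow> avgop N (\<lambda>h x r. r * A h x r)"

lemma avgop_mono: "avgop N A \<Longrightarrow> N \<le> M \<Longrightarrow> avgop M A"
  by (induction rule: avgop.induct) (auto intro: avgop.intros)

lemma avgop_zero: "avgop N (\<lambda>h x r. 0)"
proof -
  have "ball_weight (\<lambda>y. 0)" by (auto simp: ball_weight_def intro: exI[of _ 0])
  then have "avgop N (\<lambda>h x r. 0 * avg [] (\<lambda>y. 0) h x r)" by (intro avgop.intros) auto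
  then show ?thesis by simp
qed

lemma avgop_sum: "finite I \<Longrightarrow> (\<And>i. i \<in> I \<Longrightarrow> avgop N (A i)) \<Longrightarrow> avgop N (\<lambda>h x r. \<Sum>i\<in>I. A i h x r)"
proof (induction I rule: finite_induct)
  case empty then show ?case by (simp add: avgop_zero)
next
  case (insert i I)
  then have "avgop N (\<lambda>h x r. A i h x r + (\<Sum>i\<in>I. A i h x r))" by (intro avgop.add) auto
  then show ?case using insert by simp
qed

lemma Ck_diter_continuous: "Ck k S g \<Longrightarrow> set bs \<subseteq> Basis \<Longrightarrow> length bs \<le> k \<Longrightarrow> continuous_on S (diter bs g)"
  by (auto simp: Ck_def)

lemma avgop_continuous:
  fixes h :: "real \<Rightarrow> 'a::euclidean_space \<Rightarrow> real"
  assumes "avgop N A" "open L"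
    and "\<And>bs. set bs \<subseteq> Basis \<Longrightarrow> length bs \<le> N \<Longrightarrow> continuous_on (UNIV \<times> L) (\<lambda>(y, l). diter bs (h l) y)"
  shows "continuous_on (UNIV \<times> UNIV \<times> L) (\<lambda>(x, r, l). A (h l) x r)"
  using assms
proof (induction rule: avgop.induct)
  case (avg q bs N)
  show ?case unfolding avg_def using ball_average_continuous[OF avg(1) avg(5)[OF avg(2,3)] avg(4)] by simp
qed (auto simp: case_prod_unfold intro!: continuous_intros)

text \<open>The constant depends on the operator and on \<open>R\<close> only, so a bound on data
  that vary with l carries over with the same dependence on l. That only points within
  \<open>R\<close> of \<open>x\<close> enter reflects the finite speed of propagation.\<close>

lemma avgop_bound:
  fixes A :: "('a::euclidean_space \<Rightarrow> real) \<Rightarrow> 'a \<Rightarrow> real \<Rightarrow> real"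
  assumes "avgop N A"
  shows "\<exists>C\<ge>0. \<forall>h x r B. 0 \<le> B \<longrightarrow> \<bar>r\<bar> \<le> R \<longrightarrow> Ck N UNIV h \<longrightarrow>
     (\<forall>bs y. set bs \<subseteq> Basis \<longrightarrow> length bs \<le> N \<longrightarrow> y \<in> cball x R \<longrightarrow> \<bar>diter bs h y\<bar> \<le> B) \<longrightarrow> \<bar>A h x r\<bar> \<le> C * B"
  using assms
proof (induction rule: avgop.induct)
  case (avg q bs N)
  obtain C where C: "C \<ge> 0" "\<And>y. \<bar>q y\<bar> \<le> C * indicator (cball 0 1) y" using ball_weight_bound[OF avg(1)] by auto
  define V where "V = (integral\<^sup>L lborel (indicator (cball (0::'a) 1)) :: real)"
  have V: "V \<ge> 0" unfolding V_def by simp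
  have "\<bar>avg bs q h x r\<bar> \<le> C * V * B"
    if *: "0 \<le> B" "\<bar>r\<bar> \<le> R" "Ck N UNIV h" "\<And>bs y. set bs \<subseteq> Basis \<Longrightarrow> length bs \<le> N \<Longrightarrow> y \<in> cball x R \<Longrightarrow> \<bar>diter bs h y\<bar> \<le> B"
    for h :: "'a \<Rightarrow> real" and x r B
  proof -
    have "continuous_on UNIV (diter bs h)" using *(3) avg by (intro Ck_diter_continuous)
    then have c: "continuous_on UNIV (\<lambda>y. diter bs h (x + r *\<^sub>R y))"
      by (rule continuous_on_compose2) (auto intro!: continuous_intros)
    have "\<bar>avg bs q h x r\<bar> \<le> (\<integral>y. (C * B) * indicator (cball (0::'a) 1) y \<partial>lborel)"
      unfolding avg_def
    proof (rule integral_abs_bound_integral)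
      show "integrable lborel (\<lambda>y. q y * diter bs h (x + r *\<^sub>R y))"
        by (rule ball_weight_integrable[OF avg(1) c])
      fix y :: 'a
      show "\<bar>q y * diter bs h (x + r *\<^sub>R y)\<bar> \<le> C * B * indicator (cball 0 1) y"
      proof (cases "y \<in> cball 0 1")
        case True
        have "\<bar>r\<bar> * norm y \<le> R * 1" using True *(2) by (intro mult_mono) auto
        then have "x + r *\<^sub>R y \<in> cball x R" by (simp add: dist_norm)
        then have "\<bar>diter bs h (x + r *\<^sub>R y)\<bar> \<le> B" using avg by (intro *(4)) auto
        then have "\<bar>q y\<bar> * \<bar>diter bs h (x + r *\<^sub>R y)\<bar> \<le> C * B" using C(2)[of y] True C(1) by (intro mult_mono) auto
        then show ?thesis using True by (simp add: abs_mult)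
      qed (use C(2)[of y] in auto)
    qed (rule integrable_indicator_cball)
    also have "\<dots> = C * V * B" by (simp add: V_def)
    finally show ?thesis .
  qed
  then show ?case using C(1) V by (intro exI[of _ "C * V"]) auto
next
  case (add N A B)
  then obtain C1 C2 where C: "C1 \<ge> 0" "C2 \<ge> 0"
    "\<And>h x r b. 0 \<le> b \<Longrightarrow> \<bar>r\<bar> \<le> R \<Longrightarrow> Ck N UNIV h \<Longrightarrow>
     (\<forall>bs y. set bs \<subseteq> Basis \<longrightarrow> length bs \<le> N \<longrightarrow> y \<in> cball x R \<longrightarrow> \<bar>diter bs h y\<bar> \<le> b) \<Longrightarrow> \<bar>A h x r\<bar> \<le> C1 * b"
    "\<And>h x r b. 0 \<le> b \<Longrightarrow> \<bar>r\<bar> \<le> R \<Longrightarrow> Ck N UNIV h \<Longrightarrow>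
     (\<forall>bs y. set bs \<subseteq> Basis \<longrightarrow> length bs \<le> N \<longrightarrow> y \<in> cball x R \<longrightarrow> \<bar>diter bs h y\<bar> \<le> b) \<Longrightarrow> \<bar>B h x r\<bar> \<le> C2 * b"
    by metis
  show ?case
  proof (intro exI[of _ "C1 + C2"] conjI allI impI)
    fix h :: "'a \<Rightarrow> real" and x r b assume *: "0 \<le> (b::real)" "\<bar>r\<bar> \<le> R" "Ck N UNIV h"
     "\<forall>bs y. set bs \<subseteq> Basis \<longrightarrow> length bs \<le> N \<longrightarrow> y \<in> cball x R \<longrightarrow> \<bar>diter bs h y\<bar> \<le> b"
    show "\<bar>A h x r + B h x r\<bar> \<le> (C1 + C2) * b"
      using C(3)[OF *] C(4)[OF *] by (simp add: algebra_simps)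
  qed (use C in auto)
next
  case (scale N A c)
  then obtain C where C: "C \<ge> 0" 
    "\<And>h x r b. 0 \<le> b \<Longrightarrow> \<bar>r\<bar> \<le> R \<Longrightarrow> Ck N UNIV h \<Longrightarrow>
     (\<forall>bs y. set bs \<subseteq> Basis \<longrightarrow> length bs \<le> N \<longrightarrow> y \<in> cball x R \<longrightarrow> \<bar>diter bs h y\<bar> \<le> b) \<Longrightarrow> \<bar>A h x r\<bar> \<le> C * b"
    by metis
  show ?case
  proof (intro exI[of _ "\<bar>c\<bar> * C"] conjI allI impI)
    fix h :: "'a \<Rightarrow> real" and x r b assume *: "0 \<le> (b::real)" "\<bar>r\<bar> \<le> R" "Ck N UNIV h"
     "\<forall>bs y. set bs \<subseteq> Basis \<longrightarrow> length bs \<le> N \<longrightarrow> y \<in> cball x R \<longrightarrow> \<bar>diter bs h y\<bar> \<le> b"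
    show "\<bar>c * A h x r\<bar> \<le> \<bar>c\<bar> * C * b"
      using mult_left_mono[OF C(2)[OF *], of "\<bar>c\<bar>"] by (simp add: abs_mult mult.assoc)
  qed (use C in auto)
next
  case (mult_r N A)
  then obtain C where C: "C \<ge> 0" 
    "\<And>h x r b. 0 \<le> b \<Longrightarrow> \<bar>r\<bar> \<le> R \<Longrightarrow> Ck N UNIV h \<Longrightarrow>
     (\<forall>bs y. set bs \<subseteq> Basis \<longrightarrow> length bs \<le> N \<longrightarrow> y \<in> cball x R \<longrightarrow> \<bar>diter bs h y\<bar> \<le> b) \<Longrightarrow> \<bar>A h x r\<bar> \<le> C * b"
    by metis
  show ?case
  proof (intro exI[of _ "\<bar>R\<bar> * C"] conjI allI impI)
    fix h :: "'a \<Rightarrow> real" and x r b assume *: "0 \<le> (b::real)" "\<bar>r\<bar> \<le> R" "Ck N UNIV h"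
     "\<forall>bs y. set bs \<subseteq> Basis \<longrightarrow> length bs \<le> N \<longrightarrow> y \<in> cball x R \<longrightarrow> \<bar>diter bs h y\<bar> \<le> b"
    have "\<bar>r\<bar> * \<bar>A h x r\<bar> \<le> \<bar>R\<bar> * (C * b)"
      using C(2)[OF *] C(1) * by (intro mult_mono) auto
    then show "\<bar>r * A h x r\<bar> \<le> \<bar>R\<bar> * C * b"
      by (simp add: abs_mult mult.assoc)
  qed (use C in auto)
qed

lemma diter_linear:
  assumes "Ck k UNIV h" "Ck k UNIV h'" "set bs \<subseteq> Basis" "length bs \<le> k"
  shows "diter bs (\<lambda>y. a * h y + c * h' y) x = a * diter bs h x + c * diter bs h' x"
  using assms
proof (induction bs arbitrary: k h h' x rule: rev_induct)
  case (snoc b bs)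
  then obtain j where k: "k = Suc j" by (cases k) auto
  have "has_pd b (\<lambda>y. a * h y + c * h' y) (a * pdir b h y + c * pdir b h' y) y" for y
    using has_pd_add[OF has_pd_mult[OF has_pd_const[of b a] Ck_has_pd[of j UNIV h b y]]
        has_pd_mult[OF has_pd_const[of b c] Ck_has_pd[of j UNIV h' b y]]] snoc.prems k by simp
  then have "pdir b (\<lambda>y. a * h y + c * h' y) = (\<lambda>y. a * pdir b h y + c * pdir b h' y)"
    by (auto intro: has_pd_pdir)
  then have "diter (bs @ [b]) (\<lambda>y. a * h y + c * h' y) x = diter bs (\<lambda>y. a * pdir b h y + c * pdir b h' y) x"
    by (simp add: diter_append)
  also have "\<dots> = a * diter bs (pdir b h) x + c * diter bs (pdir b h') x"
    by (rule snoc.IH[of j]) (use snoc.prems k in \<open>auto simp: Ck_Suc\<close>)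
  finally show ?case by (simp add: diter_append)
qed simp

lemma avg_integrable:
  assumes "ball_weight q" "Ck N UNIV h" "set bs \<subseteq> Basis" "length bs \<le> N"
  shows "integrable lborel (\<lambda>y. q y * diter bs h (x + r *\<^sub>R y))"
  by (rule ball_weight_integrable[OF assms(1)], rule continuous_on_compose2[OF Ck_diter_continuous[OF assms(2-4)]])
     (auto intro!: continuous_intros)

lemma avgop_linear:
  assumes "avgop N A" "Ck N UNIV h" "Ck N UNIV h'"
  shows "A (\<lambda>y. a * h y + c * h' y) x r = a * A h x r + c * A h' x r"
  using assms
proof (induction arbitrary: x r rule: avgop.induct)
  case (avg q bs N)
  have "avg bs q (\<lambda>y. a * h y + c * h' y) x r = (\<integral>y. a * (q y * diter bs h (x + r *\<^sub>R y)) + c * (q y * diter bs h' (x + r *\<^sub>R y)) \<partial>lborel)"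
    unfolding avg_def using avg by (subst diter_linear[of N]) (auto simp: algebra_simps)
  also have "\<dots> = a * avg bs q h x r + c * avg bs q h' x r"
    unfolding avg_def using avg_integrable[OF avg(1) avg(4) avg(2,3)] avg_integrable[OF avg(1) avg(5) avg(2,3)] by simp
  finally show ?case .
qed (auto simp: algebra_simps)

lemma avg_deriv_x:
  assumes q: "ball_weight q" and h: "Ck (Suc N) UNIV h" and bs: "set bs \<subseteq> Basis" "length bs \<le> N" and b: "b \<in> Basis"
  shows "has_pd b (\<lambda>x. avg bs q h x r) (avg (b # bs) q h x r) x"
proof -
  have p: "has_pd b (diter bs h) (diter (b # bs) h y) y" for y
    using Ck_has_pd[OF Ck_diter[of "Suc 0" bs UNIV h] b, of y] Ck_mono[OF h, of "Suc 0 + length bs"] bs by simp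
  have c: "continuous_on UNIV (diter (b # bs) h)" by (rule Ck_diter_continuous[OF h]) (use bs b in auto)
  have "((\<lambda>s. \<integral>y. q y * diter bs h ((x + s *\<^sub>R b) + r *\<^sub>R y) \<partial>lborel) has_real_derivative
    (\<integral>y. q y * diter (b # bs) h (x + 0 *\<^sub>R b + r *\<^sub>R y) \<partial>lborel)) (at 0)"
  proof (rule ball_average_derivative[OF q, where X = "\<lambda>s. x + s *\<^sub>R b" and R = "\<lambda>s. r" and k' = "\<lambda>s y. diter (b # bs) h (x + s *\<^sub>R b + r *\<^sub>R y)"])
    show "continuous_on UNIV (diter bs h)" by (rule Ck_diter_continuous[OF h]) (use bs in auto)
    show "((\<lambda>s. diter bs h ((x + s *\<^sub>R b) + r *\<^sub>R y)) has_real_derivative diter (b # bs) h (x + s *\<^sub>R b + r *\<^sub>R y)) (at s)" for y s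
      using has_pd_line[OF p, of "x + r *\<^sub>R y" s] by (simp add: algebra_simps)
    show "continuous_on UNIV (\<lambda>(s, y). diter (b # bs) h (x + s *\<^sub>R b + r *\<^sub>R y))"
      unfolding case_prod_unfold by (rule continuous_on_compose2[OF c]) (auto intro!: continuous_intros)
  qed
  then show ?thesis by (simp add: has_pd_def avg_def)
qed

text \<open>The chain rule produces the factors \<open>y \<bullet> b\<close>. Absorbing them into
  the weight keeps each summand an average with an admissible weight, so differentiation in r stays
  inside the class.\<close>

lemma avg_deriv_r:
  assumes q: "ball_weight q" and h: "Ck (Suc N) UNIV h" and bs: "set bs \<subseteq> Basis" "length bs \<le> N"
  shows "((\<lambda>r. avg bs q h x r) has_real_derivative (\<Sum>b\<in>Basis. avg (b # bs) (\<lambda>y. (y \<bullet> b) * q y) h x r)) (at r)"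
proof -
  have p: "has_pd b (diter bs h) (diter (b # bs) h y) y" if "b \<in> Basis" for y b
    using Ck_has_pd[OF Ck_diter[of "Suc 0" bs UNIV h] that, of y] Ck_mono[OF h, of "Suc 0 + length bs"] bs by simp
  have c: "continuous_on UNIV (diter (b # bs) h)" if "b \<in> Basis" for b by (rule Ck_diter_continuous[OF h]) (use bs that in auto)
  let ?k = "\<lambda>s y. \<Sum>b\<in>Basis. (y \<bullet> b) * diter (b # bs) h (x + s *\<^sub>R y)"
  have "((\<lambda>s. \<integral>y. q y * diter bs h (x + s *\<^sub>R y) \<partial>lborel) has_real_derivative
    (\<integral>y. q y * ?k r y \<partial>lborel)) (at r)"
  proof (rule ball_average_derivative[OF q, where X = "\<lambda>s. x" and R = "\<lambda>s. s" and k' = ?k])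
    show "continuous_on UNIV (diter bs h)" by (rule Ck_diter_continuous[OF h]) (use bs in auto)
    show "((\<lambda>s. diter bs h (x + s *\<^sub>R y)) has_real_derivative ?k s y) (at s)" for y s
      by (rule directional_derivative[OF p c])
    show "continuous_on UNIV (\<lambda>(s, y). ?k s y)"
      unfolding case_prod_unfold by (intro continuous_intros continuous_on_compose2[OF c]) auto
  qed
  also have "(\<integral>y. q y * ?k r y \<partial>lborel) = (\<integral>y. (\<Sum>b\<in>Basis. ((y \<bullet> b) * q y) * diter (b # bs) h (x + r *\<^sub>R y)) \<partial>lborel)"
    by (simp add: sum_distrib_left algebra_simps)
  also have "\<dots> = (\<Sum>b\<in>Basis. avg (b # bs) (\<lambda>y. (y \<bullet> b) * q y) h x r)"
    unfolding avg_def
    by (rule Bochner_Integration.integral_sum, rule avg_integrable[OF ball_weight_mult_coord[OF q] h]) (use bs in auto)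
  finally show ?thesis by (simp add: avg_def)
qed

lemma avgop_deriv_x:
  assumes "avgop N A" "b \<in> Basis"
  shows "\<exists>D. avgop (Suc N) D \<and> (\<forall>h x r. Ck (Suc N) UNIV h \<longrightarrow> has_pd b (\<lambda>x. A h x r) (D h x r) x)"
  using assms
proof (induction rule: avgop.induct)
  case (avg q bs N)
  show ?case
    by (intro exI[of _ "avg (b # bs) q"] conjI avgop.avg allI impI avg_deriv_x) (use avg in auto)
next
  case (add N A B)
  then obtain D E where "avgop (Suc N) D" "\<forall>h x r. Ck (Suc N) UNIV h \<longrightarrow> has_pd b (\<lambda>x. A h x r) (D h x r) x"
     "avgop (Suc N) E" "\<forall>h x r. Ck (Suc N) UNIV h \<longrightarrow> has_pd b (\<lambda>x. B h x r) (E h x r) x" by blast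
  then show ?case by (intro exI[of _ "\<lambda>h x r. D h x r + E h x r"]) (auto intro: avgop.add has_pd_add)
next
  case (scale N A c)
  then obtain D where "avgop (Suc N) D" "\<forall>h x r. Ck (Suc N) UNIV h \<longrightarrow> has_pd b (\<lambda>x. A h x r) (D h x r) x" by blast
  then show ?case by (intro exI[of _ "\<lambda>h x r. c * D h x r"]) (auto intro: avgop.scale simp: has_pd_def intro!: DERIV_cmult)
next
  case (mult_r N A)
  then obtain D where "avgop (Suc N) D" "\<forall>h x r. Ck (Suc N) UNIV h \<longrightarrow> has_pd b (\<lambda>x. A h x r) (D h x r) x" by blast
  then show ?case by (intro exI[of _ "\<lambda>h x r. r * D h x r"]) (auto intro: avgop.mult_r simp: has_pd_def intro!: DERIV_cmult)
qed

lemma avgop_deriv_r: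
  assumes "avgop N A"
  shows "\<exists>D. avgop (Suc N) D \<and> (\<forall>h x r. Ck (Suc N) UNIV h \<longrightarrow> ((\<lambda>r. A h x r) has_real_derivative D h x r) (at r))"
  using assms
proof (induction rule: avgop.induct)
  case (avg q bs N)
  have "avgop (Suc N) (\<lambda>h x r. \<Sum>b\<in>Basis. avg (b # bs) (\<lambda>y. (y \<bullet> b) * q y) h x r)"
    by (intro avgop_sum avgop.avg ball_weight_mult_coord) (use avg in auto)
  then show ?case using avg avg_deriv_r by blast
next
  case (add N A B)
  then obtain D E where "avgop (Suc N) D" "\<forall>h x r. Ck (Suc N) UNIV h \<longrightarrow> ((\<lambda>r. A h x r) has_real_derivative D h x r) (at r)"
     "avgop (Suc N) E" "\<forall>h x r. Ck (Suc N) UNIV h \<longrightarrow> ((\<lambda>r. B h x r) has_real_derivative E h x r) (at r)" by blast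
  then show ?case by (intro exI[of _ "\<lambda>h x r. D h x r + E h x r"]) (auto intro: avgop.add intro!: DERIV_add)
next
  case (scale N A c)
  then obtain D where "avgop (Suc N) D" "\<forall>h x r. Ck (Suc N) UNIV h \<longrightarrow> ((\<lambda>r. A h x r) has_real_derivative D h x r) (at r)" by blast
  then show ?case by (intro exI[of _ "\<lambda>h x r. c * D h x r"]) (auto intro: avgop.scale intro!: DERIV_cmult)
next
  case (mult_r N A)
  then obtain D where D: "avgop (Suc N) D" "\<forall>h x r. Ck (Suc N) UNIV h \<longrightarrow> ((\<lambda>r. A h x r) has_real_derivative D h x r) (at r)" by blast
  have "avgop (Suc N) (\<lambda>h x r. A h x r + r * D h x r)"
    by (intro avgop.add avgop.mult_r D avgop_mono[OF mult_r(1)]) simp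
  then show ?case
    by (intro exI[of _ "\<lambda>h x r. A h x r + r * D h x r"]) (use D in \<open>auto intro!: derivative_eq_intros\<close>)
qed

section \<open>Regularity in space and time jointly\<close>

lemma has_pd_time:
  "has_pd (0, 1) (\<lambda>(x, r). v x r) d (x, r) \<longleftrightarrow> ((\<lambda>s. v x s) has_real_derivative d) (at r)"
  using DERIV_shift[of "\<lambda>s. v x s" d 0 r] by (simp add: has_pd_def add.commute)

lemma has_pd_space:
  "has_pd (b, 0) (\<lambda>(x, r). v x r) d (x, r) \<longleftrightarrow> has_pd b (\<lambda>x. v x r) d x"
  by (simp add: has_pd_def)

lemma Ck_prodI:
  fixes v :: "'a::euclidean_space \<Rightarrow> real \<Rightarrow> real"
  assumes S: "open S" and c: "continuous_on S (\<lambda>(x, r). v x r)"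
    and t: "\<And>x r. (x, r) \<in> S \<Longrightarrow> ((\<lambda>s. v x s) has_real_derivative vt x r) (at r)"
    and x: "\<And>b x r. b \<in> Basis \<Longrightarrow> (x, r) \<in> S \<Longrightarrow> has_pd b (\<lambda>x. v x r) (vx b x r) x"
    and ct: "Ck k S (\<lambda>(x, r). vt x r)" and cx: "\<And>b. b \<in> Basis \<Longrightarrow> Ck k S (\<lambda>(x, r). vx b x r)"
  shows "Ck (Suc k) S (\<lambda>(x, r). v x r)"
\<comment> \<open>The basis of the product consists of the vectors \<open>(b, 0)\<close> and
  \<open>(0, 1)\<close>; the second component tells which kind is meant.\<close>
proof (rule Ck_SucI[OF S c, where g' = "\<lambda>(b, c) (x, r). if c = 0 then vx b x r else vt x r"])
  fix z :: "'a \<times> real" and p :: "'a \<times> real" assume z: "z \<in> Basis" and p: "p \<in> S"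
  from z consider b where "b \<in> Basis" "z = (b, 0)" | "z = (0, 1)" by (auto simp: Basis_prod_def)
  then show "has_pd z (\<lambda>(x, r). v x r) ((\<lambda>(b, c) (x, r). if c = 0 then vx b x r else vt x r) z p) p"
    by cases (use t x p in \<open>auto simp: has_pd_time has_pd_space split: prod.splits\<close>)
next
  fix z :: "'a \<times> real" assume z: "z \<in> Basis"
  then consider b where "b \<in> Basis" "z = (b, 0)" | "z = (0, 1)" by (auto simp: Basis_prod_def)
  then show "Ck k S ((\<lambda>(b, c) (x, r). if c = 0 then vx b x r else vt x r) z)"
    by cases (use ct cx in auto)
qed

lemma avgop_continuous_single:
  fixes A :: "('a::euclidean_space \<Rightarrow> real) \<Rightarrow> 'a \<Rightarrow> real \<Rightarrow> real"
  assumes "avgop N A" "Ck N UNIV h"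
  shows "continuous_on UNIV (\<lambda>(x, r). A h x r)"
proof -
  have "continuous_on (UNIV \<times> UNIV) (\<lambda>(y, l::real). diter bs h y)" if "set bs \<subseteq> Basis" "length bs \<le> N" for bs
    unfolding case_prod_unfold
    by (rule continuous_on_compose2[OF Ck_diter_continuous[OF assms(2) that]]) (auto intro!: continuous_intros)
  from avgop_continuous[OF assms(1) open_UNIV this]
  have "continuous_on UNIV (\<lambda>(x, r, l::real). A h x r)" by simp
  moreover have "continuous_on UNIV (\<lambda>p::'a \<times> real. (fst p, snd p, 0::real))" by (intro continuous_intros)
  ultimately have "continuous_on UNIV (\<lambda>p::'a \<times> real. (\<lambda>(x, r, l::real). A h x r) (fst p, snd p, 0))"
    by (rule continuous_on_compose2) simp
  then show ?thesis by (simp add: case_prod_unfold)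
qed

text \<open>Each derivative of \<open>A h\<close> is an operator of order one higher applied to the
  same \<open>h\<close>, so the induction on \<open>k\<close> leaves \<open>N + k\<close>
  unchanged.\<close>

lemma avgop_Ck:
  "avgop N A \<Longrightarrow> Ck (N + k) UNIV h \<Longrightarrow> Ck k UNIV (\<lambda>(x, r). A h x r)"
proof (induction k arbitrary: N A)
  case 0
  then show ?case using avgop_continuous_single by (auto simp: Ck_0)
next
  case (Suc k)
  have c: "continuous_on UNIV (\<lambda>(x, r). A h x r)"
    by (rule avgop_continuous_single[OF Suc(2) Ck_mono[OF Suc(3)]]) simp
  have h: "Ck (Suc N) UNIV h" "Ck (Suc N + k) UNIV h" using Suc(3) Ck_mono by fastforce+
  obtain Dr where Dr: "avgop (Suc N) Dr" "\<And>h x r. Ck (Suc N) UNIV h \<Longrightarrow> ((\<lambda>r. A h x r) has_real_derivative Dr h x r) (at r)"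
    using avgop_deriv_r[OF Suc(2)] by blast
  have "\<forall>b\<in>Basis. \<exists>D. avgop (Suc N) D \<and> (\<forall>h x r. Ck (Suc N) UNIV h \<longrightarrow> has_pd b (\<lambda>x. A h x r) (D h x r) x)"
    using avgop_deriv_x[OF Suc(2)] by blast
  then obtain Dx where Dx: "\<And>b. b \<in> Basis \<Longrightarrow> avgop (Suc N) (Dx b)"
    "\<And>b h x r. b \<in> Basis \<Longrightarrow> Ck (Suc N) UNIV h \<Longrightarrow> has_pd b (\<lambda>x. A h x r) (Dx b h x r) x" by metis
  show ?case
    by (rule Ck_prodI[OF open_UNIV c Dr(2)[OF h(1)] Dx(2)[OF _ h(1)] Suc.IH[OF Dr(1) h(2)] Suc.IH[OF Dx(1) h(2)]])
qed

section \<open>The Euler-Poisson-Darboux equation and the wave equation\<close>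

definition dt :: "('a::euclidean_space \<Rightarrow> real \<Rightarrow> real) \<Rightarrow> 'a \<Rightarrow> real \<Rightarrow> real" where
  "dt w x r = deriv (\<lambda>s. w x s) r"

definition dx :: "'a::euclidean_space \<Rightarrow> ('a \<Rightarrow> real \<Rightarrow> real) \<Rightarrow> 'a \<Rightarrow> real \<Rightarrow> real" where
  "dx b w x r = pdir b (\<lambda>y. w y r) x"

definition lapx :: "('a::euclidean_space \<Rightarrow> real \<Rightarrow> real) \<Rightarrow> 'a \<Rightarrow> real \<Rightarrow> real" where
  "lapx w x r = (\<Sum>b\<in>Basis. dx b (dx b w) x r)"

lemma lap_eq_lapx: "lap (\<lambda>y. w y r) x = lapx w x r"
  by (simp add: lap_def lapx_def dx_def[abs_def])

lemma is_wave_sol_iff: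
  "is_wave_sol h v \<longleftrightarrow> Ck 2 UNIV (\<lambda>(x, r). v x r) \<and> (\<forall>x r. dt (dt v) x r = lapx v x r) \<and>
     (\<forall>x. v x 0 = h x) \<and> (\<forall>x. dt v x 0 = 0)"
  by (simp add: is_wave_sol_def lap_eq_lapx dt_def[abs_def])

lemma dt_eqI: "((\<lambda>s. w x s) has_real_derivative d) (at r) \<Longrightarrow> dt w x r = d"
  by (simp add: dt_def DERIV_imp_deriv)

lemma dx_eqI: "has_pd b (\<lambda>y. w y r) d x \<Longrightarrow> dx b w x r = d"
  by (simp add: dx_def has_pd_pdir)

lemma pdir_time: "pdir (0, 1) (\<lambda>(x, r). w x r) (x, r) = dt w x r"
  unfolding pdir_def dt_def deriv_def
  using has_pd_time[of w] by (simp add: has_pd_def)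

lemma pdir_space: "pdir (b, 0) (\<lambda>(x, r). w x r) (x, r) = dx b w x r"
  by (simp add: pdir_def dx_def)

lemma pdir_time_fun: "pdir (0, 1) (\<lambda>(x, r). w x r) = (\<lambda>(x, r). dt w x r)"
  by (auto simp: pdir_time)

lemma pdir_space_fun: "pdir (b, 0) (\<lambda>(x, r). w x r) = (\<lambda>(x, r). dx b w x r)"
  by (auto simp: pdir_space)

lemma time_Basis: "(0::'a::euclidean_space, 1::real) \<in> Basis"
  by (auto simp: Basis_prod_def image_iff)

lemma space_Basis: "b \<in> Basis \<Longrightarrow> (b, 0) \<in> Basis"
  by (simp add: Basis_prod_def)

lemma Ck_dt: "Ck (Suc k) S (\<lambda>(x, r). w x r) \<Longrightarrow> Ck k S (\<lambda>(x, r). dt w x r)"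
  using time_Basis by (auto simp: Ck_Suc pdir_time_fun[symmetric])

lemma Ck_dx: "Ck (Suc k) S (\<lambda>(x, r). w x r) \<Longrightarrow> b \<in> Basis \<Longrightarrow> Ck k S (\<lambda>(x, r). dx b w x r)"
  using space_Basis by (auto simp: Ck_Suc pdir_space_fun[symmetric])

lemma Ck_has_dt:
  "Ck (Suc k) S (\<lambda>(x, r). w x r) \<Longrightarrow> (x, r) \<in> S \<Longrightarrow> ((\<lambda>s. w x s) has_real_derivative dt w x r) (at r)"
  using Ck_has_pd[OF _ time_Basis, of k S "\<lambda>(x, r). w x r" "(x, r)"] by (simp add: has_pd_time pdir_time)

lemma Ck_has_dx:
  "Ck (Suc k) S (\<lambda>(x, r). w x r) \<Longrightarrow> (x, r) \<in> S \<Longrightarrow> b \<in> Basis \<Longrightarrow> has_pd b (\<lambda>y. w y r) (dx b w x r) x"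
  using Ck_has_pd[OF _ space_Basis, of k S "\<lambda>(x, r). w x r" b "(x, r)"] by (simp add: has_pd_space pdir_space)

lemma dx_dt_commute:
  assumes "Ck 2 UNIV (\<lambda>(x, r). w x r)" "b \<in> Basis"
  shows "dx b (dt w) x r = dt (dx b w) x r"
  using pdir_commute[OF assms(1) space_Basis[OF assms(2)] time_Basis, of "(x, r)"]
  by (simp add: pdir_time_fun pdir_space_fun pdir_time pdir_space)

text \<open>The equation is multiplied by r so that it is meaningful for every real r, including
  0.\<close>

definition epd :: "real \<Rightarrow> ('a::euclidean_space \<Rightarrow> real \<Rightarrow> real) \<Rightarrow> bool" where
  "epd k w \<longleftrightarrow> (\<forall>x r. r * dt (dt w) x r + k * dt w x r = r * lapx w x r)"

lemma lapx_has_dt: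
  assumes w: "Ck 3 UNIV (\<lambda>(x, r). w x r)"
  shows "((\<lambda>s. lapx w x s) has_real_derivative lapx (dt w) x r) (at r)"
proof -
  have w': "Ck (Suc (Suc (Suc 0))) UNIV (\<lambda>(x, r). w x r)" "Ck 2 UNIV (\<lambda>(x, r). w x r)"
    using w Ck_mono[OF w, of 2] by (simp_all add: numeral_3_eq_3)
  have "((\<lambda>s. lapx w x s) has_real_derivative (\<Sum>b\<in>Basis. dt (dx b (dx b w)) x r)) (at r)"
    unfolding lapx_def by (intro DERIV_sum Ck_has_dt[OF Ck_dx[OF Ck_dx[OF w'(1)]]]) auto
  moreover have "dt (dx b (dx b w)) x r = dx b (dx b (dt w)) x r" if b: "b \<in> Basis" for b
  proof -
    have "dx b (dt w) = dt (dx b w)" by (intro ext dx_dt_commute[OF w'(2) b])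
    moreover have "dx b (dt (dx b w)) x r = dt (dx b (dx b w)) x r"
      using Ck_dx[OF w'(1) b] by (intro dx_dt_commute[OF _ b]) (simp add: numeral_2_eq_2)
    ultimately show ?thesis by simp
  qed
  ultimately show ?thesis by (simp add: lapx_def)
qed

lemma lapx_linear:
  assumes v: "Ck 2 UNIV (\<lambda>(x, r). v x r)" and w: "Ck 2 UNIV (\<lambda>(x, r). w x r)"
  shows "lapx (\<lambda>x r. v x r + c r * w x r) x r = lapx v x r + c r * lapx w x r"
proof -
  have s: "Ck (Suc (Suc 0)) UNIV (\<lambda>(x, r). v x r)" "Ck (Suc (Suc 0)) UNIV (\<lambda>(x, r). w x r)"
    using v w by (simp_all add: numeral_2_eq_2)
  have a: "dx b (\<lambda>x r. f x r + c r * g x r) = (\<lambda>x r. dx b f x r + c r * dx b g x r)"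
    if "Ck (Suc 0) UNIV (\<lambda>(x, r). f x r)" "Ck (Suc 0) UNIV (\<lambda>(x, r). g x r)" "b \<in> Basis" for f g b
  proof (intro ext dx_eqI)
    fix x r
    have "has_pd b (\<lambda>y. f y r + c r * g y r) (dx b f x r + (0 * g x r + c r * dx b g x r)) x"
      using that by (intro has_pd_add has_pd_mult has_pd_const Ck_has_dx) auto
    then show "has_pd b (\<lambda>y. f y r + c r * g y r) (dx b f x r + c r * dx b g x r) x" by simp
  qed
  have "dx b (dx b (\<lambda>x r. v x r + c r * w x r)) = (\<lambda>x r. dx b (dx b v) x r + c r * dx b (dx b w) x r)" if b: "b \<in> Basis" for b
    using a[OF Ck_mono[OF s(1)] Ck_mono[OF s(2)] b] a[OF Ck_dx[OF s(1) b] Ck_dx[OF s(2) b] b] by simp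
  then show ?thesis by (simp add: lapx_def sum.distrib sum_distrib_left)
qed

text \<open>The equation with parameter \<open>k\<close> says that the derivative of \<open>w + r w\<^sub>r / (k - 1)\<close> is \<open>r \<Delta>w / (k - 1)\<close>.\<close>

lemma epd_step:
  fixes w :: "'a::euclidean_space \<Rightarrow> real \<Rightarrow> real"
  assumes w: "Ck 3 UNIV (\<lambda>(x, r). w x r)" and e: "epd k w" and k: "k \<noteq> 1"
  defines "w' \<equiv> \<lambda>x r. w x r + r / (k - 1) * dt w x r"
  shows "((\<lambda>s. w' x s) has_real_derivative r / (k - 1) * lapx w x r) (at r)"
    "dt w' x r = r / (k - 1) * lapx w x r" "epd (k - 2) w'"
    "k = 2 \<Longrightarrow> dt (dt w') x r = lapx w' x r"
proof -
  have w3: "Ck (Suc (Suc (Suc 0))) UNIV (\<lambda>(x, r). w x r)" "Ck 2 UNIV (\<lambda>(x, r). w x r)"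
    using w Ck_mono[OF w, of 2] by (simp_all add: numeral_3_eq_3)
  have w2: "Ck 2 UNIV (\<lambda>(x, r). dt w x r)" using Ck_dt[OF w3(1)] by (simp add: numeral_2_eq_2)
  have e': "r * dt (dt w) x r + k * dt w x r = r * lapx w x r" for x r using e by (simp add: epd_def)
  have d: "((\<lambda>s. w' x s) has_real_derivative r / (k - 1) * lapx w x r) (at r)" for x r
  proof -
    have "((\<lambda>s. w' x s) has_real_derivative dt w x r + (1 / (k - 1) * dt w x r + r / (k - 1) * dt (dt w) x r)) (at r)"
      unfolding w'_def using k
      by (auto intro!: derivative_eq_intros Ck_has_dt[OF w3(1)] Ck_has_dt[OF Ck_dt[OF w3(1)]] simp: add_divide_distrib)
    moreover have "dt w x r + (1 / (k - 1) * dt w x r + r / (k - 1) * dt (dt w) x r) = (r * dt (dt w) x r + k * dt w x r) / (k - 1)"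
    proof -
      define c where "c = k - 1"
      then have "k = c + 1" "c \<noteq> 0" using k by auto
      then show ?thesis by (simp add: field_simps)
    qed
    ultimately show ?thesis by (simp add: e')
  qed
  then show "((\<lambda>s. w' x s) has_real_derivative r / (k - 1) * lapx w x r) (at r)" .
  have dt': "dt w' x r = r / (k - 1) * lapx w x r" for x r by (rule dt_eqI[OF d])
  then show "dt w' x r = r / (k - 1) * lapx w x r" .
  have dtt: "dt (dt w') x r = 1 / (k - 1) * lapx w x r + r / (k - 1) * lapx (dt w) x r" for x r
  proof (rule dt_eqI)
    show "((\<lambda>s. dt w' x s) has_real_derivative 1 / (k - 1) * lapx w x r + r / (k - 1) * lapx (dt w) x r) (at r)"
      unfolding dt' using k by (auto intro!: derivative_eq_intros lapx_has_dt[OF w] simp: add_divide_distrib)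
  qed
  have lp: "lapx w' x r = lapx w x r + r / (k - 1) * lapx (dt w) x r" for x r
    unfolding w'_def by (rule lapx_linear[OF w3(2) w2, where c = "\<lambda>r. r / (k - 1)"])
  show "epd (k - 2) w'"
    unfolding epd_def dt' dtt lp
  proof (intro allI)
    fix x r
    define c where "c = k - 1"
    then have "k = c + 1" "c \<noteq> 0" using k by auto
    then show "r * (1 / (k - 1) * lapx w x r + r / (k - 1) * lapx (dt w) x r) + (k - 2) * (r / (k - 1) * lapx w x r)
      = r * (lapx w x r + r / (k - 1) * lapx (dt w) x r)"
      by (simp add: field_simps)
  qed
  \<comment> \<open>The equation with parameter 0 carries the factor r and says nothing at r = 0;
    the explicit second derivative gives the wave equation there as well.\<close>
  show "k = 2 \<Longrightarrow> dt (dt w') x r = lapx w' x r" unfolding dtt lp by simp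
qed

section \<open>The weights (1 - |y|^2)^a and their divergence identity\<close>

text \<open>Since \<open>0 powr 0 = 0\<close> in HOL, \<open>ppow 0\<close> is the indicator function of the positive reals.\<close>

definition ppow :: "real \<Rightarrow> real \<Rightarrow> real" where
  "ppow a p = max 0 p powr a"

lemma ppow_pos: "p > 0 \<Longrightarrow> ppow a p = p powr a" and ppow_neg: "p \<le> 0 \<Longrightarrow> ppow a p = 0"
  by (simp_all add: ppow_def)

lemma ppow_continuous: "a > 0 \<Longrightarrow> continuous_on UNIV (ppow a)"
  unfolding ppow_def[abs_def] by (intro continuous_on_powr' continuous_intros) auto

lemma ppow_has_derivative:
  assumes "a > 1"
  shows "(ppow a has_real_derivative a * ppow (a - 1) p) (at p)"
proof (cases p "0::real" rule: linorder_cases)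
  case less
  have "((\<lambda>p. 0) has_real_derivative 0) (at p)" by simp
  moreover have "\<forall>\<^sub>F q in nhds p. (0::real) = ppow a q"
    using eventually_nhds_in_open[of "{..<0}" p] less by (auto elim!: eventually_mono simp: ppow_neg)
  ultimately show ?thesis using less DERIV_cong_ev[of p p "\<lambda>p. 0" "ppow a" 0 0] by (simp add: ppow_neg)
next
  case greater
  have "((\<lambda>p. p powr a) has_real_derivative a * p powr (a - 1)) (at p)"
    using greater by (auto intro!: derivative_eq_intros)
  moreover have "\<forall>\<^sub>F q in nhds p. q powr a = ppow a q"
    using eventually_nhds_in_open[of "{0<..}" p] greater by (auto elim!: eventually_mono simp: ppow_pos)
  ultimately show ?thesis using greater DERIV_cong_ev[of p p "\<lambda>p. p powr a" "ppow a"] by (simp add: ppow_pos)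
next
  case equal
  \<comment> \<open>At 0 the difference quotient is bounded by the power \<open>a - 1\<close>, which
    tends to 0 because \<open>a > 1\<close>.\<close>
  have "((\<lambda>q. ppow a q / q) \<longlongrightarrow> 0) (at 0)"
  proof (rule Lim_null_comparison[where g = "\<lambda>q. ppow (a - 1) q"])
    have "norm (ppow a q / q) \<le> ppow (a - 1) q" if "q \<noteq> 0" for q
      using that assms by (cases "q > 0") (auto simp: ppow_pos ppow_neg powr_diff)
    then show "\<forall>\<^sub>F q in at 0. norm (ppow a q / q) \<le> ppow (a - 1) q"
      by (auto simp: eventually_at intro!: exI[of _ 1])
    have "isCont (ppow (a - 1)) 0" using ppow_continuous[of "a - 1"] assms
      by (simp add: continuous_on_eq_continuous_at)
    then show "(ppow (a - 1) \<longlongrightarrow> 0) (at 0)" by (simp add: isCont_def ppow_neg)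
  qed
  then show ?thesis using equal by (simp add: has_field_derivative_iff ppow_neg)
qed

lemma has_pd_coord: "has_pd i (\<lambda>y. y \<bullet> j) (i \<bullet> j) y"
  unfolding has_pd_def by (auto intro!: derivative_eq_intros simp: inner_add_left)

lemma has_pd_sum: "(\<And>i. i \<in> I \<Longrightarrow> has_pd b (f i) (d i) x) \<Longrightarrow> has_pd b (\<lambda>y. \<Sum>i\<in>I. f i y) (\<Sum>i\<in>I. d i) x"
  unfolding has_pd_def by (rule DERIV_sum)

lemma has_pd_diff: "has_pd b f d x \<Longrightarrow> has_pd b g e x \<Longrightarrow> has_pd b (\<lambda>y. f y - g y) (d - e) x"
  unfolding has_pd_def by (intro derivative_intros)

lemma has_pd_compose:
  assumes "has_pd b f d x" "(g has_real_derivative e) (at (f x))"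
  shows "has_pd b (\<lambda>y. g (f y)) (e * d) x"
  using DERIV_chain2[of g e "\<lambda>s. f (x + s *\<^sub>R b)" 0 d UNIV] assms by (simp add: has_pd_def)

lemma has_pd_affine:
  assumes "\<And>y. has_pd b g (g' y) y"
  shows "has_pd b (\<lambda>y. g (x + r *\<^sub>R y)) (r * g' (x + r *\<^sub>R y)) y"
proof -
  have "((\<lambda>s. s * r) has_real_derivative r) (at 0)" by (auto intro!: derivative_eq_intros)
  from DERIV_chain2[where f = "\<lambda>s. g ((x + r *\<^sub>R y) + s *\<^sub>R b)" and g = "\<lambda>s. s * r", OF has_pd_line[OF assms] this]
  show ?thesis by (simp add: has_pd_def algebra_simps)
qed

lemma has_pd_norm_sq:
  assumes "b \<in> Basis"
  shows "has_pd b (\<lambda>y. 1 - y \<bullet> y) (- 2 * (y \<bullet> b)) y"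
proof -
  have "((\<lambda>s. 1 - (y \<bullet> y + 2 * s * (y \<bullet> b) + s * s * (b \<bullet> b))) has_real_derivative - 2 * (y \<bullet> b)) (at 0)"
    by (auto intro!: derivative_eq_intros)
  moreover have "(y + s *\<^sub>R b) \<bullet> (y + s *\<^sub>R b) = y \<bullet> y + 2 * s * (y \<bullet> b) + s * s * (b \<bullet> b)" for s
    by (simp add: inner_add_left inner_add_right inner_commute algebra_simps)
  ultimately show ?thesis by (simp add: has_pd_def)
qed

lemma outside_unit_ball: "y \<notin> cball 0 1 \<Longrightarrow> 1 - y \<bullet> y \<le> (0::real)"
proof -
  assume "y \<notin> cball 0 1"
  then have "1 \<le> (norm y)\<^sup>2" by auto
  then show ?thesis by (simp add: power2_norm_eq_inner)
qed

context
  fixes h :: "'a::euclidean_space \<Rightarrow> real" and x :: 'a and r :: real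
  assumes h: "Ck 2 UNIV h"
begin

text \<open>As functions of r, \<open>HY\<close> and \<open>HZ\<close> are the first and second
  derivative of \<open>h (x + r *\<^sub>R y)\<close>; \<open>HL\<close> is the Laplacian of
  \<open>h\<close> at that point.\<close>

definition "H1 j y = pdir j h (x + r *\<^sub>R y)"
definition "H2 i j y = pdir i (pdir j h) (x + r *\<^sub>R y)"
definition "HY y = (\<Sum>j\<in>Basis. (y \<bullet> j) * H1 j y)"
definition "HL y = (\<Sum>i\<in>Basis. H2 i i y)"
definition "HZ y = (\<Sum>i\<in>Basis. \<Sum>j\<in>Basis. (y \<bullet> i) * (y \<bullet> j) * H2 i j y)"

lemma H_continuous:
  "j \<in> Basis \<Longrightarrow> continuous_on UNIV (H1 j)" "i \<in> Basis \<Longrightarrow> j \<in> Basis \<Longrightarrow> continuous_on UNIV (H2 i j)"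
  "continuous_on UNIV HY" "continuous_on UNIV HL" "continuous_on UNIV HZ"
proof -
  have c: "continuous_on UNIV (diter bs h)" if "set bs \<subseteq> Basis" "length bs \<le> 2" for bs
    by (rule Ck_diter_continuous[OF h that])
  have c1: "continuous_on UNIV (H1 j)" if "j \<in> Basis" for j
    unfolding H1_def[abs_def] using that
    by (intro continuous_on_compose2[OF c[of "[j]", simplified]]) (auto intro!: continuous_intros)
  have c2: "continuous_on UNIV (H2 i j)" if "i \<in> Basis" "j \<in> Basis" for i j
    unfolding H2_def[abs_def] using that
    by (intro continuous_on_compose2[OF c[of "[i, j]", simplified]]) (auto intro!: continuous_intros)
  show "j \<in> Basis \<Longrightarrow> continuous_on UNIV (H1 j)" "i \<in> Basis \<Longrightarrow> j \<in> Basis \<Longrightarrow> continuous_on UNIV (H2 i j)"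
    by (fact c1 c2)+
  show "continuous_on UNIV HY" "continuous_on UNIV HL" "continuous_on UNIV HZ"
    unfolding HY_def[abs_def] HL_def[abs_def] HZ_def[abs_def] by (auto intro!: continuous_intros c1 c2)
qed

lemma has_pd_H1:
  assumes "i \<in> Basis" "j \<in> Basis"
  shows "has_pd i (H1 j) (r * H2 i j y) y"
  unfolding H1_def[abs_def] H2_def
proof (rule has_pd_affine)
  have "Ck (Suc 0) UNIV (pdir j h)" using h assms by (simp add: numeral_2_eq_2 Ck_Suc[of "Suc 0"])
  then show "has_pd i (pdir j h) (pdir i (pdir j h) y) y" for y by (rule Ck_has_pd) (use assms in auto)
qed

lemma has_pd_HY:
  assumes i: "i \<in> Basis"
  shows "has_pd i HY (H1 i y + r * (\<Sum>j\<in>Basis. (y \<bullet> j) * H2 i j y)) y"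
proof -
  have "has_pd i HY (\<Sum>j\<in>Basis. (i \<bullet> j) * H1 j y + (y \<bullet> j) * (r * H2 i j y)) y"
    unfolding HY_def[abs_def] by (intro has_pd_sum has_pd_mult has_pd_coord has_pd_H1 i)
  moreover have "(\<Sum>j\<in>Basis. (i \<bullet> j) * H1 j y) = (\<Sum>j\<in>Basis. if j = i then H1 j y else 0)"
    by (rule sum.cong) (use i in \<open>auto simp: inner_Basis\<close>)
  ultimately show ?thesis using i by (simp add: sum.distrib sum_distrib_left algebra_simps)
qed

text \<open>The integrand is the divergence of the field \<open>g(1 - |y|\<^sup>2) (\<nabla>h - (y \<bullet> \<nabla>h) y)\<close> at \<open>x + r y\<close>, whose flux through the unit
  sphere vanishes; this is why the weight may later be allowed to jump there.\<close>

lemma divergence_integral: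
  assumes g: "\<And>p. (g has_real_derivative g' p) (at p)" and c: "continuous_on UNIV g'"
    and z: "\<And>p. p \<le> 0 \<Longrightarrow> g p = 0" "\<And>p. p \<le> 0 \<Longrightarrow> g' p = 0"
  shows "(\<integral>y. - 2 * (g' (1 - y \<bullet> y) * (1 - y \<bullet> y)) * HY y
    + g (1 - y \<bullet> y) * (r * (HL y - HZ y) - (DIM('a) + 1) * HY y) \<partial>lborel) = 0"
proof -
  define X where "X i y = g (1 - y \<bullet> y) * (H1 i y - (y \<bullet> i) * HY y)" for i y
  define X' where "X' i y = g' (1 - y \<bullet> y) * (- 2 * (y \<bullet> i)) * (H1 i y - (y \<bullet> i) * HY y)
     + g (1 - y \<bullet> y) * (r * H2 i i y - ((i \<bullet> i) * HY y + (y \<bullet> i) * (H1 i y + r * (\<Sum>j\<in>Basis. (y \<bullet> j) * H2 i j y))))" for i y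
  have cg: "continuous_on UNIV g" using g by (meson DERIV_continuous_on has_field_derivative_at_within)
  have cc: "continuous_on UNIV (\<lambda>y::'a. g (1 - y \<bullet> y))" "continuous_on UNIV (\<lambda>y::'a. g' (1 - y \<bullet> y))"
    by (rule continuous_on_compose2[OF cg] continuous_on_compose2[OF c], auto intro!: continuous_intros)+
  note z' = outside_unit_ball
  have X': "(\<integral>y. X' i y \<partial>lborel) = 0 \<and> integrable lborel (X' i)" if i: "i \<in> Basis" for i
  proof (intro conjI)
    have p: "has_pd i (X i) (X' i y) y" for y
      unfolding X_def[abs_def] X'_def
      by (intro has_pd_mult has_pd_diff has_pd_coord has_pd_H1 has_pd_HY i
           has_pd_compose[where f = "\<lambda>y. 1 - y \<bullet> y", OF has_pd_norm_sq g])
    have c: "continuous_on UNIV (X i)" "continuous_on UNIV (X' i)"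
      unfolding X_def[abs_def] X'_def[abs_def] using i by (auto intro!: continuous_intros cc H_continuous)
    have s: "X i y = 0" "X' i y = 0" if "y \<notin> cball 0 1" for y
      using z z'[OF that] by (auto simp: X_def X'_def)
    show "(\<integral>y. X' i y \<partial>lborel) = 0" "integrable lborel (X' i)"
      using lborel_integral_partial_zero[of i "X i" "X' i" 1, OF p c s] by auto
  qed
  have "(\<integral>y. (\<Sum>i\<in>Basis. X' i y) \<partial>lborel) = (\<Sum>i\<in>Basis. \<integral>y. X' i y \<partial>lborel)"
    by (rule Bochner_Integration.integral_sum) (use X' in auto)
  also have "\<dots> = 0" using X' by simp
  also have "(\<lambda>y. \<Sum>i\<in>Basis. X' i y) = (\<lambda>y. - 2 * (g' (1 - y \<bullet> y) * (1 - y \<bullet> y)) * HY y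
    + g (1 - y \<bullet> y) * (r * (HL y - HZ y) - (DIM('a) + 1) * HY y))"
  proof
    fix y :: 'a
    have yy: "(\<Sum>i\<in>Basis. (y \<bullet> i) * (y \<bullet> i)) = y \<bullet> y" by (rule euclidean_inner[symmetric])
    \<comment> \<open>The radial component of the field has the factor 1 - |y|^2. Hence the
      derivative of the weight enters only in the combination p g'(p), which stays bounded for
      weights that become singular at the sphere.\<close>
    have 1: "(\<Sum>i\<in>Basis. (y \<bullet> i) * (H1 i y - (y \<bullet> i) * HY y)) = (1 - y \<bullet> y) * HY y"
      unfolding right_diff_distrib sum_subtractf mult.assoc[symmetric] sum_distrib_right[symmetric] yy
      by (simp add: HY_def left_diff_distrib)
    have 2: "(\<Sum>i\<in>Basis. (y \<bullet> i) * (\<Sum>j\<in>Basis. (y \<bullet> j) * H2 i j y)) = HZ y"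
      by (simp add: HZ_def sum_distrib_left mult.assoc)
    have 3: "(\<Sum>i\<in>Basis. r * H2 i i y - ((i \<bullet> i) * HY y + (y \<bullet> i) * (H1 i y + r * (\<Sum>j\<in>Basis. (y \<bullet> j) * H2 i j y))))
      = r * HL y - (\<Sum>i\<in>(Basis::'a set). (i \<bullet> i) * HY y) - (\<Sum>i\<in>Basis. (y \<bullet> i) * H1 i y) - r * (\<Sum>i\<in>Basis. (y \<bullet> i) * (\<Sum>j\<in>Basis. (y \<bullet> j) * H2 i j y))"
      by (simp add: HL_def sum_subtractf sum.distrib sum_distrib_left algebra_simps)
    have 4: "(\<Sum>i\<in>(Basis::'a set). (i \<bullet> i) * HY y) = DIM('a) * HY y"
      by simp
    have "(\<Sum>i\<in>Basis. X' i y) = - 2 * g' (1 - y \<bullet> y) * (\<Sum>i\<in>Basis. (y \<bullet> i) * (H1 i y - (y \<bullet> i) * HY y))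
      + g (1 - y \<bullet> y) * (\<Sum>i\<in>Basis. r * H2 i i y - ((i \<bullet> i) * HY y + (y \<bullet> i) * (H1 i y + r * (\<Sum>j\<in>Basis. (y \<bullet> j) * H2 i j y))))"
      unfolding X'_def sum.distrib sum_distrib_left by (simp add: mult_ac)
    then show "(\<Sum>i\<in>Basis. X' i y) = - 2 * (g' (1 - y \<bullet> y) * (1 - y \<bullet> y)) * HY y
        + g (1 - y \<bullet> y) * (r * (HL y - HZ y) - (DIM('a) + 1) * HY y)"
      unfolding 1 3 4 2 HY_def[symmetric] by (simp add: algebra_simps)
  qed
  finally show ?thesis .
qed

text \<open>The limit of \<open>divergence_integral\<close> along regularised weights: p g'(p) tends
  to a p^a, and this is the origin of the additional 2 a in the coefficient of
  \<open>HY\<close>.\<close>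

lemma weighted_identity:
  fixes a :: real
  assumes a: "a \<ge> 0"
  shows "(\<integral>y. ppow a (1 - y \<bullet> y) * (r * (HL y - HZ y) - (DIM('a) + 1 + 2 * a) * HY y) \<partial>lborel) = 0"
proof -
  define E where "E k = inverse (real (Suc k))" for k
  have E: "E k > 0" for k by (simp add: E_def)
  have El: "E \<longlonglongrightarrow> 0" using LIMSEQ_inverse_real_of_nat by (simp add: E_def[abs_def])
  have pz: "p\<^sup>2 + E k > 0" for p k using E[of k] by (simp add: add_nonneg_pos)
  \<comment> \<open>For \<open>a \<le> 1\<close> the weight is not \<open>C\<^sup>1\<close> at the sphere; these regularisations keep \<open>p g'(p)\<close> bounded by a multiple of \<open>p\<^sup>a\<close>.\<close>
  define g where "g k p = ppow (a + 2) p / (p\<^sup>2 + E k)" for k p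
  define g' where "g' k p = ((a + 2) * ppow (a + 1) p * (p\<^sup>2 + E k) - ppow (a + 2) p * (2 * p)) / (p\<^sup>2 + E k)\<^sup>2" for k p
  \<comment> \<open>The ratio of the regularised weight to p^a for p > 0: it lies between 0 and 1
    and tends to 1 there, so it yields both the domination and the limit.\<close>
  define \<theta> where "\<theta> k p = p\<^sup>2 / (p\<^sup>2 + E k)" for k p
  have \<theta>: "0 \<le> \<theta> k p" "\<theta> k p \<le> 1" for k p
    using E[of k] pz[of p k] by (auto simp: \<theta>_def)
  have gd: "(g k has_real_derivative g' k p) (at p)" for k p
  proof -
    have d: "((\<lambda>p. p\<^sup>2 + E k) has_real_derivative 2 * p) (at p)" by (auto intro!: derivative_eq_intros)
    have d2: "(ppow (a + 2) has_real_derivative (a + 2) * ppow (a + 1) p) (at p)"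
      using ppow_has_derivative[of "a + 2" p] a by (simp add: algebra_simps)
    show ?thesis
      unfolding g_def[abs_def] g'_def using DERIV_divide[OF d2 d] pz[of p k] by (simp add: power2_eq_square)
  qed
  have g'c: "continuous_on UNIV (g' k)" for k
    unfolding g'_def[abs_def] using pz[of _ k] a
    by (intro continuous_intros ppow_continuous) (auto simp: less_imp_neq[symmetric] dest: less_imp_neq)
  have gc: "continuous_on UNIV (g k)" for k using gd by (meson DERIV_continuous_on has_field_derivative_at_within)
  have gt: "g k p = ppow a p * \<theta> k p" for k p
    by (cases "p > 0") (auto simp: g_def \<theta>_def ppow_pos ppow_neg powr_add)
  have gt': "g' k p * p = ppow a p * ((a + 2) * \<theta> k p - 2 * (\<theta> k p)\<^sup>2)" for k p
  proof (cases "p > 0")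
    case True
    define D where "D = p\<^sup>2 + E k"
    have D: "D \<noteq> 0" using pz[of p k] by (simp add: D_def)
    have "ppow (a + 1) p = ppow a p * p" "ppow (a + 2) p = ppow a p * p\<^sup>2"
      using True by (auto simp: ppow_pos powr_add)
    then show ?thesis unfolding g'_def \<theta>_def D_def[symmetric] using D
      by (simp add: field_simps power2_eq_square)
  qed (auto simp: g'_def ppow_neg)
  have pp: "0 \<le> ppow a p" "p \<le> 1 \<Longrightarrow> ppow a p \<le> 1" for p
    using a by (auto simp: ppow_def powr_le1)
  let ?R = "\<lambda>y. r * (HL y - HZ y) - (DIM('a) + 1) * HY y"
  let ?I = "\<lambda>k y. - 2 * (g' k (1 - y \<bullet> y) * (1 - y \<bullet> y)) * HY y + g k (1 - y \<bullet> y) * ?R y"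
  have bnd: "\<bar>?I k y\<bar> \<le> indicator (cball 0 1) y * (2 * (a + 4) * \<bar>HY y\<bar> + \<bar>?R y\<bar>)" for k y
  proof (cases "y \<in> cball 0 1")
    case True
    let ?p = "1 - y \<bullet> y"
    have p1: "?p \<le> 1" by simp
    \<comment> \<open>The constant a + 4 arises as (a + 2) + 2, with both \<open>\<theta>\<close>
      and its square at most 1.\<close>
    have "\<bar>(a + 2) * \<theta> k ?p - 2 * (\<theta> k ?p)\<^sup>2\<bar> \<le> (a + 2) * 1 + 2 * 1"
    proof -
      have "(a + 2) * \<theta> k ?p \<le> (a + 2) * 1" "0 \<le> (a + 2) * \<theta> k ?p" using a \<theta>[of k ?p] by (auto intro!: mult_left_mono)
      moreover have "(\<theta> k ?p)\<^sup>2 \<le> 1" "0 \<le> (\<theta> k ?p)\<^sup>2" using \<theta>[of k ?p] by (auto simp: power_le_one)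
      ultimately show ?thesis by (intro abs_leI; linarith)
    qed
    then have "ppow a ?p * \<bar>(a + 2) * \<theta> k ?p - 2 * (\<theta> k ?p)\<^sup>2\<bar> \<le> 1 * (a + 4)"
      using pp[of ?p] a by (intro mult_mono) auto
    then have 1: "\<bar>g' k ?p * ?p\<bar> \<le> a + 4" unfolding gt' abs_mult using pp[of ?p] by simp
    have 2: "\<bar>g k ?p\<bar> \<le> 1" unfolding gt abs_mult using pp[of ?p] \<theta>[of k ?p] by (simp add: mult_le_one)
    have "\<bar>?I k y\<bar> \<le> \<bar>- 2 * (g' k ?p * ?p) * HY y\<bar> + \<bar>g k ?p * ?R y\<bar>" by (rule abs_triangle_ineq)
    also have "\<bar>- 2 * (g' k ?p * ?p) * HY y\<bar> = 2 * \<bar>g' k ?p * ?p\<bar> * \<bar>HY y\<bar>" by (simp add: abs_mult)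
    also have "\<dots> \<le> 2 * (a + 4) * \<bar>HY y\<bar>" using 1 by (intro mult_right_mono) auto
    also have "\<bar>g k ?p * ?R y\<bar> \<le> 1 * \<bar>?R y\<bar>" unfolding abs_mult using 2 by (intro mult_right_mono) auto
    finally show ?thesis using True by simp
  next
    case False
    then have "1 - y \<bullet> y \<le> 0" by (rule outside_unit_ball)
    then show ?thesis using False by (simp add: gt gt' ppow_neg)
  qed
  have "(\<lambda>k. \<integral>y. ?I k y \<partial>lborel) \<longlonglongrightarrow> (\<integral>y. ppow a (1 - y \<bullet> y) * (r * (HL y - HZ y) - (DIM('a) + 1 + 2 * a) * HY y) \<partial>lborel)"
  proof (rule integral_dominated_convergence[where w = "\<lambda>y. indicator (cball 0 1) y * (2 * (a + 4) * \<bar>HY y\<bar> + \<bar>?R y\<bar>)"])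
    show "integrable lborel (\<lambda>y. indicator (cball 0 1) y * (2 * (a + 4) * \<bar>HY y\<bar> + \<bar>?R y\<bar>))"
      by (rule ball_weight_integrable) (auto simp: ball_weight_def intro!: exI[of _ 1] continuous_intros H_continuous borel_measurable_indicator)
    show "AE y in lborel. norm (?I k y) \<le> indicator (cball 0 1) y * (2 * (a + 4) * \<bar>HY y\<bar> + \<bar>?R y\<bar>)" for k
      using bnd[of k] by (simp only: real_norm_def) simp
    have m: "HY \<in> borel_measurable borel" "HL \<in> borel_measurable borel" "HZ \<in> borel_measurable borel"
      by (auto intro: borel_measurable_continuous_onI H_continuous)
    have mp: "ppow a \<in> borel_measurable borel" unfolding ppow_def[abs_def] by measurable
    show "(\<lambda>y. ppow a (1 - y \<bullet> y) * (r * (HL y - HZ y) - (DIM('a) + 1 + 2 * a) * HY y)) \<in> borel_measurable lborel"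
      using m mp by measurable
    have mg: "g k \<in> borel_measurable borel" "g' k \<in> borel_measurable borel" for k
      by (auto intro: borel_measurable_continuous_onI gc g'c)
    show "?I k \<in> borel_measurable lborel" for k
      using m mg[of k] by measurable
    show "AE y in lborel. (\<lambda>k. ?I k y) \<longlonglongrightarrow> ppow a (1 - y \<bullet> y) * (r * (HL y - HZ y) - (DIM('a) + 1 + 2 * a) * HY y)"
    proof (rule AE_I2)
      fix y :: 'a
      let ?p = "1 - y \<bullet> y"
      show "(\<lambda>k. ?I k y) \<longlonglongrightarrow> ppow a ?p * (r * (HL y - HZ y) - (DIM('a) + 1 + 2 * a) * HY y)"
      proof (cases "?p > 0")
        case True
        have t: "(\<lambda>k. \<theta> k ?p) \<longlonglongrightarrow> ?p\<^sup>2 / (?p\<^sup>2 + 0)"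
          unfolding \<theta>_def using True by (intro tendsto_intros El) auto
        have "(\<lambda>k. ?I k y) \<longlonglongrightarrow> - 2 * (ppow a ?p * ((a + 2) * (?p\<^sup>2 / (?p\<^sup>2 + 0)) - 2 * (?p\<^sup>2 / (?p\<^sup>2 + 0))\<^sup>2)) * HY y
           + ppow a ?p * (?p\<^sup>2 / (?p\<^sup>2 + 0)) * ?R y"
          unfolding gt gt' by (intro tendsto_intros t)
        also have "?p\<^sup>2 / (?p\<^sup>2 + 0) = 1" using True by simp
        also have "- 2 * (ppow a ?p * ((a + 2) * 1 - 2 * 1\<^sup>2)) * HY y + ppow a ?p * 1 * ?R y
           = ppow a ?p * (r * (HL y - HZ y) - (DIM('a) + 1 + 2 * a) * HY y)" by (simp add: algebra_simps)
        finally show ?thesis .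
      next
        case False then show ?thesis by (simp add: gt gt' ppow_neg)
      qed
    qed
  qed
  moreover have "(\<integral>y. ?I k y \<partial>lborel) = 0" for k
  proof (rule divergence_integral[OF gd g'c])
    show "g k p = 0" "g' k p = 0" if "p \<le> 0" for p using that by (auto simp: g_def g'_def ppow_neg)
  qed
  ultimately show ?thesis by (simp add: LIMSEQ_const_iff)
qed

end

section \<open>From the divergence identity to solution operators of the wave equation\<close>

lemma ball_weight_ppow:
  fixes a c :: real
  assumes "a \<ge> 0"
  shows "ball_weight (\<lambda>y::'a::euclidean_space. c * ppow a (1 - y \<bullet> y))"
  unfolding ball_weight_def
proof (intro conjI exI allI)
  have mp: "ppow a \<in> borel_measurable borel" unfolding ppow_def[abs_def] by measurable
  then show "(\<lambda>y::'a. c * ppow a (1 - y \<bullet> y)) \<in> borel_measurable borel" by measurable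
  fix y :: 'a
  show "\<bar>c * ppow a (1 - y \<bullet> y)\<bar> \<le> \<bar>c\<bar> * indicator (cball 0 1) y"
  proof (cases "y \<in> cball 0 1")
    case True
    have "0 \<le> ppow a (1 - y \<bullet> y)" "ppow a (1 - y \<bullet> y) \<le> 1"
      using assms by (auto simp: ppow_def powr_le1)
    then show ?thesis using True by (auto simp: abs_mult intro: mult_left_le)
  next
    case False
    then have "1 - y \<bullet> y \<le> 0" by (rule outside_unit_ball)
    then show ?thesis using False by (simp add: ppow_neg)
  qed
qed

lemma ppow_integral_pos:
  fixes a :: real
  assumes "a \<ge> 0"
  shows "integral\<^sup>L lborel (\<lambda>y::'a::euclidean_space. ppow a (1 - y \<bullet> y)) > 0"
proof -
  have i: "integrable lborel (\<lambda>y::'a. ppow a (1 - y \<bullet> y))"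
    using ball_weight_integrable[OF ball_weight_ppow[OF assms, of 1], of "\<lambda>_. 1"] by simp
  \<comment> \<open>On the ball of radius 1/2 the quantity 1 - |y|^2 is at least 3/4, so the weight
    is at least (3/4)^a.\<close>
  have "0 < (3/4) powr a * measure lborel (cball (0::'a) (1/2))"
    using content_cball_pos[of "1/2" "0::'a"] by simp
  also have "\<dots> = (\<integral>y. (3/4) powr a * indicator (cball (0::'a) (1/2)) y \<partial>lborel)" by simp
  also have "\<dots> \<le> integral\<^sup>L lborel (\<lambda>y::'a. ppow a (1 - y \<bullet> y))"
  proof (rule integral_mono[OF integrable_indicator_cball i])
    fix y :: 'a
    show "(3/4) powr a * indicator (cball 0 (1/2)) y \<le> ppow a (1 - y \<bullet> y)"
    proof (cases "y \<in> cball 0 (1/2)")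
      case True
      then have "(norm y)\<^sup>2 \<le> (1/2)\<^sup>2" by (intro power_mono) auto
      then have "y \<bullet> y \<le> 1/4" unfolding power2_norm_eq_inner by (simp add: power2_eq_square)
      then show ?thesis using True assms by (auto simp: ppow_def intro: powr_mono2)
    qed (simp add: ppow_def)
  qed
  finally show ?thesis .
qed

text \<open>Differentiating under the integral turns u_r, u_rr and the Laplacian of u into weighted
  integrals of \<open>HY\<close>, \<open>HZ\<close> and \<open>HL\<close>. The equation is then
  \<open>weighted_identity\<close> multiplied by \<open>c\<close>.\<close>

lemma epd_avg:
  fixes h :: "'a::euclidean_space \<Rightarrow> real" and a c :: real
  assumes h: "Ck 2 UNIV h" and a: "a \<ge> 0"
  defines "q \<equiv> \<lambda>y::'a. c * ppow a (1 - y \<bullet> y)"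
  shows "epd (DIM('a) + 1 + 2 * a) (avg [] q h)"
proof -
  have q: "ball_weight q" unfolding q_def by (rule ball_weight_ppow[OF a])
  have qb: "ball_weight (\<lambda>y. (y \<bullet> b) * q y)" if "b \<in> Basis" for b by (rule ball_weight_mult_coord[OF q that])
  have qbc: "ball_weight (\<lambda>y. (y \<bullet> i) * ((y \<bullet> b) * q y))" if "b \<in> Basis" "i \<in> Basis" for b i by (rule ball_weight_mult_coord[OF qb that(2)]) (use that in auto)
  have h2: "Ck (Suc (Suc 0)) UNIV h" "Ck (Suc 0) UNIV h" using h Ck_mono[OF h, of 1] by (simp_all add: numeral_2_eq_2)
  have d1: "dt (avg [] q h) x r = (\<Sum>b\<in>Basis. avg [b] (\<lambda>y. (y \<bullet> b) * q y) h x r)" for x r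
    by (rule dt_eqI[OF avg_deriv_r[OF q h2(2)]]) auto
  have d2: "dt (dt (avg [] q h)) x r = (\<Sum>b\<in>Basis. \<Sum>i\<in>Basis. avg [i, b] (\<lambda>y. (y \<bullet> i) * ((y \<bullet> b) * q y)) h x r)" for x r
    by (rule dt_eqI, unfold d1, rule DERIV_sum, rule avg_deriv_r[OF qb h2(1)]) auto
  have l1: "dx b (avg [] q h) = avg [b] q h" if "b \<in> Basis" for b
    by (intro ext dx_eqI avg_deriv_x[OF q h2(2)]) (use that in auto)
  have l2: "dx b (avg [b] q h) = avg [b, b] q h" if "b \<in> Basis" for b
    by (intro ext dx_eqI avg_deriv_x[OF q h2(1)]) (use that in auto)
  have l: "lapx (avg [] q h) x r = (\<Sum>b\<in>Basis. avg [b, b] q h x r)" for x r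
    by (simp add: lapx_def l1 l2)
  show ?thesis unfolding epd_def
  proof (intro allI)
    fix x r
    let ?H1 = "H1 h x r" and ?H2 = "H2 h x r" and ?HY = "HY h x r" and ?HL = "HL h x r" and ?HZ = "HZ h x r"
    note Hd = H1_def[OF h] H2_def[OF h] HY_def[OF h] HL_def[OF h] HZ_def[OF h]
    note Hc = H_continuous[OF h, where x = x and r = r]
    have i1: "integrable lborel (\<lambda>y. ((y \<bullet> b) * q y) * ?H1 b y)" if "b \<in> Basis" for b
      by (rule ball_weight_integrable[OF qb]) (use Hc that in auto)
    have i2: "integrable lborel (\<lambda>y. ((y \<bullet> i) * ((y \<bullet> b) * q y)) * ?H2 i b y)" if "b \<in> Basis" "i \<in> Basis" for b i
      by (rule ball_weight_integrable[OF qbc]) (use Hc that in auto)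
    have i3: "integrable lborel (\<lambda>y. q y * ?H2 b b y)" if "b \<in> Basis" for b
      by (rule ball_weight_integrable[OF q]) (use Hc that in auto)
    have iY: "integrable lborel (\<lambda>y. q y * ?HY y)" "integrable lborel (\<lambda>y. q y * ?HL y)" "integrable lborel (\<lambda>y. q y * ?HZ y)"
      by (rule ball_weight_integrable[OF q], use Hc in auto)+
    have e1: "dt (avg [] q h) x r = (\<integral>y. q y * ?HY y \<partial>lborel)"
    proof -
      have "(\<integral>y. q y * ?HY y \<partial>lborel) = (\<integral>y. (\<Sum>b\<in>Basis. ((y \<bullet> b) * q y) * ?H1 b y) \<partial>lborel)"
        by (simp add: Hd sum_distrib_left mult_ac)
      also have "\<dots> = (\<Sum>b\<in>Basis. \<integral>y. ((y \<bullet> b) * q y) * ?H1 b y \<partial>lborel)" by (rule Bochner_Integration.integral_sum[OF i1])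
      finally show ?thesis by (simp add: d1 avg_def Hd)
    qed
    have e2: "dt (dt (avg [] q h)) x r = (\<integral>y. q y * ?HZ y \<partial>lborel)"
    proof -
      have "(\<integral>y. q y * ?HZ y \<partial>lborel) = (\<integral>y. (\<Sum>b\<in>Basis. \<Sum>i\<in>Basis. ((y \<bullet> i) * ((y \<bullet> b) * q y)) * ?H2 i b y) \<partial>lborel)"
        unfolding Hd(5) sum_distrib_left by (subst sum.swap) (simp add: mult_ac)
      also have "\<dots> = (\<Sum>b\<in>Basis. \<Sum>i\<in>Basis. \<integral>y. ((y \<bullet> i) * ((y \<bullet> b) * q y)) * ?H2 i b y \<partial>lborel)"
        by (subst Bochner_Integration.integral_sum, use i2 in \<open>auto intro!: sum.cong Bochner_Integration.integral_sum\<close>)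
      finally show ?thesis by (simp add: d2 avg_def Hd)
    qed
    have e3: "lapx (avg [] q h) x r = (\<integral>y. q y * ?HL y \<partial>lborel)"
    proof -
      have "(\<integral>y. q y * ?HL y \<partial>lborel) = (\<integral>y. (\<Sum>b\<in>Basis. q y * ?H2 b b y) \<partial>lborel)"
        by (simp add: Hd sum_distrib_left mult_ac)
      also have "\<dots> = (\<Sum>b\<in>Basis. \<integral>y. q y * ?H2 b b y \<partial>lborel)" by (rule Bochner_Integration.integral_sum[OF i3])
      finally show ?thesis by (simp add: l avg_def Hd)
    qed
    have "0 = c * (\<integral>y. ppow a (1 - y \<bullet> y) * (r * (?HL y - ?HZ y) - (DIM('a) + 1 + 2 * a) * ?HY y) \<partial>lborel)"
      using weighted_identity[OF h a, where x = x and r = r] by simp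
    also have "\<dots> = (\<integral>y. r * (q y * ?HL y) - r * (q y * ?HZ y) - (DIM('a) + 1 + 2 * a) * (q y * ?HY y) \<partial>lborel)"
      by (subst integral_mult_right_zero[symmetric], rule Bochner_Integration.integral_cong) (auto simp: q_def algebra_simps)
    also have "\<dots> = r * (\<integral>y. q y * ?HL y \<partial>lborel) - r * (\<integral>y. q y * ?HZ y \<partial>lborel) - (DIM('a) + 1 + 2 * a) * (\<integral>y. q y * ?HY y \<partial>lborel)"
      using iY by simp
    finally show "r * dt (dt (avg [] q h)) x r + (DIM('a) + 1 + 2 * a) * dt (avg [] q h) x r = r * lapx (avg [] q h) x r"
      unfolding e1 e2 e3 by simp
  qed
qed

text \<open>Starting from parameter 2 m, each application of \<open>epd_step\<close> lowers the
  parameter by two and costs one derivative. The induction ends at parameter 2, one step before the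
  wave equation, because that operator supplies the r-primitive of the wave.\<close>

lemma wave_operator_aux:
  fixes m :: nat
  defines "m \<equiv> DIM('a::euclidean_space) div 2 + 1"
  shows "j < m \<Longrightarrow> \<exists>A::('a \<Rightarrow> real) \<Rightarrow> 'a \<Rightarrow> real \<Rightarrow> real. avgop j A \<and>
    (\<forall>h. Ck (j + 2) UNIV h \<longrightarrow> epd (2 * (real m - real j)) (A h) \<and> (\<forall>x. A h x 0 = h x))"
proof (induction j)
  case 0
  \<comment> \<open>The exponent making the Euler-Poisson-Darboux parameter \<open>2 m\<close>: it is 0 in odd and 1/2 in even dimension.\<close>
  define a where "a = real m - (DIM('a) + 1) / 2"
  have a: "a \<ge> 0" by (cases "even (DIM('a))") (auto simp: a_def m_def elim!: evenE oddE)
  define I where "I = integral\<^sup>L lborel (\<lambda>y::'a. ppow a (1 - y \<bullet> y))"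
  have I: "I > 0" unfolding I_def by (rule ppow_integral_pos[OF a])
  \<comment> \<open>Total mass one makes the average at r = 0 equal to \<open>h\<close>.\<close>
  define q where "q = (\<lambda>y::'a. (1 / I) * ppow a (1 - y \<bullet> y))"
  have q: "ball_weight q" unfolding q_def by (rule ball_weight_ppow[OF a])
  have "epd (2 * (real m - real 0)) (avg [] q h) \<and> (\<forall>x. avg [] q h x 0 = h x)" if "Ck (0 + 2) UNIV h" for h
  proof
    have "epd (DIM('a) + 1 + 2 * a) (avg [] q h)" unfolding q_def by (rule epd_avg) (use that a in \<open>auto simp: numeral_2_eq_2\<close>)
    moreover have "DIM('a) + 1 + 2 * a = 2 * (real m - real 0)" by (simp add: a_def field_simps)
    ultimately show "epd (2 * (real m - real 0)) (avg [] q h)" by simp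
    show "\<forall>x. avg [] q h x 0 = h x" using I by (simp add: avg_def q_def I_def[symmetric])
  qed
  then show ?case by (intro exI[of _ "avg [] q"]) (auto intro!: avgop.avg q)
next
  case (Suc j)
  from Suc.IH[OF Suc_lessD[OF Suc.prems]] obtain A :: "('a \<Rightarrow> real) \<Rightarrow> 'a \<Rightarrow> real \<Rightarrow> real"
    where A0: "avgop j A" "\<forall>h. Ck (j + 2) UNIV h \<longrightarrow> epd (2 * (real m - real j)) (A h) \<and> (\<forall>x. A h x 0 = h x)" by blast
  then have A: "avgop j A" "\<And>h. Ck (j + 2) UNIV h \<Longrightarrow> epd (2 * (real m - real j)) (A h)"
     "\<And>h x. Ck (j + 2) UNIV h \<Longrightarrow> A h x 0 = h x" by blast+
  obtain D where D: "avgop (Suc j) D" "\<And>h x r. Ck (Suc j) UNIV h \<Longrightarrow> ((\<lambda>r. A h x r) has_real_derivative D h x r) (at r)"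
    using avgop_deriv_r[OF A(1)] by blast
  define k where "k = 2 * (real m - real j)"
  \<comment> \<open>The parameter stays an even integer, so the division by k - 1 in the descent is
    always possible.\<close>
  have k: "k \<noteq> 1" "k - 2 = 2 * (real m - real (Suc j))" using Suc(2) by (auto simp: k_def)
  let ?A = "\<lambda>h x r. A h x r + (1 / (k - 1)) * (r * D h x r)"
  have "avgop (Suc j) ?A" by (intro avgop.intros D avgop_mono[OF A(1)]) simp
  moreover have "epd (2 * (real m - real (Suc j))) (?A h) \<and> (\<forall>x. ?A h x 0 = h x)" if h: "Ck (Suc j + 2) UNIV h" for h
  proof
    have h': "Ck (j + 2) UNIV h" "Ck (Suc j) UNIV h" "Ck (j + 3) UNIV h" using h Ck_mono[OF h] by auto
    have "D h = dt (A h)" by (intro ext) (rule dt_eqI[OF D(2)[OF h'(2)], symmetric])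
    moreover have "epd (k - 2) (\<lambda>x r. A h x r + r / (k - 1) * dt (A h) x r)"
      by (rule epd_step(3)[OF avgop_Ck[OF A(1) h'(3)] _ k(1)]) (use A(2)[OF h'(1)] in \<open>simp add: k_def\<close>)
    ultimately show "epd (2 * (real m - real (Suc j))) (?A h)" by (simp add: k(2))
    show "\<forall>x. ?A h x 0 = h x" using A(3)[OF h'(1)] by simp
  qed
  ultimately show ?case by blast
qed

text \<open>For k = 2 the last descent step is w + r w_r = (r w)_r. So \<open>V h\<close> is the
  wave, \<open>r * A h x r\<close> is its primitive in r, and the primitive costs one derivative of
  the data less.\<close>

theorem wave_operators:
  fixes m :: nat
  defines "m \<equiv> DIM('a::euclidean_space) div 2 + 1"
  obtains A V :: "('a::euclidean_space \<Rightarrow> real) \<Rightarrow> 'a \<Rightarrow> real \<Rightarrow> real" where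
    "avgop (m - 1) A" "avgop m V"
    "\<And>h x r. Ck m UNIV h \<Longrightarrow> ((\<lambda>r. r * A h x r) has_real_derivative V h x r) (at r)"
    "\<And>h x r. Ck (m + 2) UNIV h \<Longrightarrow> ((\<lambda>r. V h x r) has_real_derivative r * lapx (A h) x r) (at r)"
    "\<And>h x r. Ck (m + 2) UNIV h \<Longrightarrow> dt (dt (V h)) x r = lapx (V h) x r"
    "\<And>h x. Ck (m + 2) UNIV h \<Longrightarrow> V h x 0 = h x"
    "\<And>h. Ck (m + 2) UNIV h \<Longrightarrow> is_wave_sol h (V h)"
proof -
  have m: "m - 1 < m" "Suc (m - 1) = m" "m - 1 + 2 = m + 1" "m - 1 + 3 = m + 2" by (auto simp: m_def)
  have m2: "2 * (real m - real (m - 1)) = 2" by (simp add: m_def)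
  obtain A :: "('a \<Rightarrow> real) \<Rightarrow> 'a \<Rightarrow> real \<Rightarrow> real" where A: "avgop (m - 1) A" "\<And>h. Ck (m + 1) UNIV h \<Longrightarrow> epd 2 (A h)"
     "\<And>h x. Ck (m + 1) UNIV h \<Longrightarrow> A h x 0 = h x"
    using wave_operator_aux[of "m - 1", where 'a = 'a] m m2 unfolding m_def[symmetric] by auto
  obtain D where D: "avgop m D" "\<And>h x r. Ck m UNIV h \<Longrightarrow> ((\<lambda>r. A h x r) has_real_derivative D h x r) (at r)"
    using avgop_deriv_r[OF A(1)] m by auto
  define V where "V = (\<lambda>h x r. A h x r + r * D h x r)"
  have V: "avgop m V" unfolding V_def by (intro avgop.intros D avgop_mono[OF A(1)]) simp
  have S: "((\<lambda>r. r * A h x r) has_real_derivative V h x r) (at r)" if "Ck m UNIV h" for h x r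
    using D(2)[OF that, of x r] by (auto simp: V_def intro!: derivative_eq_intros)
  have st: "((\<lambda>r. V h x r) has_real_derivative r * lapx (A h) x r) (at r)"
    "dt (dt (V h)) x r = lapx (V h) x r" "V h x 0 = h x" "dt (V h) x 0 = 0" "Ck 2 UNIV (\<lambda>(x, r). V h x r)"
    if h: "Ck (m + 2) UNIV h" for h x r
  proof -
    have h': "Ck (m + 1) UNIV h" "Ck m UNIV h" "Ck (m - 1 + 3) UNIV h" using h Ck_mono[OF h] m by auto
    have D': "D h = dt (A h)" by (intro ext) (rule dt_eqI[OF D(2)[OF h'(2)], symmetric])
    have V': "V h = (\<lambda>x r. A h x r + r / (2 - 1) * dt (A h) x r)" by (simp add: V_def D')
    note e = avgop_Ck[OF A(1) h'(3)] A(2)[OF h'(1)]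
    show *: "((\<lambda>r. V h x r) has_real_derivative r * lapx (A h) x r) (at r)" using epd_step(1)[OF e, of x r] by (simp add: V')
    show "dt (dt (V h)) x r = lapx (V h) x r" using epd_step(4)[OF e, of x r] by (simp add: V')
    show "V h x 0 = h x" using A(3)[OF h'(1)] by (simp add: V_def)
    show "dt (V h) x 0 = 0" using epd_step(2)[OF e, of x 0] by (simp add: V')
    show "Ck 2 UNIV (\<lambda>(x, r). V h x r)" by (rule avgop_Ck[OF V h])
  qed
  show ?thesis
  proof (rule that[OF A(1) V S])
    show "is_wave_sol h (V h)" if "Ck (m + 2) UNIV h" for h
      unfolding is_wave_sol_iff using st[OF that] by simp
  qed (use st in auto)
qed

section \<open>Uniqueness for the wave equation\<close>

lemma continuous_on_slice:
  assumes "continuous_on UNIV (\<lambda>(s, y). k s y)"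
  shows "continuous_on UNIV (k s)"
proof -
  have "continuous_on UNIV (\<lambda>y. (s, y))" by (intro continuous_intros)
  from continuous_on_compose2[OF assms this] show ?thesis by simp
qed

lemma compact_support_integrable:
  fixes Z :: "'a::euclidean_space \<Rightarrow> real"
  assumes "continuous_on UNIV Z" "\<And>y. y \<notin> cball 0 D \<Longrightarrow> Z y = 0"
  shows "integrable lborel Z"
proof -
  have "integrable lborel (\<lambda>y. indicator (cball 0 D) y *\<^sub>R Z y)"
    using assms by (intro borel_integrable_compact) (auto intro: continuous_on_subset)
  moreover have "(\<lambda>y. indicator (cball 0 D) y *\<^sub>R Z y) = Z" using assms by (auto simp: fun_eq_iff indicator_def)
  ultimately show ?thesis by simp
qed

lemma compact_support_derivative:
  fixes F :: "real \<Rightarrow> 'a::euclidean_space \<Rightarrow> real"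
  assumes d: "\<And>s y. ((\<lambda>s. F s y) has_real_derivative F' s y) (at s)"
    and c: "continuous_on UNIV (\<lambda>(s, y). F s y)" and c': "continuous_on UNIV (\<lambda>(s, y). F' s y)"
    and z: "\<And>s y. \<bar>s - s0\<bar> < 1 \<Longrightarrow> y \<notin> cball 0 D \<Longrightarrow> F s y = 0 \<and> F' s y = 0"
  shows "((\<lambda>s. integral\<^sup>L lborel (F s)) has_real_derivative integral\<^sup>L lborel (F' s0)) (at s0)"
proof -
  have cs: "continuous_on UNIV (\<lambda>y. F s y)" "continuous_on UNIV (\<lambda>y. F' s y)" for s
    by (rule continuous_on_slice[OF c] continuous_on_slice[OF c'])+
  have "compact ((\<lambda>(s, y). F' s y) ` (cball s0 1 \<times> cball 0 D))"
    by (intro compact_continuous_image continuous_on_subset[OF c'] compact_Times) auto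
  then obtain B where B: "\<And>p. p \<in> cball s0 1 \<times> cball 0 D \<Longrightarrow> \<bar>(\<lambda>(s, y). F' s y) p\<bar> \<le> B"
    using compact_imp_bounded bounded_iff by (metis image_eqI real_norm_def)
  show ?thesis
  proof (rule lint_has_derivative[where e = 1 and g = "\<lambda>y. B * indicator (cball 0 D) y"])
    fix s assume s: "\<bar>s - s0\<bar> < 1"
    show "integrable lborel (F s)" by (rule compact_support_integrable[OF cs(1)]) (use z[OF s] in auto)
    show "\<bar>F' s y\<bar> \<le> B * indicator (cball 0 D) y" for y
    proof (cases "y \<in> cball 0 D")
      case True then show ?thesis using B[of "(s, y)"] s by (simp add: dist_real_def abs_minus_commute)
    qed (use z[OF s] in auto)
  next
    show "integrable lborel (\<lambda>y::'a. B * indicator (cball 0 D) y :: real)" by (rule integrable_indicator_cball)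
    show "F' s0 \<in> borel_measurable lborel"
      using compact_support_integrable[OF cs(2)[of s0], of D] z[of s0] by auto
  qed (use d in auto)
qed

lemma nonneg_integral_zero:
  fixes F :: "'a::euclidean_space \<Rightarrow> real"
  assumes c: "continuous_on UNIV F" and i: "integrable lborel F" and n: "\<And>y. F y \<ge> 0" and z: "integral\<^sup>L lborel F \<le> 0"
  shows "F y = 0"
proof (rule ccontr)
  assume "F y \<noteq> 0"
  then have p: "F y > 0" using n[of y] by simp
  have "isCont F y" using c by (simp add: continuous_on_eq_continuous_at)
  then obtain d where d: "d > 0" "\<And>u. dist u y < d \<Longrightarrow> dist (F u) (F y) < F y / 2"
    using p unfolding continuous_at_eps_delta by (metis half_gt_zero)
  have "0 < F y / 2 * measure lborel (ball y d)"
    using p d content_ball_pos[of d y] by simp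
  also have "\<dots> = (\<integral>u. F y / 2 * indicator (ball y d) u \<partial>lborel)" by simp
  also have "\<dots> \<le> integral\<^sup>L lborel F"
  proof (rule integral_mono[OF _ i])
    show "integrable lborel (\<lambda>u. F y / 2 * indicator (ball y d) u)"
      by (intro integrable_mult_right integrable_real_indicator)
         (use emeasure_bounded_finite[OF bounded_ball[of y d]] in \<open>simp_all add: top.not_eq_extremum\<close>)
    show "F y / 2 * indicator (ball y d) u \<le> F u" for u
      using d(2)[of u] n[of u] by (auto simp: indicator_def dist_real_def dist_commute abs_if split: if_splits)
  qed
  finally show False using z by simp
qed

text \<open>sqrt (1 + |y|^2) serves as a substitute for |y|: it is smooth at the origin and its
  gradient still has length at most 1, which is what the energy estimate requires of a spacelike
  cut-off.\<close>

lemma has_pd_sigma: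
  assumes "b \<in> Basis"
  shows "has_pd b (\<lambda>y. sqrt (1 + y \<bullet> y)) ((y \<bullet> b) / sqrt (1 + y \<bullet> y)) y"
proof -
  have pos: "1 + y \<bullet> y > 0" for y :: 'a by (simp add: add_pos_nonneg)
  have "has_pd b (\<lambda>y. - (1 - y \<bullet> y) + 2) (2 * (y \<bullet> b)) y"
    using has_pd_add[OF has_pd_mult[OF has_pd_const[of b "-1"] has_pd_norm_sq[OF assms]] has_pd_const[of b 2], of y] by simp
  then have "has_pd b (\<lambda>y. 1 + y \<bullet> y) (2 * (y \<bullet> b)) y" by (simp add: algebra_simps)
  from has_pd_compose[OF this DERIV_real_sqrt[OF pos]] show ?thesis by (simp add: field_simps)
qed

text \<open>The energy density is weighted by \<open>((A - r - sqrt (1 + |y|\<^sup>2))\<^sub>+)\<^sup>2\<close>. The weight is compactly supported and its spatial gradient is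
  dominated by minus its time derivative, so the weighted energy cannot grow.\<close>

locale zero_data_wave =
  fixes z :: "'a::euclidean_space \<Rightarrow> real \<Rightarrow> real"
  assumes reg: "Ck 2 UNIV (\<lambda>(x, r). z x r)"
    and eq: "dt (dt z) x r = lapx z x r"
    and z0: "z x 0 = 0" and zt0: "dt z x 0 = 0"
begin

lemma reg2: "Ck (Suc (Suc 0)) UNIV (\<lambda>(x, r). z x r)" "Ck (Suc 0) UNIV (\<lambda>(x, r). z x r)"
  using reg Ck_mono[OF reg, of 1] by (simp_all add: numeral_2_eq_2)

lemma comm: "b \<in> Basis \<Longrightarrow> dx b (dt z) x r = dt (dx b z) x r"
  by (rule dx_dt_commute[OF reg])

definition "en y r = (dt z y r)\<^sup>2 + (\<Sum>b\<in>Basis. (dx b z y r)\<^sup>2)"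
definition "sg A y r = A - r - sqrt (1 + y \<bullet> y)" for A :: real and y :: 'a
text \<open>The r-derivative of the energy density, with z_rr already replaced by the
  Laplacian.\<close>

definition "en' y r = 2 * dt z y r * lapx z y r + (\<Sum>b\<in>Basis. 2 * dx b z y r * dx b (dt z) y r)"
definition "F A r y = ppow 2 (sg A y r) * en y r"
definition "F' A r y = - 2 * ppow 1 (sg A y r) * en y r + ppow 2 (sg A y r) * en' y r"

lemma c_basic:
  "continuous_on UNIV (\<lambda>(y, r). dt z y r)" "b \<in> Basis \<Longrightarrow> continuous_on UNIV (\<lambda>(y, r). dx b z y r)"
  "b \<in> Basis \<Longrightarrow> continuous_on UNIV (\<lambda>(y, r). dx b (dt z) y r)"
  "b \<in> Basis \<Longrightarrow> continuous_on UNIV (\<lambda>(y, r). dx b (dx b z) y r)"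
  "continuous_on UNIV (\<lambda>(y, r). lapx z y r)"
proof -
  show "continuous_on UNIV (\<lambda>(y, r). dt z y r)" by (rule Ck_continuous[OF Ck_dt[OF reg2(1)]])
  show "b \<in> Basis \<Longrightarrow> continuous_on UNIV (\<lambda>(y, r). dx b z y r)" by (rule Ck_continuous[OF Ck_dx[OF reg2(1)]])
  show "b \<in> Basis \<Longrightarrow> continuous_on UNIV (\<lambda>(y, r). dx b (dt z) y r)" by (rule Ck_continuous[OF Ck_dx[OF Ck_dt[OF reg2(1)]]])
  show xx: "continuous_on UNIV (\<lambda>(y, r). dx b (dx b z) y r)" if "b \<in> Basis" for b
    by (rule Ck_continuous[OF Ck_dx[OF Ck_dx[OF reg2(1) that] that]])
  show "continuous_on UNIV (\<lambda>(y, r). lapx z y r)"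
    unfolding lapx_def case_prod_unfold using xx by (auto simp: case_prod_unfold intro!: continuous_intros)
qed

lemma c_swap:
  assumes "continuous_on UNIV (\<lambda>(y, r). k y r)"
  shows "continuous_on UNIV (\<lambda>p::real \<times> 'a. k (snd p) (fst p) :: real)"
  using continuous_on_compose2[OF assms, of UNIV "\<lambda>p. (snd p, fst p)"] by (simp add: continuous_intros)

lemma c_sg: "continuous_on UNIV (\<lambda>p::real \<times> 'a. sg A (snd p) (fst p))"
  unfolding sg_def by (intro continuous_intros)

lemma c_pp: "a > 0 \<Longrightarrow> continuous_on UNIV (\<lambda>p::real \<times> 'a. ppow a (sg A (snd p) (fst p)))"
  by (rule continuous_on_compose2[OF ppow_continuous c_sg]) auto

lemma c_F: "continuous_on UNIV (\<lambda>(s, y). F A s y)" "continuous_on UNIV (\<lambda>(s, y). F' A s y)"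
  unfolding F_def F'_def en_def en'_def case_prod_unfold
  by (intro continuous_intros c_pp c_swap c_basic; simp)+

lemma en_deriv: "((\<lambda>s. en y s) has_real_derivative en' y s) (at s)"
proof -
  have "((\<lambda>s. en y s) has_real_derivative
     (2 * dt z y s * dt (dt z) y s + (\<Sum>b\<in>Basis. 2 * dx b z y s * dt (dx b z) y s))) (at s)"
    unfolding en_def
    by (auto intro!: derivative_eq_intros DERIV_sum sum.cong Ck_has_dt[OF Ck_dt[OF reg2(1)]] Ck_has_dt[OF Ck_dx[OF reg2(1)]])
  then show ?thesis by (simp add: en'_def eq comm mult_ac)
qed

lemma F_deriv: "((\<lambda>s. F A s y) has_real_derivative F' A s y) (at s)"
proof -
  have "((\<lambda>s. sg A y s) has_real_derivative -1) (at s)" unfolding sg_def by (auto intro!: derivative_eq_intros)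
  from DERIV_chain2[OF ppow_has_derivative this, of 2]
  have "((\<lambda>s. ppow 2 (sg A y s)) has_real_derivative 2 * ppow 1 (sg A y s) * -1) (at s)" by simp
  from DERIV_mult[OF this en_deriv] show ?thesis by (simp add: F_def F'_def algebra_simps)
qed

text \<open>Since sqrt (1 + |y|^2) is at least |y|, the cut-off vanishes for |y| > A - s. The
  additional 1 in the radius covers all s within distance 1 of r at once, as differentiation under
  the integral demands.\<close>

lemma supp:
  assumes "\<bar>s - r\<bar> < 1" "y \<notin> cball 0 (A - r + 1)"
  shows "sg A y s \<le> 0"
proof -
  have "norm y = sqrt (y \<bullet> y)" by (simp add: norm_eq_sqrt_inner)
  also have "\<dots> \<le> sqrt (1 + y \<bullet> y)" by simp
  finally show ?thesis using assms by (auto simp: sg_def)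
qed

lemma F_supp: "\<bar>s - r\<bar> < 1 \<Longrightarrow> y \<notin> cball 0 (A - r + 1) \<Longrightarrow> F A s y = 0 \<and> F' A s y = 0"
  using supp by (simp add: F_def F'_def ppow_neg)

lemma E_deriv: "((\<lambda>s. integral\<^sup>L lborel (F A s)) has_real_derivative integral\<^sup>L lborel (F' A r)) (at r)"
  by (rule compact_support_derivative[OF F_deriv c_F F_supp])

text \<open>Used with p the time derivative, q the spatial gradient and c the gradient of the
  cut-off function: the flux through a spacelike surface is at most the energy density.\<close>

lemma flux_pointwise:
  fixes p :: real and q c :: "'a \<Rightarrow> real"
  assumes "(\<Sum>b\<in>Basis. (c b)\<^sup>2) \<le> 1"
  shows "2 * p * (\<Sum>b\<in>Basis. c b * q b) \<le> p\<^sup>2 + (\<Sum>b\<in>Basis. (q b)\<^sup>2)"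
proof -
  have "0 \<le> (\<Sum>b\<in>Basis. (q b - p * c b)\<^sup>2)" by (simp add: sum_nonneg)
  also have "\<dots> = (\<Sum>b\<in>Basis. (q b)\<^sup>2) - 2 * p * (\<Sum>b\<in>Basis. c b * q b) + p\<^sup>2 * (\<Sum>b\<in>Basis. (c b)\<^sup>2)"
    by (simp add: power2_diff power_mult_distrib sum.distrib sum_subtractf sum_distrib_left mult_ac)
  also have "\<dots> \<le> (\<Sum>b\<in>Basis. (q b)\<^sup>2) - 2 * p * (\<Sum>b\<in>Basis. c b * q b) + p\<^sup>2 * 1"
    using assms by (intro add_left_mono mult_left_mono) auto
  finally show ?thesis by simp
qed

text \<open>Twice the divergence of weight * z_r * grad z integrates to zero. Subtracting it cancels
  all second derivatives of z, and the remainder is a nonpositive multiple of energy density minus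
  flux.\<close>

lemma E_nonincreasing: "integral\<^sup>L lborel (F' A r) \<le> 0"
proof -
  let ?s = "\<lambda>y::'a. sqrt (1 + y \<bullet> y)"
  define X where "X b y = ppow 2 (sg A y r) * (dt z y r * dx b z y r)" for b y
  define X' where "X' b y = 2 * ppow 1 (sg A y r) * (- ((y \<bullet> b) / ?s y)) * (dt z y r * dx b z y r)
     + ppow 2 (sg A y r) * (dx b (dt z) y r * dx b z y r + dt z y r * dx b (dx b z) y r)" for b y
  have p: "has_pd b (X b) (X' b y) y" if b: "b \<in> Basis" for b y
  proof -
    have "has_pd b (\<lambda>y. sg A y r) (0 - (y \<bullet> b) / ?s y) y"
      unfolding sg_def by (intro has_pd_diff has_pd_const has_pd_sigma b)
    then have s: "has_pd b (\<lambda>y. sg A y r) (- ((y \<bullet> b) / ?s y)) y" by simp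
    have g: "(ppow 2 has_real_derivative 2 * ppow 1 p) (at p)" for p using ppow_has_derivative[of 2 p] by simp
    show ?thesis unfolding X_def[abs_def] X'_def
      by (intro has_pd_mult has_pd_compose[OF s g] Ck_has_dx[OF Ck_dt[OF reg2(1)]] Ck_has_dx[OF Ck_dx[OF reg2(1)]] b) (use b in auto)
  qed
  have cX: "continuous_on UNIV (\<lambda>(s::real, y). ppow 2 (sg A y s) * (dt z y s * dx b z y s))"
   "continuous_on UNIV (\<lambda>(r::real, y). 2 * ppow 1 (sg A y r) * (- ((y \<bullet> b) / ?s y)) * (dt z y r * dx b z y r)
     + ppow 2 (sg A y r) * (dx b (dt z) y r * dx b z y r + dt z y r * dx b (dx b z) y r))" if "b \<in> Basis" for b
  proof -
    have nz: "?s y \<noteq> 0" for y by (simp add: add_nonneg_eq_0_iff)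
    show "continuous_on UNIV (\<lambda>(s::real, y). ppow 2 (sg A y s) * (dt z y s * dx b z y s))"
      unfolding case_prod_unfold by (intro continuous_intros c_pp c_swap c_basic that; simp)
    show "continuous_on UNIV (\<lambda>(r::real, y). 2 * ppow 1 (sg A y r) * (- ((y \<bullet> b) / ?s y)) * (dt z y r * dx b z y r)
     + ppow 2 (sg A y r) * (dx b (dt z) y r * dx b z y r + dt z y r * dx b (dx b z) y r))"
      unfolding case_prod_unfold using nz by (intro continuous_intros c_pp c_swap c_basic that; simp)
  qed
  have X0: "(\<integral>y. X' b y \<partial>lborel) = 0 \<and> integrable lborel (X' b)" if b: "b \<in> Basis" for b
  proof -
    have s: "X b y = 0" "X' b y = 0" if "y \<notin> cball 0 (A - r + 1)" for y
      using supp[of r r y A] that by (auto simp: X_def X'_def ppow_neg)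
    show ?thesis
      using lborel_integral_partial_zero[of b "X b" "X' b" "A - r + 1", OF p[OF b] _ _ s]
        continuous_on_slice[OF cX(1)[OF b], of r] continuous_on_slice[OF cX(2)[OF b], of r] by (auto simp: X_def[abs_def] X'_def[abs_def])
  qed
  have iF: "integrable lborel (F' A r)"
    by (rule compact_support_integrable[OF continuous_on_slice[OF c_F(2)], of "A - r + 1"]) (use F_supp[of r r] in auto)
  have iS: "integrable lborel (\<lambda>y. \<Sum>b\<in>Basis. X' b y)" using X0 by (intro Bochner_Integration.integrable_sum) auto
  have "(\<integral>y. (\<Sum>b\<in>Basis. X' b y) \<partial>lborel) = (\<Sum>b\<in>Basis. \<integral>y. X' b y \<partial>lborel)"
    by (rule Bochner_Integration.integral_sum) (use X0 in auto)
  also have "\<dots> = 0" using X0 by simp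
  finally have "integral\<^sup>L lborel (F' A r) = (\<integral>y. F' A r y - 2 * (\<Sum>b\<in>Basis. X' b y) \<partial>lborel)"
    using iF iS by simp
  moreover have "0 \<le> (\<integral>y. - (F' A r y - 2 * (\<Sum>b\<in>Basis. X' b y)) \<partial>lborel)"
  proof (rule Bochner_Integration.integral_nonneg)
    fix y :: 'a
    have s1: "(\<Sum>b\<in>Basis. ((y \<bullet> b) / ?s y)\<^sup>2) \<le> 1"
    proof -
      have "(\<Sum>b\<in>Basis. ((y \<bullet> b) / ?s y)\<^sup>2) = (\<Sum>b\<in>Basis. (y \<bullet> b) * (y \<bullet> b)) / (1 + y \<bullet> y)"
        by (simp add: power_divide sum_divide_distrib[symmetric] power2_eq_square)
      also have "(\<Sum>b\<in>Basis. (y \<bullet> b) * (y \<bullet> b)) = y \<bullet> y" by (rule euclidean_inner[symmetric])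
      finally show ?thesis by (simp add: add_pos_nonneg)
    qed
    have "(\<Sum>b\<in>Basis. X' b y) = 2 * ppow 1 (sg A y r) * (- dt z y r * (\<Sum>b\<in>Basis. (y \<bullet> b) / ?s y * dx b z y r))
       + ppow 2 (sg A y r) * ((\<Sum>b\<in>Basis. dx b z y r * dx b (dt z) y r) + dt z y r * lapx z y r)"
      unfolding X'_def lapx_def by (simp add: sum.distrib sum_distrib_left algebra_simps sum_negf sum_subtractf)
    then have "F' A r y - 2 * (\<Sum>b\<in>Basis. X' b y) = - 2 * ppow 1 (sg A y r) *
       (en y r - 2 * dt z y r * (\<Sum>b\<in>Basis. (y \<bullet> b) / ?s y * dx b z y r))"
      unfolding F'_def en'_def by (simp add: sum_distrib_left algebra_simps)
    also have "\<dots> \<le> 0"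
      using flux_pointwise[OF s1, of "dt z y r" "\<lambda>b. dx b z y r"]
      by (intro mult_nonpos_nonneg) (auto simp: en_def ppow_def)
    finally show "0 \<le> - (F' A r y - 2 * (\<Sum>b\<in>Basis. X' b y))" by simp
  qed
  ultimately show ?thesis unfolding Bochner_Integration.integral_minus by simp
qed

lemma dt_zero:
  assumes r: "r \<ge> 0"
  shows "dt z y r = 0"
proof -
  \<comment> \<open>With this choice the argument of the cut-off at the point (y, r) equals 1, so
    the weight is positive there.\<close>
  define A where "A = r + sqrt (1 + y \<bullet> y) + 1"
  have "integral\<^sup>L lborel (F A r) \<le> integral\<^sup>L lborel (F A 0)"
    by (rule DERIV_nonpos_imp_nonincreasing[OF r]) (use E_deriv E_nonincreasing in blast)
  also have "F A 0 = (\<lambda>y. 0)"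
  proof
    fix y
    have "dx b z y 0 = 0" for b by (rule dx_eqI) (simp add: z0 has_pd_const)
    then show "F A 0 y = 0" by (simp add: F_def en_def zt0)
  qed
  finally have le: "integral\<^sup>L lborel (F A r) \<le> 0" by simp
  have "F A r y = 0"
    by (rule nonneg_integral_zero[OF continuous_on_slice[OF c_F(1)] compact_support_integrable[OF continuous_on_slice[OF c_F(1)], of "A - r + 1"] _ le])
       (use F_supp[of r r] in \<open>auto simp: F_def en_def ppow_def intro!: mult_nonneg_nonneg add_nonneg_nonneg sum_nonneg\<close>)
  moreover have "ppow 2 (sg A y r) > 0" by (simp add: sg_def A_def ppow_def)
  ultimately have "en y r = 0" by (simp add: F_def)
  moreover have "(\<Sum>b\<in>Basis. (dx b z y r)\<^sup>2) \<ge> 0" by (simp add: sum_nonneg)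
  ultimately have "(dt z y r)\<^sup>2 \<le> 0" unfolding en_def by linarith
  then show ?thesis by simp
qed

lemma zero: 
  assumes "r \<ge> 0"
  shows "z y r = 0"
proof (cases "r = 0")
  case False
  then have r: "0 < r" using assms by simp
  obtain s where s: "0 < s" "z y r - z y 0 = (r - 0) * dt z y s"
    using MVT2[OF r, of "z y" "dt z y"] Ck_has_dt[OF reg2(2)] by auto
  then show ?thesis using dt_zero[of s y] z0 by simp
qed (simp add: z0)

end

section \<open>Time reversal and uniqueness for all real times\<close>

lemma Ck_reflect:
  fixes v :: "'a::euclidean_space \<Rightarrow> real \<Rightarrow> real"
  shows
  "Ck k UNIV (\<lambda>(x, r). v x r) \<Longrightarrow> Ck k UNIV (\<lambda>(x, r). c * v x (- r))"
\<comment> \<open>The factor \<open>c\<close> is generalised because every derivative in time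
  changes the sign of the reflected function.\<close>
proof (induction k arbitrary: v c)
  case 0
  have r: "continuous_on UNIV (\<lambda>p::'a \<times> real. (fst p, - snd p))" by (intro continuous_intros)
  from 0 have "continuous_on UNIV (\<lambda>(x, r). v x r)" by (simp add: Ck_0)
  from continuous_on_mult_left[OF continuous_on_compose2[OF this r], of c]
  show ?case by (simp add: Ck_0 case_prod_unfold)
next
  case (Suc k)
  have r: "continuous_on UNIV (\<lambda>p::'a \<times> real. (fst p, - snd p))" by (intro continuous_intros)
  from continuous_on_mult_left[OF continuous_on_compose2[OF Ck_continuous[OF Suc(2)] r], of c]
  have c: "continuous_on UNIV (\<lambda>(x, r). c * v x (- r))"
    by (simp add: case_prod_unfold)
  have t: "((\<lambda>s. c * v x (- s)) has_real_derivative (- c) * dt v x (- r)) (at r)" for x r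
    using DERIV_cmult[OF DERIV_mirror[THEN iffD1, OF Ck_has_dt[OF Suc(2) UNIV_I, of x "- r"]], of c] by simp
  have x: "has_pd b (\<lambda>x. c * v x (- r)) (c * dx b v x (- r)) x" if "b \<in> Basis" for b x r
    using has_pd_mult[OF has_pd_const[of b c] Ck_has_dx[OF Suc(2) _ that, of x "- r"]] by simp
  show ?case
    by (rule Ck_prodI[OF open_UNIV c t x]) (use Suc.IH[OF Ck_dt[OF Suc(2)], of "- c"] Suc.IH[OF Ck_dx[OF Suc(2)], of _ c] in auto)
qed

text \<open>Solutions live on the whole time axis, while the energy estimate runs forward only. It
  is applied to the difference of two solutions and to its time reversal.\<close>

theorem is_wave_sol_unique:
  fixes v w :: "'a::euclidean_space \<Rightarrow> real \<Rightarrow> real"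
  assumes v: "is_wave_sol h v" and w: "is_wave_sol h w"
  shows "v = w"
proof -
  have v': "Ck 2 UNIV (\<lambda>(x, r). v x r)" "\<And>x r. dt (dt v) x r = lapx v x r" "\<And>x. v x 0 = h x" "\<And>x. dt v x 0 = 0"
    and w': "Ck 2 UNIV (\<lambda>(x, r). w x r)" "\<And>x r. dt (dt w) x r = lapx w x r" "\<And>x. w x 0 = h x" "\<And>x. dt w x 0 = 0"
    using v w by (auto simp: is_wave_sol_iff)
  have s: "Ck (Suc (Suc 0)) UNIV (\<lambda>(x, r). v x r)" "Ck (Suc (Suc 0)) UNIV (\<lambda>(x, r). w x r)"
    using v' w' by (simp_all add: numeral_2_eq_2)
  \<comment> \<open>The constant function -1 in place of a minus sign gives the difference the shape
    required by \<open>lapx_linear\<close>.\<close>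
  define z where "z = (\<lambda>x r. v x r + (\<lambda>r. -1) r * w x r)"
  have zc: "Ck 2 UNIV (\<lambda>(x, r). z x r)"
    using Ck_add[OF open_UNIV v'(1) Ck_mult[OF open_UNIV Ck_const[of 2 UNIV "-1"] w'(1)]]
    by (simp add: z_def case_prod_unfold)
  have d1: "dt z = (\<lambda>x r. dt v x r - dt w x r)"
    by (intro ext dt_eqI) (auto simp: z_def intro!: derivative_eq_intros Ck_has_dt[OF s(1)] Ck_has_dt[OF s(2)])
  have d2: "dt (dt z) x r = dt (dt v) x r - dt (dt w) x r" for x r
    unfolding d1 by (rule dt_eqI) (auto intro!: derivative_eq_intros Ck_has_dt[OF Ck_dt[OF s(1)]] Ck_has_dt[OF Ck_dt[OF s(2)]])
  interpret Z: zero_data_wave z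
  proof
    show "dt (dt z) x r = lapx z x r" for x r
    proof -
      have "lapx z x r = lapx v x r + -1 * lapx w x r"
        unfolding z_def by (rule lapx_linear[OF v'(1) w'(1), where c = "\<lambda>r. -1"])
      then show ?thesis by (simp add: d2 v' w')
    qed
    show "z x 0 = 0" "dt z x 0 = 0" for x using v' w' by (simp_all add: d1) (simp add: z_def v' w')
  qed (rule zc)
  define y where "y = (\<lambda>x r. 1 * z x (- r))"
  have sz: "Ck (Suc (Suc 0)) UNIV (\<lambda>(x, r). z x r)" using zc by (simp add: numeral_2_eq_2)
  have y1: "dt y = (\<lambda>x r. - dt z x (- r))"
    by (intro ext dt_eqI) (auto simp: y_def intro!: derivative_eq_intros DERIV_mirror[THEN iffD1, OF Ck_has_dt[OF sz]])
  have y2: "dt (dt y) x r = dt (dt z) x (- r)" for x r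
    unfolding y1 by (rule dt_eqI) (auto intro!: derivative_eq_intros DERIV_mirror[THEN iffD1, OF Ck_has_dt[OF Ck_dt[OF sz]]])
  interpret Y: zero_data_wave y
  proof
    show "Ck 2 UNIV (\<lambda>(x, r). y x r)" unfolding y_def by (rule Ck_reflect[OF zc])
    show "dt (dt y) x r = lapx y x r" for x r
      unfolding y2 Z.eq by (simp add: lapx_def dx_def[abs_def] y_def)
    show "y x 0 = 0" "dt y x 0 = 0" for x using Z.z0 Z.zt0 by (simp_all add: y1) (simp add: y_def Z.z0)
  qed
  have "z x r = 0" for x r
    using Z.zero[of r x] Y.zero[of "- r" x] by (cases "r \<ge> 0") (auto simp: y_def)
  then show ?thesis by (simp add: z_def fun_eq_iff)
qed

lemma wave_sol_eq: "is_wave_sol h v \<Longrightarrow> wave_sol h = v"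
  unfolding wave_sol_def by (rule the_equality) (auto intro: is_wave_sol_unique)

section \<open>Integrals with a moving endpoint and an integrable singularity\<close>

text \<open>The endpoint enters through an indicator over a fixed domain, so it can be treated as
  one more parameter in dominated convergence.\<close>

definition kernel_int :: "('p \<Rightarrow> real \<Rightarrow> real) \<Rightarrow> real \<Rightarrow> 'p \<Rightarrow> real" where
  "kernel_int G a p = (\<integral>l. indicator {0<..a} l * G p l \<partial>lborel)"

text \<open>The majorant is integrable at 0 when the exponent \<open>\<delta>\<close> is positive.
  It is locally uniform in the parameter and available up to every \<open>L\<close>, which leaves
  room to move the endpoint.\<close>

definition dominated :: "real \<Rightarrow> 'p::metric_space set \<Rightarrow> ('p \<Rightarrow> real \<Rightarrow> real) \<Rightarrow> bool" where
  "dominated \<delta> P G \<longleftrightarrow> continuous_on (P \<times> {0<..}) (\<lambda>(p, l). G p l) \<and>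
     (\<forall>p0\<in>P. \<forall>L. \<exists>e>0. \<exists>C. \<forall>p\<in>P \<inter> ball p0 e. \<forall>l\<in>{0<..L}. \<bar>G p l\<bar> \<le> C * l powr (\<delta> - 1))"

lemma powr_integrable:
  assumes "\<delta> > 0"
  shows "integrable lborel (\<lambda>l. indicator {0<..a} l * l powr (\<delta> - 1) :: real)"
    and "a \<ge> 0 \<Longrightarrow> (\<integral>l. indicator {0<..a} l * l powr (\<delta> - 1) \<partial>lborel) = a powr \<delta> / \<delta>"
proof -
  let ?g = "\<lambda>l. indicator {0<..a} l * l powr (\<delta> - 1) :: real"
  have m: "?g \<in> borel_measurable borel" by measurable
  have *: "has_bochner_integral lborel ?g (a powr \<delta> / \<delta>)" if a: "a \<ge> 0"
  proof -
    have "((\<lambda>l. l powr (\<delta> - 1)) has_integral (a powr (\<delta> - 1 + 1) / (\<delta> - 1 + 1))) {0..a}"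
      by (rule has_integral_powr_from_0) (use assms a in auto)
    then have h: "((\<lambda>l. l powr (\<delta> - 1)) has_integral (a powr \<delta> / \<delta>)) {0..a}" by simp
    have "(?g has_integral (a powr \<delta> / \<delta>)) {0..a}"
      by (rule has_integral_spike_finite[OF _ _ h, of "{0}"]) auto
    then have u: "(?g has_integral (a powr \<delta> / \<delta>)) UNIV"
      by (rule has_integral_on_superset) auto
    have "integrable lborel ?g"
      using nonnegative_absolutely_integrable_1[of ?g UNIV] u m
      by (auto simp: set_integrable_def integrable_completion)
    moreover from has_integral_integral_lborel[OF this] u have "integral\<^sup>L lborel ?g = a powr \<delta> / \<delta>"
      by (rule has_integral_unique)
    ultimately show ?thesis by (simp add: has_bochner_integral_iff)
  qed
  show "integrable lborel ?g"
  proof (cases "a \<ge> 0")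
    case True then show ?thesis using * by (simp add: has_bochner_integral_iff)
  next
    case False
    then have "?g = (\<lambda>l. 0)" by (auto simp: fun_eq_iff indicator_def)
    then show ?thesis by simp
  qed
  show "a \<ge> 0 \<Longrightarrow> integral\<^sup>L lborel ?g = a powr \<delta> / \<delta>" using * by (simp add: has_bochner_integral_iff)
qed

lemma dominated_slice: "dominated \<delta> P G \<Longrightarrow> p \<in> P \<Longrightarrow> continuous_on {0<..} (G p)"
proof -
  assume g: "dominated \<delta> P G" and p: "p \<in> P"
  have c: "continuous_on (P \<times> {0<..}) (\<lambda>(p, l). G p l)" using g by (simp add: dominated_def)
  have i: "continuous_on {0<..} (\<lambda>l::real. (p, l))" by (intro continuous_intros)
  from continuous_on_compose2[OF c i] p show ?thesis by auto
qed

lemma dominated_bound: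
  assumes "dominated \<delta> P G" "p0 \<in> P"
  obtains e C where "e > 0" "C \<ge> 0" "\<And>p l. p \<in> P \<Longrightarrow> dist p0 p < e \<Longrightarrow> 0 < l \<Longrightarrow> l \<le> L \<Longrightarrow> \<bar>G p l\<bar> \<le> C * l powr (\<delta> - 1)"
proof -
  obtain e C where eC: "e > 0" "\<forall>p\<in>P \<inter> ball p0 e. \<forall>l\<in>{0<..L}. \<bar>G p l\<bar> \<le> C * l powr (\<delta> - 1)"
    using assms unfolding dominated_def by blast
  show ?thesis
  proof (rule that[OF eC(1), of "\<bar>C\<bar>"])
    fix p l assume "p \<in> P" "dist p0 p < e" "0 < l" "l \<le> L"
    then have "\<bar>G p l\<bar> \<le> C * l powr (\<delta> - 1)" using eC(2) by auto
    also have "\<dots> \<le> \<bar>C\<bar> * l powr (\<delta> - 1)" by (intro mult_right_mono) auto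
    finally show "\<bar>G p l\<bar> \<le> \<bar>C\<bar> * l powr (\<delta> - 1)" .
  qed simp
qed

lemma dominated_measurable: "dominated \<delta> P G \<Longrightarrow> p \<in> P \<Longrightarrow> (\<lambda>l. indicator {0<..a} l * G p l) \<in> borel_measurable borel"
proof -
  assume "dominated \<delta> P G" "p \<in> P"
  then have "continuous_on {0<..a} (G p)" by (rule continuous_on_subset[OF dominated_slice]) auto
  then have "(\<lambda>l. indicator {0<..a} l *\<^sub>R G p l) \<in> borel_measurable borel"
    by (intro borel_measurable_continuous_on_indicator) auto
  then show ?thesis by simp
qed

lemma dominated_integrable:
  assumes "dominated \<delta> P G" "p \<in> P" "\<delta> > 0"
  shows "integrable lborel (\<lambda>l. indicator {0<..a} l * G p l)"
proof -
  obtain e C where eC: "e > 0" "C \<ge> 0" "\<And>q l. q \<in> P \<Longrightarrow> dist p q < e \<Longrightarrow> 0 < l \<Longrightarrow> l \<le> a \<Longrightarrow> \<bar>G q l\<bar> \<le> C * l powr (\<delta> - 1)"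
    using dominated_bound[OF assms(1,2), of a] by metis
  show ?thesis
  proof (rule Bochner_Integration.integrable_bound[OF integrable_mult_right[OF powr_integrable(1)[OF assms(3), of a], of C]])
    show "AE l in lborel. norm (indicator {0<..a} l * G p l) \<le> norm (C * (indicator {0<..a} l * l powr (\<delta> - 1)))"
      using eC(1,2) eC(3)[OF assms(2)] by (intro AE_I2) (auto simp: indicator_def)
  qed (use dominated_measurable[OF assms(1,2)] in auto)
qed

lemma kernel_int_bound:
  assumes "dominated \<delta> P G" "p \<in> P" "\<delta> > 0" "a \<ge> 0" "\<And>l. 0 < l \<Longrightarrow> l \<le> a \<Longrightarrow> \<bar>G p l\<bar> \<le> C * l powr (\<delta> - 1)"
  shows "\<bar>kernel_int G a p\<bar> \<le> C * (a powr \<delta> / \<delta>)"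
proof -
  have "\<bar>kernel_int G a p\<bar> \<le> (\<integral>l. C * (indicator {0<..a} l * l powr (\<delta> - 1)) \<partial>lborel)"
    unfolding kernel_int_def
    by (rule integral_abs_bound_integral[OF dominated_integrable[OF assms(1-3)]])
       (use assms powr_integrable(1)[OF assms(3)] in \<open>auto simp: indicator_def\<close>)
  also have "\<dots> = C * (a powr \<delta> / \<delta>)" using powr_integrable(2)[OF assms(3,4)] by simp
  finally show ?thesis .
qed

lemma kernel_int_continuous:
  assumes g: "dominated \<delta> P G" and d: "\<delta> > 0"
  shows "continuous_on (P \<times> UNIV) (\<lambda>(p, a). kernel_int G a p)"
  unfolding kernel_int_def case_prod_unfold
proof (rule lint_continuous_on)
  fix z assume "z \<in> P \<times> (UNIV :: real set)"
  then obtain p0 a0 where z: "z = (p0, a0)" and p0: "p0 \<in> P" by auto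
  show "(\<lambda>l. indicator {0<..snd z} l * G (fst z) l) \<in> borel_measurable lborel"
    using dominated_measurable[OF g p0, of a0] z by simp
  have c: "continuous_on (P \<times> {0<..}) (\<lambda>(p, l). G p l)" using g by (simp add: dominated_def)
  \<comment> \<open>As a function of the endpoint the indicator is discontinuous only where l equals
    the endpoint, which is a null set.\<close>
  have "AE l in lborel. l \<noteq> a0" using AE_lborel_singleton[of a0] by simp
  then show "AE l in lborel. continuous (at z within P \<times> UNIV) (\<lambda>z. indicator {0<..snd z} l * G (fst z) l)"
  proof eventually_elim
    case (elim l)
    show ?case
    proof (cases "l > 0")
      case True
      have "continuous_on P (\<lambda>p. G p l)"
      proof -
        have "continuous_on P (\<lambda>p. (p, l))" by (intro continuous_intros)
        from continuous_on_compose2[OF c this] True show ?thesis by auto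
      qed
      then have cg: "continuous_on (P \<times> UNIV) (\<lambda>z::'a \<times> real. G (fst z) l)"
        by (rule continuous_on_compose2) (auto intro!: continuous_intros)
      have "\<forall>\<^sub>F y in at z within P \<times> UNIV. indicator {0<..snd y} l = (indicator {0<..a0} l :: real)"
      proof (cases "l < a0")
        case lt: True
        have "open {y::'a \<times> real. l < snd y}" by (intro open_Collect_less continuous_intros)
        from eventually_nhds_in_open[OF this, of z] lt z
        have "\<forall>\<^sub>F y in nhds z. l < snd y" by simp
        then have "\<forall>\<^sub>F y in at z within P \<times> UNIV. l < snd y" by (simp add: eventually_at_filter eventually_mono)
        then show ?thesis by eventually_elim (use lt True in auto)
      next
        case ge: False
        have "open {y::'a \<times> real. snd y < l}" by (intro open_Collect_less continuous_intros)
        from eventually_nhds_in_open[OF this, of z] ge z elim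
        have "\<forall>\<^sub>F y in nhds z. snd y < l" by simp
        then have "\<forall>\<^sub>F y in at z within P \<times> UNIV. snd y < l" by (simp add: eventually_at_filter eventually_mono)
        then show ?thesis by eventually_elim (use ge True elim in \<open>auto simp: indicator_def\<close>)
      qed
      then have "((\<lambda>y. indicator {0<..snd y} l) \<longlongrightarrow> (indicator {0<..a0} l :: real)) (at z within P \<times> UNIV)"
        by (rule tendsto_eventually)
      then have "continuous (at z within P \<times> UNIV) (\<lambda>z. indicator {0<..snd z} l :: real)"
        by (simp add: continuous_within z)
      moreover have "continuous (at z within P \<times> UNIV) (\<lambda>z. G (fst z) l)"
        using cg z p0 by (auto simp: continuous_on_eq_continuous_within)
      ultimately show ?thesis by (rule continuous_mult)
    qed simp
  qed
  \<comment> \<open>The bound is taken up to a0 + 1 so that one majorant serves all endpoints within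
    distance 1 of a0.\<close>
  obtain e C where eC: "e > 0" "C \<ge> 0" "\<And>p l. p \<in> P \<Longrightarrow> dist p0 p < e \<Longrightarrow> 0 < l \<Longrightarrow> l \<le> a0 + 1 \<Longrightarrow> \<bar>G p l\<bar> \<le> C * l powr (\<delta> - 1)"
    using dominated_bound[OF g p0, of "a0 + 1"] by metis
  show "\<exists>e>0. \<exists>h. integrable lborel h \<and> (\<forall>y\<in>P \<times> UNIV \<inter> ball z e. \<forall>l. \<bar>indicator {0<..snd y} l * G (fst y) l\<bar> \<le> h l)"
  proof (intro exI[of _ "min e 1"] conjI exI[of _ "\<lambda>l. C * (indicator {0<..a0 + 1} l * l powr (\<delta> - 1))"] ballI allI)
    show "integrable lborel (\<lambda>l. C * (indicator {0<..a0 + 1} l * l powr (\<delta> - 1)))"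
      by (intro integrable_mult_right powr_integrable d)
    fix y l assume y: "y \<in> P \<times> UNIV \<inter> ball z (min e 1)"
    have 1: "dist p0 (fst y) < e" using dist_fst_le[of z y] y z by auto
    have 2: "\<bar>a0 - snd y\<bar> < 1" using dist_snd_le[of z y] y z by (auto simp: dist_real_def)
    show "\<bar>indicator {0<..snd y} l * G (fst y) l\<bar> \<le> C * (indicator {0<..a0 + 1} l * l powr (\<delta> - 1))"
      using eC(2) eC(3)[OF _ 1, of l] y 2 by (auto simp: indicator_def mem_Times_iff)
  qed (use eC in auto)
qed

lemma kernel_int_has_pd:
  fixes P :: "'p::euclidean_space set"
  assumes P: "open P" "p \<in> P" and d: "\<delta> > 0" and g: "dominated \<delta> P G" and g': "dominated \<delta> P G'"
    and pd: "\<And>p l. p \<in> P \<Longrightarrow> 0 < l \<Longrightarrow> has_pd v (\<lambda>p. G p l) (G' p l) p"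
  shows "has_pd v (kernel_int G a) (kernel_int G' a p) p"
proof -
  obtain e C where eC: "e > 0" "C \<ge> 0" "\<And>q l. q \<in> P \<Longrightarrow> dist p q < e \<Longrightarrow> 0 < l \<Longrightarrow> l \<le> a \<Longrightarrow> \<bar>G' q l\<bar> \<le> C * l powr (\<delta> - 1)"
    using dominated_bound[OF g' P(2), of a] by metis
  have "open (P \<inter> ball p e)" "p \<in> P \<inter> ball p e" using P eC(1) by auto
  from eventually_open_line[OF this, of v] obtain d where d': "d > 0" "\<And>s. \<bar>s\<bar> < d \<Longrightarrow> p + s *\<^sub>R v \<in> P \<inter> ball p e"
    unfolding eventually_nhds_metric by (auto simp: dist_real_def)
  have "((\<lambda>s. \<integral>l. indicator {0<..a} l * G (p + s *\<^sub>R v) l \<partial>lborel) has_real_derivative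
     (\<integral>l. indicator {0<..a} l * G' (p + 0 *\<^sub>R v) l \<partial>lborel)) (at 0)"
  proof (rule lint_has_derivative[OF d'(1), where F' = "\<lambda>s l. indicator {0<..a} l * G' (p + s *\<^sub>R v) l"
        and g = "\<lambda>l. C * (indicator {0<..a} l * l powr (\<delta> - 1))"])
    fix s :: real assume s: "\<bar>s - 0\<bar> < d"
    then have ps: "p + s *\<^sub>R v \<in> P" "dist p (p + s *\<^sub>R v) < e" using d'(2)[of s] by auto
    show "integrable lborel (\<lambda>l. indicator {0<..a} l * G (p + s *\<^sub>R v) l)" by (rule dominated_integrable[OF g ps(1) d])
    show "((\<lambda>s. indicator {0<..a} l * G (p + s *\<^sub>R v) l) has_real_derivative indicator {0<..a} l * G' (p + s *\<^sub>R v) l) (at s)" for l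
    proof (cases "l \<in> {0<..a}")
      case True
      have "((\<lambda>u. G (p + s *\<^sub>R v + u *\<^sub>R v) l) has_real_derivative G' (p + s *\<^sub>R v) l) (at 0)"
        using pd[OF ps(1), of l] True by (simp add: has_pd_def)
      then have "((\<lambda>u. G (p + (u + s) *\<^sub>R v) l) has_real_derivative G' (p + s *\<^sub>R v) l) (at 0)"
        by (simp add: algebra_simps)
      then have "((\<lambda>u. G (p + u *\<^sub>R v) l) has_real_derivative G' (p + s *\<^sub>R v) l) (at s)"
        using DERIV_shift[of "\<lambda>u. G (p + u *\<^sub>R v) l" _ 0 s] by simp
      then show ?thesis by (rule DERIV_cmult)
    qed auto
    show "\<bar>indicator {0<..a} l * G' (p + s *\<^sub>R v) l\<bar> \<le> C * (indicator {0<..a} l * l powr (\<delta> - 1))" for l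
      using eC(3)[OF ps, of l] by (auto simp: indicator_def)
  next
    show "integrable lborel (\<lambda>l. C * (indicator {0<..a} l * l powr (\<delta> - 1)))"
      by (intro integrable_mult_right powr_integrable d)
    show "(\<lambda>l. indicator {0<..a} l * G' (p + 0 *\<^sub>R v) l) \<in> borel_measurable lborel"
      using dominated_measurable[OF g' P(2), of a] by simp
  qed
  then show ?thesis by (simp add: has_pd_def kernel_int_def)
qed

lemma kernel_int_has_integral:
  assumes g: "dominated \<delta> P G" and p: "p \<in> P" and d: "\<delta> > 0" and a: "a \<ge> 0"
  shows "(G p has_integral kernel_int G a p) {0..a}"
proof -
  have "((\<lambda>l. indicator {0<..a} l * G p l) has_integral kernel_int G a p) UNIV"
    unfolding kernel_int_def by (rule has_integral_integral_lborel[OF dominated_integrable[OF g p d]])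
  moreover have "(\<lambda>l. indicator {0<..a} l * G p l) = (\<lambda>l. if l \<in> {0<..a} then G p l else 0)"
    by (auto simp: indicator_def)
  ultimately have "(G p has_integral kernel_int G a p) {0<..a}" by (simp only: has_integral_restrict_UNIV)
  moreover have "negligible {x \<in> {0<..a} - {0..a}. G p x \<noteq> 0}" "negligible {x \<in> {0..a} - {0<..a}. G p x \<noteq> 0}"
    by (rule negligible_subset[of "{0}"]; auto)+
  ultimately show ?thesis
    using has_integral_spike_set_eq[of "{0<..a}" "{0..a}" "G p"] by blast
qed

lemma kernel_int_has_derivative_limit:
  assumes g: "dominated \<delta> P G" and p: "p \<in> P" and d: "\<delta> > 0" and a: "a > 0"
  shows "((\<lambda>a. kernel_int G a p) has_real_derivative G p a) (at a)"
proof -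
  have i: "G p integrable_on {0..a + 1}" using kernel_int_has_integral[OF g p d, of "a + 1"] a by auto
  have "isCont (G p) a"
    using dominated_slice[OF g p] a by (simp add: continuous_on_eq_continuous_at)
  then have c: "continuous (at a within ({0..a + 1} - {})) (G p)" by (simp add: continuous_at_imp_continuous_at_within)
  have "((\<lambda>u. integral {0..u} (G p)) has_vector_derivative G p a) (at a within ({0..a + 1} - {}))"
    by (rule integral_has_vector_derivative_continuous_at[OF i _ _ c]) (use a in auto)
  then have "((\<lambda>u. integral {0..u} (G p)) has_real_derivative G p a) (at a)"
    using a by (simp add: has_real_derivative_iff_has_vector_derivative at_within_Icc_at)
  moreover have "\<forall>\<^sub>F u in nhds a. integral {0..u} (G p) = kernel_int G u p"
    using eventually_nhds_in_open[of "{0<..}" a] a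
    by (auto elim!: eventually_mono intro!: integral_unique kernel_int_has_integral[OF g p d])
  ultimately show ?thesis using DERIV_cong_ev[of a a "\<lambda>u. integral {0..u} (G p)" "\<lambda>u. kernel_int G u p"] by blast
qed

section \<open>Integrals in which t is both the endpoint and a parameter\<close>

definition duhamel_int :: "('a::euclidean_space \<times> real \<Rightarrow> real \<Rightarrow> real) \<Rightarrow> 'a \<Rightarrow> real \<Rightarrow> real" where
  "duhamel_int G x t = kernel_int G t (x, t)"

abbreviation (input) "halfspace \<equiv> UNIV \<times> {0<..}"

lemma open_halfspace: "open (UNIV \<times> {0<..} :: ('a::euclidean_space \<times> real) set)"
  by (simp add: open_Times)

lemma duhamel_int_continuous:
  assumes "dominated \<delta> halfspace G" "\<delta> > 0"
  shows "continuous_on halfspace (\<lambda>(x, t). duhamel_int G x t)"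
proof -
  have "continuous_on halfspace (\<lambda>p::'a \<times> real. (p, snd p))" by (intro continuous_intros)
  from continuous_on_compose2[OF kernel_int_continuous[OF assms] this] show ?thesis
    by (auto simp: duhamel_int_def case_prod_unfold)
qed

lemma duhamel_int_has_dx:
  assumes "\<delta> > 0" "dominated \<delta> halfspace G" "dominated \<delta> halfspace G'" "t > 0"
    and "\<And>x t l. 0 < t \<Longrightarrow> 0 < l \<Longrightarrow> has_pd b (\<lambda>x. G (x, t) l) (G' (x, t) l) x"
  shows "has_pd b (\<lambda>x. duhamel_int G x t) (duhamel_int G' x t) x"
proof -
  have "has_pd (b, 0) (kernel_int G t) (kernel_int G' t (x, t)) (x, t)"
  proof (rule kernel_int_has_pd[OF open_halfspace _ assms(1-3)])
    fix p :: "'a \<times> real" and l :: real assume "p \<in> halfspace" "0 < l"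
    then show "has_pd (b, 0) (\<lambda>p. G p l) (G' p l) p"
      using assms(5)[of "snd p" l "fst p"] has_pd_space[of b "\<lambda>x t. G (x, t) l" "G' p l" "fst p" "snd p"]
      by (auto simp: case_prod_unfold)
  qed (use assms in auto)
  then show ?thesis by (simp add: has_pd_def duhamel_int_def)
qed

text \<open>\<open>DERIV_diagonal\<close> separates the two roles of t: the parameter contributes
  the integral of the derivative, the endpoint contributes the value of the integrand at l =
  t.\<close>

lemma duhamel_int_has_dt:
  assumes d: "\<delta> > 0" and g: "dominated \<delta> halfspace G" "dominated \<delta> halfspace G'" and t: "t > 0"
    and D: "\<And>x t l. 0 < t \<Longrightarrow> 0 < l \<Longrightarrow> ((\<lambda>s. G (x, s) l) has_real_derivative G' (x, t) l) (at t)"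
  shows "((\<lambda>s. duhamel_int G x s) has_real_derivative duhamel_int G' x t + G (x, t) t) (at t)"
  unfolding duhamel_int_def
proof (rule DERIV_diagonal[where X = "{0<..}" and f = "\<lambda>s u. kernel_int G u (x, s)" and ft = "\<lambda>s u. G (x, s) u"])
  have "has_pd (0, 1) (kernel_int G t) (kernel_int G' t (x, t)) (x, t)"
  proof (rule kernel_int_has_pd[OF open_halfspace _ d g])
    fix p :: "'a \<times> real" and l :: real assume "p \<in> halfspace" "0 < l"
    then show "has_pd (0, 1) (\<lambda>p. G p l) (G' p l) p"
      using D[of "snd p" l "fst p"] has_pd_time[of "\<lambda>x t. G (x, t) l" "G' p l" "fst p" "snd p"]
      by (auto simp: case_prod_unfold)
  qed (use t in auto)
  then show "((\<lambda>s. kernel_int G t (x, s)) has_real_derivative kernel_int G' t (x, t)) (at t)"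
    using has_pd_time[of "\<lambda>x s. kernel_int G t (x, s)"] by (simp add: case_prod_unfold)
  show "((\<lambda>u. kernel_int G u (x, s)) has_real_derivative G (x, s) u) (at u)" if "s \<in> {0<..}" "u \<in> {0<..}" for s u
    by (rule kernel_int_has_derivative_limit[OF g(1) _ d]) (use that in auto)
  have c: "continuous_on (halfspace \<times> {0<..}) (\<lambda>(p, l). G p l)" using g by (simp add: dominated_def)
  have i: "continuous_on ({0<..} \<times> {0<..}) (\<lambda>z::real \<times> real. ((x, fst z), snd z))" by (intro continuous_intros)
  have "continuous_on ({0<..} \<times> {0<..}) (\<lambda>z. (\<lambda>(p, l). G p l) ((x, fst z), snd z))"
    by (rule continuous_on_compose2[OF c i]) auto
  then show "continuous_on ({0<..} \<times> {0<..}) (\<lambda>(s, u). G (x, s) u)"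
    by (simp add: case_prod_unfold)
qed (use t in auto)

lemma dominated_add:
  assumes "dominated \<delta> P G" "dominated \<delta> P H"
  shows "dominated \<delta> P (\<lambda>p l. G p l + H p l)"
  unfolding dominated_def
proof (intro conjI ballI allI)
  show "continuous_on (P \<times> {0<..}) (\<lambda>(p, l). G p l + H p l)"
    using assms by (auto simp: dominated_def case_prod_unfold intro!: continuous_intros)
  fix p0 L assume p0: "p0 \<in> P"
  obtain e C where eC: "e > 0" "C \<ge> 0" "\<And>p l. p \<in> P \<Longrightarrow> dist p0 p < e \<Longrightarrow> 0 < l \<Longrightarrow> l \<le> L \<Longrightarrow> \<bar>G p l\<bar> \<le> C * l powr (\<delta> - 1)"
    using dominated_bound[OF assms(1) p0, of L] by metis
  obtain e' C' where eC': "e' > 0" "C' \<ge> 0" "\<And>p l. p \<in> P \<Longrightarrow> dist p0 p < e' \<Longrightarrow> 0 < l \<Longrightarrow> l \<le> L \<Longrightarrow> \<bar>H p l\<bar> \<le> C' * l powr (\<delta> - 1)"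
    using dominated_bound[OF assms(2) p0, of L] by metis
  show "\<exists>e>0. \<exists>C. \<forall>p\<in>P \<inter> ball p0 e. \<forall>l\<in>{0<..L}. \<bar>G p l + H p l\<bar> \<le> C * l powr (\<delta> - 1)"
  proof (rule exI[of _ "min e e'"], rule conjI, use eC eC' in simp, rule exI[of _ "C + C'"], intro ballI)
    fix p l assume p: "p \<in> P \<inter> ball p0 (min e e')" and l: "l \<in> {0<..L}"
    then have "\<bar>G p l\<bar> \<le> C * l powr (\<delta> - 1)" "\<bar>H p l\<bar> \<le> C' * l powr (\<delta> - 1)" by (auto intro!: eC(3) eC'(3))
    then show "\<bar>G p l + H p l\<bar> \<le> (C + C') * l powr (\<delta> - 1)" by (simp add: algebra_simps)
  qed
qed

lemma dominated_mult:
  assumes g: "dominated \<delta> P G" and c: "continuous_on P c"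
    and k: "continuous_on {0<..} k" "\<And>L. \<exists>B. \<forall>l\<in>{0<..L}. \<bar>k l\<bar> \<le> B"
  shows "dominated \<delta> P (\<lambda>p l. c p * k l * G p l)"
  unfolding dominated_def
proof (intro conjI ballI allI)
  have "continuous_on (P \<times> {0<..}) (\<lambda>z. c (fst z))" "continuous_on (P \<times> {0<..}) (\<lambda>z. k (snd z))"
    by (rule continuous_on_compose2[OF c] continuous_on_compose2[OF k(1)], auto intro!: continuous_intros)+
  then show "continuous_on (P \<times> {0<..}) (\<lambda>(p, l). c p * k l * G p l)"
    using g by (auto simp: dominated_def case_prod_unfold intro!: continuous_intros)
  fix p0 L assume p0: "p0 \<in> P"
  obtain e C where eC: "e > 0" "C \<ge> 0" "\<And>p l. p \<in> P \<Longrightarrow> dist p0 p < e \<Longrightarrow> 0 < l \<Longrightarrow> l \<le> L \<Longrightarrow> \<bar>G p l\<bar> \<le> C * l powr (\<delta> - 1)"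
    using dominated_bound[OF g p0, of L] by metis
  obtain e' where e': "e' > 0" "\<And>p. p \<in> P \<Longrightarrow> dist p p0 < e' \<Longrightarrow> dist (c p) (c p0) < 1"
    using c p0 unfolding continuous_on_iff by (metis zero_less_one)
  obtain B where B: "\<And>l. l \<in> {0<..L} \<Longrightarrow> \<bar>k l\<bar> \<le> B" using k(2) by blast
  show "\<exists>e>0. \<exists>C. \<forall>p\<in>P \<inter> ball p0 e. \<forall>l\<in>{0<..L}. \<bar>c p * k l * G p l\<bar> \<le> C * l powr (\<delta> - 1)"
  proof (rule exI[of _ "min e e'"], rule conjI, use eC e' in simp, rule exI[of _ "(\<bar>c p0\<bar> + 1) * B * C"], intro ballI)
    fix p l assume p: "p \<in> P \<inter> ball p0 (min e e')" and l: "l \<in> {0<..L}"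
    have "\<bar>G p l\<bar> \<le> C * l powr (\<delta> - 1)" using p l by (auto intro!: eC(3))
    moreover have "\<bar>c p\<bar> \<le> \<bar>c p0\<bar> + 1" using e'(2)[of p] p by (auto simp: dist_real_def dist_commute)
    moreover note B[OF l]
    ultimately have "\<bar>c p\<bar> * \<bar>k l\<bar> * \<bar>G p l\<bar> \<le> (\<bar>c p0\<bar> + 1) * B * (C * l powr (\<delta> - 1))"
      using eC(2) by (intro mult_mono) auto
    then show "\<bar>c p * k l * G p l\<bar> \<le> (\<bar>c p0\<bar> + 1) * B * C * l powr (\<delta> - 1)" by (simp add: abs_mult mult_ac)
  qed
qed

lemma dominated_mult_left: "dominated \<delta> P G \<Longrightarrow> continuous_on P c \<Longrightarrow> dominated \<delta> P (\<lambda>p l. c p * G p l)"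
  using dominated_mult[of \<delta> P G c "\<lambda>l. 1"] by auto

section \<open>The Duhamel integral\<close>

lemma phi_continuous: "continuous_on {0..} phi"
  unfolding phi_def[abs_def] by (intro continuous_intros continuous_on_powr') auto

lemma phi_mono: "0 \<le> l \<Longrightarrow> l \<le> t \<Longrightarrow> phi l \<le> phi t"
  unfolding phi_def by (simp add: powr_mono2)

lemma phi_nonneg: "0 \<le> phi t"
  by (simp add: phi_def)

lemma phi_has_derivative:
  assumes "t > 0"
  shows "(phi has_real_derivative t powr (-2/3)) (at t)"
proof -
  have "(phi has_real_derivative 3 * ((1/3) * t powr (1/3 - 1))) (at t)"
    unfolding phi_def[abs_def] using assms by (auto intro!: derivative_eq_intros)
  then show ?thesis by simp
qed

lemma phi_continuous_pos: "continuous_on {0<..} phi"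
  by (rule continuous_on_subset[OF phi_continuous]) auto

lemma phi_bounded: "\<exists>B. \<forall>l\<in>{0<..L}. \<bar>phi l\<bar> \<le> B"
  using phi_mono phi_nonneg by (intro exI[of _ "phi L"]) (auto simp: abs_of_nonneg)

definition dominated_data :: "real \<Rightarrow> ('a::euclidean_space \<Rightarrow> real \<Rightarrow> real \<Rightarrow> real) \<Rightarrow> bool" where
  "dominated_data \<delta> S \<longleftrightarrow> continuous_on (UNIV \<times> UNIV \<times> {0<..}) (\<lambda>(x, r, l). S x r l) \<and>
     (\<forall>R L. \<exists>C. \<forall>x r l. norm x \<le> R \<longrightarrow> \<bar>r\<bar> \<le> R \<longrightarrow> 0 < l \<longrightarrow> l \<le> L \<longrightarrow> \<bar>S x r l\<bar> \<le> C * l powr (\<delta> - 1))"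

lemma dominated_data_bound:
  fixes S :: "'a::euclidean_space \<Rightarrow> real \<Rightarrow> real \<Rightarrow> real"
  assumes "dominated_data \<delta> S"
  obtains C where "C \<ge> 0" "\<And>x r l. norm x \<le> R \<Longrightarrow> \<bar>r\<bar> \<le> R \<Longrightarrow> 0 < l \<Longrightarrow> l \<le> L \<Longrightarrow> \<bar>S x r l\<bar> \<le> C * l powr (\<delta> - 1)"
proof -
  obtain C where C: "\<And>x r l. norm x \<le> R \<Longrightarrow> \<bar>r\<bar> \<le> R \<Longrightarrow> 0 < l \<Longrightarrow> l \<le> L \<Longrightarrow> \<bar>S x r l\<bar> \<le> C * l powr (\<delta> - 1)"
    using assms unfolding dominated_data_def by metis
  show ?thesis
  proof (rule that[of "\<bar>C\<bar>"])
    fix x :: 'a and r l assume "norm x \<le> R" "\<bar>r\<bar> \<le> R" "0 < l" "l \<le> L"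
    then have "\<bar>S x r l\<bar> \<le> C * l powr (\<delta> - 1)" by (rule C)
    also have "\<dots> \<le> \<bar>C\<bar> * l powr (\<delta> - 1)" by (intro mult_right_mono) auto
    finally show "\<bar>S x r l\<bar> \<le> \<bar>C\<bar> * l powr (\<delta> - 1)" .
  qed simp
qed

lemma dominated_data_slice:
  assumes "dominated_data \<delta> S" "l > 0"
  shows "continuous_on UNIV (\<lambda>r. S x r l)"
proof -
  have c: "continuous_on (UNIV \<times> UNIV \<times> {0<..}) (\<lambda>(x, r, l). S x r l)" using assms by (simp add: dominated_data_def)
  have "continuous_on UNIV (\<lambda>r::real. (x, r, l))" by (intro continuous_intros)
  from continuous_on_compose2[OF c this] assms(2) show ?thesis by auto
qed

lemma dominated_data_good:
  fixes S :: "'a::euclidean_space \<Rightarrow> real \<Rightarrow> real \<Rightarrow> real"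
  assumes S: "dominated_data \<delta> S"
  shows "dominated \<delta> halfspace (\<lambda>p l. S (fst p) (phi (snd p) - phi l) l)"
  unfolding dominated_def
proof (intro conjI ballI allI)
  have c: "continuous_on (UNIV \<times> UNIV \<times> {0<..}) (\<lambda>(x, r, l). S x r l)" using S by (simp add: dominated_data_def)
  have p1: "continuous_on (halfspace \<times> {0<..}) (\<lambda>z::('a \<times> real) \<times> real. phi (snd (fst z)))"
    by (rule continuous_on_compose2[OF phi_continuous_pos]) (auto intro!: continuous_intros)
  have p2: "continuous_on (halfspace \<times> {0<..}) (\<lambda>z::('a \<times> real) \<times> real. phi (snd z))"
    by (rule continuous_on_compose2[OF phi_continuous_pos]) (auto intro!: continuous_intros)
  have i: "continuous_on (halfspace \<times> {0<..}) (\<lambda>z::('a \<times> real) \<times> real. (fst (fst z), phi (snd (fst z)) - phi (snd z), snd z))"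
    by (intro continuous_intros p1 p2)
  have "continuous_on (halfspace \<times> {0<..}) (\<lambda>z::('a \<times> real) \<times> real. (\<lambda>(x, r, l). S x r l) (fst (fst z), phi (snd (fst z)) - phi (snd z), snd z))"
    by (rule continuous_on_compose2[OF c i]) auto
  then show "continuous_on (halfspace \<times> {0<..}) (\<lambda>(p, l). S (fst p) (phi (snd p) - phi l) l)"
    by (simp add: case_prod_unfold)
  fix p0 :: "'a \<times> real" and L :: real assume p0: "p0 \<in> halfspace"
  \<comment> \<open>Bounds both |x| and |phi t - phi l| for all (x, t) within distance 1 of p0 and
    all l up to L.\<close>
  define R where "R = norm (fst p0) + 1 + phi (snd p0 + 1) + phi L"
  obtain C where C: "C \<ge> 0" "\<And>x r l. norm x \<le> R \<Longrightarrow> \<bar>r\<bar> \<le> R \<Longrightarrow> 0 < l \<Longrightarrow> l \<le> L \<Longrightarrow> \<bar>S x r l\<bar> \<le> C * l powr (\<delta> - 1)"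
    by (rule dominated_data_bound[OF S, of R L]) blast
  show "\<exists>e>0. \<exists>C. \<forall>p\<in>halfspace \<inter> ball p0 e. \<forall>l\<in>{0<..L}. \<bar>S (fst p) (phi (snd p) - phi l) l\<bar> \<le> C * l powr (\<delta> - 1)"
  proof (rule exI[of _ 1], rule conjI, simp, rule exI[of _ C], intro ballI)
    fix p :: "'a \<times> real" and l :: real assume p: "p \<in> halfspace \<inter> ball p0 1" and l: "l \<in> {0<..L}"
    have "dist (fst p0) (fst p) < 1" "dist (snd p0) (snd p) < 1"
      using dist_fst_le[of p0 p] dist_snd_le[of p0 p] p by auto
    then have 1: "norm (fst p) \<le> norm (fst p0) + 1" "snd p \<le> snd p0 + 1"
      using norm_triangle_sub[of "fst p" "fst p0"] by (auto simp: dist_norm norm_minus_commute dist_real_def)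
    have 2: "0 < snd p" using p by (auto simp: mem_Times_iff)
    have 3: "phi (snd p) \<le> phi (snd p0 + 1)" "phi l \<le> phi L" using phi_mono 1 2 l by auto
    show "\<bar>S (fst p) (phi (snd p) - phi l) l\<bar> \<le> C * l powr (\<delta> - 1)"
    proof (rule C(2))
      note n = phi_nonneg[of l] phi_nonneg[of "snd p"] phi_nonneg[of L] phi_nonneg[of "snd p0 + 1"] norm_ge_zero[of "fst p0"]
      show "norm (fst p) \<le> R" using 1 n unfolding R_def by linarith
      show "\<bar>phi (snd p) - phi l\<bar> \<le> R" using 3 n unfolding R_def by linarith
    qed (use l in auto)
  qed
qed

section \<open>Primitives in r and the kernel of the Duhamel integral\<close>

text \<open>The integral of \<open>s S x s l\<close> over \<open>s\<close> from 0 to \<open>r\<close>, rescaled to the unit interval so that it has the right sign for negative \<open>r\<close>.\<close>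

definition radial_moment :: "('a \<Rightarrow> real \<Rightarrow> real \<Rightarrow> real) \<Rightarrow> 'a \<Rightarrow> real \<Rightarrow> real \<Rightarrow> real" where
  "radial_moment S x r l = r * integral {0..1} (\<lambda>u. (r * u) * S x (r * u) l)"

lemma scaled_primitive:
  fixes f :: "real \<Rightarrow> real"
  assumes f: "continuous_on UNIV f"
  shows "((\<lambda>r. r * integral {0..1} (\<lambda>u. f (r * u))) has_real_derivative f r) (at r)"
proof -
  define M where "M = \<bar>r\<bar> + 1"
  obtain H where H: "\<And>x. x \<in> {- M..M} \<Longrightarrow> (H has_vector_derivative f x) (at x within {- M..M})"
    using antiderivative_continuous[of "- M" M f] continuous_on_subset[OF f] by blast
  \<comment> \<open>The substitution s u turns the rescaled integral into a difference of values of
    one antiderivative on a fixed symmetric interval, for either sign of s.\<close>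
  have e: "s * integral {0..1} (\<lambda>u. f (s * u)) = H s - H 0" if s: "\<bar>s\<bar> < M" for s
  proof -
    have im: "(\<lambda>u. s * u) ` {0..1} \<subseteq> {- M..M}"
    proof safe
      fix u :: real assume u: "u \<in> {0..1}"
      have "\<bar>s\<bar> * \<bar>u\<bar> \<le> M * 1" using s u by (intro mult_mono) auto
      then have "\<bar>s * u\<bar> \<le> M" by (simp add: abs_mult)
      then show "s * u \<in> {- M..M}" by auto
    qed
    have "((\<lambda>u. H (s * u)) has_vector_derivative s *\<^sub>R f (s * u)) (at u within {0..1})" if "u \<in> {0..1}" for u
    proof -
      have "((\<lambda>u. s * u) has_vector_derivative s) (at u within {0..1})"
        by (auto intro!: derivative_eq_intros)
      moreover have "(H has_vector_derivative f (s * u)) (at (s * u) within (\<lambda>u. s * u) ` {0..1})"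
        using H[of "s * u"] im that has_vector_derivative_within_subset by blast
      ultimately show ?thesis using vector_diff_chain_within[of "\<lambda>u. s * u" s u "{0..1}" H "f (s * u)"] by (simp add: o_def)
    qed
    then have "((\<lambda>u. s *\<^sub>R f (s * u)) has_integral (H (s * 1) - H (s * 0))) {0..1}"
      by (intro fundamental_theorem_of_calculus) auto
    from integral_unique[OF this] show ?thesis by simp
  qed
  have Mr: "- M < r" "r < M" by (auto simp: M_def)
  have "(H has_real_derivative f r) (at r)"
    using Mr H[of r] at_within_Icc_at[of "-M" r M] by (simp add: has_real_derivative_iff_has_vector_derivative)
  then have "((\<lambda>s. H s - H 0) has_real_derivative f r) (at r)" by (auto intro!: derivative_eq_intros)
  moreover have "\<forall>\<^sub>F s in nhds r. H s - H 0 = s * integral {0..1} (\<lambda>u. f (s * u))"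
  proof -
    have "\<forall>\<^sub>F s in nhds r. s \<in> {-M<..<M}" by (rule eventually_nhds_in_open) (use Mr in auto)
    then show ?thesis by eventually_elim (auto simp: e abs_less_iff)
  qed
  ultimately show ?thesis
    using DERIV_cong_ev[of r r "\<lambda>s. H s - H 0" "\<lambda>s. s * integral {0..1} (\<lambda>u. f (s * u))"] by blast
qed

lemma radial_moment_deriv_r:
  assumes "dominated_data \<delta> S" "l > 0"
  shows "((\<lambda>r. radial_moment S x r l) has_real_derivative r * S x r l) (at r)"
  unfolding radial_moment_def
  by (rule scaled_primitive[where f = "\<lambda>r. r * S x r l"]) (intro continuous_intros dominated_data_slice[OF assms])

lemma radial_moment_zero: "radial_moment S x 0 l = 0"
  by (simp add: radial_moment_def)

lemma radial_moment_continuous: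
  fixes S :: "'a::euclidean_space \<Rightarrow> real \<Rightarrow> real \<Rightarrow> real"
  assumes c: "continuous_on (UNIV \<times> UNIV \<times> {0<..}) (\<lambda>(x, r, l). S x r l)"
  shows "continuous_on (UNIV \<times> UNIV \<times> {0<..}) (\<lambda>(x, r, l). radial_moment S x r l)"
proof -
  have i: "continuous_on ((UNIV \<times> UNIV \<times> {0<..}) \<times> cbox 0 1) (\<lambda>z::('a \<times> real \<times> real) \<times> real. (fst (fst z), fst (snd (fst z)) * snd z, snd (snd (fst z))))"
    by (intro continuous_intros)
  have "continuous_on ((UNIV \<times> UNIV \<times> {0<..}) \<times> cbox 0 1) (\<lambda>z. (\<lambda>(x, r, l). S x r l) (fst (fst z), fst (snd (fst z)) * snd z, snd (snd (fst z))))"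
    by (rule continuous_on_compose2[OF c i]) auto
  then have "continuous_on ((UNIV \<times> UNIV \<times> {0<..}) \<times> cbox 0 1)
     (\<lambda>(p, u). (fst (snd p) * u) * S (fst p) (fst (snd p) * u) (snd (snd p)))"
    by (auto simp: case_prod_unfold intro!: continuous_intros)
  from integral_continuous_on_param[OF this]
  have "continuous_on (UNIV \<times> UNIV \<times> {0<..}) (\<lambda>p. fst (snd p) * integral {0..1} (\<lambda>u. (fst (snd p) * u) * S (fst p) (fst (snd p) * u) (snd (snd p))))"
    by (auto intro!: continuous_intros)
  then show ?thesis by (simp add: radial_moment_def case_prod_unfold)
qed

lemma radial_moment_bound:
  assumes S: "dominated_data \<delta> S" and l: "l > 0" and B: "\<And>s. \<bar>s\<bar> \<le> \<bar>r\<bar> \<Longrightarrow> \<bar>S x s l\<bar> \<le> B"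
  shows "\<bar>radial_moment S x r l\<bar> \<le> r\<^sup>2 * B"
proof -
  have B0: "0 \<le> B" using B[of 0] by simp
  have bd: "norm ((r * u) * S x (r * u) l) \<le> \<bar>r\<bar> * B" if "u \<in> {0..1}" for u
  proof -
    have 1: "\<bar>r * u\<bar> \<le> \<bar>r\<bar>" using that by (auto simp: abs_mult intro: mult_left_le)
    then show ?thesis using B[OF 1] B0 by (simp add: abs_mult mult_mono)
  qed
  have "continuous_on {0..1} (\<lambda>u. S x (r * u) l)"
    by (rule continuous_on_compose2[OF dominated_data_slice[OF S l]]) (auto intro!: continuous_intros)
  then have "continuous_on {0..1} (\<lambda>u. (r * u) * S x (r * u) l)" by (intro continuous_intros)
  from integral_bound[OF _ this bd] have "\<bar>integral {0..1} (\<lambda>u. (r * u) * S x (r * u) l)\<bar> \<le> \<bar>r\<bar> * B" by simp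
  then have "\<bar>r\<bar> * \<bar>integral {0..1} (\<lambda>u. (r * u) * S x (r * u) l)\<bar> \<le> \<bar>r\<bar> * (\<bar>r\<bar> * B)" by (intro mult_left_mono) auto
  then show ?thesis unfolding radial_moment_def abs_mult by (simp add: power2_eq_square mult.assoc[symmetric])
qed

lemma dominated_data_Q:
  fixes S :: "'a::euclidean_space \<Rightarrow> real \<Rightarrow> real \<Rightarrow> real"
  assumes S: "dominated_data \<delta> S"
  shows "dominated_data \<delta> (radial_moment S)"
  unfolding dominated_data_def
proof (intro conjI allI)
  show "continuous_on (UNIV \<times> UNIV \<times> {0<..}) (\<lambda>(x, r, l). radial_moment S x r l)"
    by (rule radial_moment_continuous) (use S in \<open>simp add: dominated_data_def\<close>)
  fix R L
  obtain C where C: "C \<ge> 0" "\<And>x r l. norm x \<le> R \<Longrightarrow> \<bar>r\<bar> \<le> R \<Longrightarrow> 0 < l \<Longrightarrow> l \<le> L \<Longrightarrow> \<bar>S x r l\<bar> \<le> C * l powr (\<delta> - 1)"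
    by (rule dominated_data_bound[OF S, of R L]) blast
  show "\<exists>C. \<forall>x r l. norm x \<le> R \<longrightarrow> \<bar>r\<bar> \<le> R \<longrightarrow> 0 < l \<longrightarrow> l \<le> L \<longrightarrow> \<bar>radial_moment S x r l\<bar> \<le> C * l powr (\<delta> - 1)"
  proof (intro exI[of _ "R\<^sup>2 * C"] allI impI)
    fix x :: 'a and r l assume *: "norm x \<le> R" "\<bar>r\<bar> \<le> R" "0 < l" "l \<le> L"
    have "\<bar>radial_moment S x r l\<bar> \<le> r\<^sup>2 * (C * l powr (\<delta> - 1))" by (rule radial_moment_bound[OF S *(3)]) (use * in \<open>auto intro!: C(2)\<close>)
    also have "\<dots> \<le> R\<^sup>2 * (C * l powr (\<delta> - 1))"
      using * C(1) by (intro mult_right_mono) (auto simp: abs_le_square_iff[symmetric])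
    finally show "\<bar>radial_moment S x r l\<bar> \<le> R\<^sup>2 * C * l powr (\<delta> - 1)" by simp
  qed
qed

lemma radial_moment_has_pd:
  fixes S :: "'a::euclidean_space \<Rightarrow> real \<Rightarrow> real \<Rightarrow> real"
  assumes S: "dominated_data \<delta> S" and S': "dominated_data \<delta> S'" and l: "l > 0"
    and d: "\<And>x r. has_pd b (\<lambda>x. S x r l) (S' x r l) x"
  shows "has_pd b (\<lambda>x. radial_moment S x r l) (radial_moment S' x r l) x"
proof -
  let ?f = "\<lambda>s u. (r * u) * S (x + s *\<^sub>R b) (r * u) l" and ?f' = "\<lambda>s u. (r * u) * S' (x + s *\<^sub>R b) (r * u) l"
  have "((\<lambda>s. integral (cbox 0 1) (?f s)) has_field_derivative integral (cbox 0 1) (?f' 0)) (at 0 within UNIV)"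
  proof (rule leibniz_rule_field_derivative)
    show "((\<lambda>s. ?f s u) has_field_derivative ?f' s u) (at s within UNIV)" for s u
      using DERIV_cmult[OF has_pd_line[where g = "\<lambda>x. S x (r * u) l" and g' = "\<lambda>x. S' x (r * u) l", OF d], of "r * u" x s] by simp
    show "?f s integrable_on cbox 0 1" for s
    proof (rule integrable_continuous)
      have "continuous_on (cbox 0 1) (\<lambda>u. S (x + s *\<^sub>R b) (r * u) l)"
        by (rule continuous_on_compose2[OF dominated_data_slice[OF S l]]) (auto intro!: continuous_intros)
      then show "continuous_on (cbox 0 1) (?f s)" by (intro continuous_intros)
    qed
    have c: "continuous_on (UNIV \<times> UNIV \<times> {0<..}) (\<lambda>(x, r, l). S' x r l)" using S' by (simp add: dominated_data_def)
    have i: "continuous_on (UNIV \<times> cbox 0 1) (\<lambda>z::real \<times> real. (x + fst z *\<^sub>R b, r * snd z, l))" by (intro continuous_intros)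
    have "continuous_on (UNIV \<times> cbox 0 1) (\<lambda>z::real \<times> real. (\<lambda>(x, r, l). S' x r l) (x + fst z *\<^sub>R b, r * snd z, l))"
      by (rule continuous_on_compose2[OF c i]) (use l in auto)
    then show "continuous_on (UNIV \<times> cbox 0 1) (\<lambda>(s, u). ?f' s u)"
      by (auto simp: case_prod_unfold intro!: continuous_intros)
  qed auto
  from DERIV_cmult[OF this, of r] show ?thesis by (simp add: has_pd_def radial_moment_def)
qed

text \<open>The inner integral of the theorem divided by 18, after integration by parts in \<open>r\<close>: here \<open>S\<close> is the primitive of the wave
  in \<open>r\<close>, which needs one derivative of the data less than the wave itself.\<close>

definition wave_kernel :: "('a \<Rightarrow> real \<Rightarrow> real \<Rightarrow> real) \<Rightarrow> 'a \<times> real \<Rightarrow> real \<Rightarrow> real" where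
  "wave_kernel S p l = (phi (snd p) / 9) * phi l * S (fst p) (phi (snd p) - phi l) l + (1/9) * radial_moment S (fst p) (phi (snd p) - phi l) l"

definition wave_kernel_dt :: "('a \<Rightarrow> real \<Rightarrow> real \<Rightarrow> real) \<Rightarrow> ('a \<Rightarrow> real \<Rightarrow> real \<Rightarrow> real) \<Rightarrow> 'a \<times> real \<Rightarrow> real \<Rightarrow> real" where
  "wave_kernel_dt S S' p l = (snd p powr (-1/3) / 3) * (S (fst p) (phi (snd p) - phi l) l)
     + (snd p powr (-1/3) / 3) * phi l * S' (fst p) (phi (snd p) - phi l) l"

lemma continuous_time_coeff:
  assumes "continuous_on {0<..} c"
  shows "continuous_on halfspace (\<lambda>p::'a::euclidean_space \<times> real. c (snd p) :: real)"
  by (rule continuous_on_compose2[OF assms]) (auto intro!: continuous_intros)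

lemma continuous_powr_pos: "continuous_on {0<..} (\<lambda>t::real. t powr a)"
  by (intro continuous_on_powr continuous_intros) auto

lemma dominated_Wop:
  assumes "dominated_data \<delta> S"
  shows "dominated \<delta> halfspace (wave_kernel (S :: 'a::euclidean_space \<Rightarrow> _))"
proof -
  have "continuous_on halfspace (\<lambda>p::'a \<times> real. phi (snd p) / 9)"
    by (rule continuous_time_coeff[where c = "\<lambda>t. phi t / 9"]) (intro continuous_intros phi_continuous_pos; simp)
  from dominated_add[OF dominated_mult[OF dominated_data_good[OF assms] this phi_continuous_pos phi_bounded]
      dominated_mult_left[OF dominated_data_good[OF dominated_data_Q[OF assms]] continuous_on_const[of _ "1/9"]]]
  show ?thesis unfolding wave_kernel_def[abs_def] .
qed

lemma dominated_Wtop: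
  assumes "dominated_data \<delta> S" "dominated_data \<delta> S'"
  shows "dominated \<delta> halfspace (wave_kernel_dt (S :: 'a::euclidean_space \<Rightarrow> _) S')"
proof -
  have c: "continuous_on halfspace (\<lambda>p::'a \<times> real. snd p powr (-1/3) / 3)"
    by (rule continuous_time_coeff[where c = "\<lambda>t. t powr (-1/3) / 3"]) (intro continuous_intros continuous_powr_pos; simp)
  from dominated_add[OF dominated_mult_left[OF dominated_data_good[OF assms(1)] c] dominated_mult[OF dominated_data_good[OF assms(2)] c phi_continuous_pos phi_bounded]]
  show ?thesis unfolding wave_kernel_dt_def[abs_def] .
qed

lemma phi_powr: "t > 0 \<Longrightarrow> t powr (-1/3) * phi t = 3" "t > 0 \<Longrightarrow> phi t * t powr (-2/3) = 3 * t powr (-1/3)"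
   "t > 0 \<Longrightarrow> t powr (-1/3) * t powr (-2/3) = phi t * t powr (-4/3) / 3"
  by (simp_all add: phi_def powr_add[symmetric])

text \<open>The derivative of the moment contributes (phi t - phi l) S and the first term
  contributes phi l S. They add up to phi t S, so phi t * t^(-2/3) = 3 t^(-1/3) factors out of the
  whole derivative.\<close>

lemma wave_kernel_has_dt:
  assumes S: "dominated_data \<delta> S" and t: "t > 0" and l: "l > 0"
    and d: "\<And>r. ((\<lambda>r. S x r l) has_real_derivative S' x r l) (at r)"
  shows "((\<lambda>s. wave_kernel S (x, s) l) has_real_derivative wave_kernel_dt S S' (x, t) l) (at t)"
proof -
  let ?R = "phi t - phi l"
  have R: "((\<lambda>s. phi s - phi l) has_real_derivative t powr (-2/3)) (at t)"
    using DERIV_diff[OF phi_has_derivative[OF t] DERIV_const, of "phi l"] by simp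
  have S1: "((\<lambda>s. S x (phi s - phi l) l) has_real_derivative S' x ?R l * t powr (-2/3)) (at t)"
    by (rule DERIV_chain2[OF d R])
  have Q1: "((\<lambda>s. radial_moment S x (phi s - phi l) l) has_real_derivative (?R * S x ?R l) * t powr (-2/3)) (at t)"
    by (rule DERIV_chain2[OF radial_moment_deriv_r[OF S l] R])
  have "((\<lambda>s. wave_kernel S (x, s) l) has_real_derivative
     (t powr (-2/3) / 9 * phi l * S x ?R l + phi t / 9 * phi l * (S' x ?R l * t powr (-2/3)))
     + 1/9 * ((?R * S x ?R l) * t powr (-2/3))) (at t)"
    unfolding wave_kernel_def fst_conv snd_conv
    by (auto intro!: derivative_eq_intros S1 Q1 phi_has_derivative[OF t] simp: field_simps)
  moreover have "(t powr (-2/3) / 9 * phi l * S x ?R l + phi t / 9 * phi l * (S' x ?R l * t powr (-2/3)))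
     + 1/9 * ((?R * S x ?R l) * t powr (-2/3)) = (phi t * t powr (-2/3)) / 9 * (S x ?R l + phi l * S' x ?R l)"
    by (simp add: algebra_simps)
  ultimately show ?thesis unfolding phi_powr(2)[OF t] by (simp add: wave_kernel_dt_def algebra_simps)
qed

lemma wave_kernel_has_dx:
  assumes "dominated_data \<delta> S" "dominated_data \<delta> S'" "l > 0" "\<And>x r. has_pd b (\<lambda>x. S x r l) (S' x r l) x"
  shows "has_pd b (\<lambda>x. wave_kernel S (x, t) l) (wave_kernel S' (x, t) l) x"
proof -
  have "has_pd b (\<lambda>x. wave_kernel S (x, t) l) (0 * S x (phi t - phi l) l + (phi t / 9) * phi l * S' x (phi t - phi l) l
     + (0 * radial_moment S x (phi t - phi l) l + (1/9) * radial_moment S' x (phi t - phi l) l)) x"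
    unfolding wave_kernel_def fst_conv snd_conv
    by (intro has_pd_add has_pd_mult has_pd_const assms(4) radial_moment_has_pd[OF assms])
  then show ?thesis by (simp add: wave_kernel_def)
qed

lemma wave_kernel_dt_has_dx:
  assumes "\<And>x r. has_pd b (\<lambda>x. S x r l) (Sb x r l) x" "\<And>x r. has_pd b (\<lambda>x. S' x r l) (S'b x r l) x"
  shows "has_pd b (\<lambda>x. wave_kernel_dt S S' (x, t) l) (wave_kernel_dt Sb S'b (x, t) l) x"
proof -
  have "has_pd b (\<lambda>x. wave_kernel_dt S S' (x, t) l) (0 * S x (phi t - phi l) l + (t powr (-1/3) / 3) * Sb x (phi t - phi l) l
     + (0 * S' x (phi t - phi l) l + (t powr (-1/3) / 3) * phi l * S'b x (phi t - phi l) l)) x"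
    unfolding wave_kernel_dt_def fst_conv snd_conv
    by (intro has_pd_add has_pd_mult has_pd_const assms)
  then show ?thesis by (simp add: wave_kernel_dt_def)
qed

lemma kernel_int_cong: "(\<And>l. 0 < l \<Longrightarrow> l \<le> a \<Longrightarrow> G p l = G' p l) \<Longrightarrow> kernel_int G a p = kernel_int G' a p"
  unfolding kernel_int_def by (rule Bochner_Integration.integral_cong) (auto simp: indicator_def)

lemma kernel_int_sum:
  assumes "\<And>i. i \<in> I \<Longrightarrow> dominated \<delta> P (G i)" "p \<in> P" "\<delta> > 0"
  shows "kernel_int (\<lambda>p l. \<Sum>i\<in>I. G i p l) a p = (\<Sum>i\<in>I. kernel_int (G i) a p)"
  unfolding kernel_int_def sum_distrib_left
  by (rule Bochner_Integration.integral_sum, rule dominated_integrable[OF assms])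

lemma radial_moment_sum:
  assumes "\<And>i. i \<in> I \<Longrightarrow> dominated_data \<delta> (S i)" "l > 0"
  shows "radial_moment (\<lambda>x r l. \<Sum>i\<in>I. S i x r l) x r l = (\<Sum>i\<in>I. radial_moment (S i) x r l)"
proof -
  have "(\<lambda>u. (r * u) * S i x (r * u) l) integrable_on {0..1}" if "i \<in> I" for i
  proof (rule integrable_continuous_interval)
    have "continuous_on {0..1} (\<lambda>u. S i x (r * u) l)"
      by (rule continuous_on_compose2[OF dominated_data_slice[OF assms(1)[OF that] assms(2)]]) (auto intro!: continuous_intros)
    then show "continuous_on {0..1} (\<lambda>u. (r * u) * S i x (r * u) l)" by (intro continuous_intros)
  qed
  then have "integral {0..1} (\<lambda>u. \<Sum>i\<in>I. (r * u) * S i x (r * u) l) = (\<Sum>i\<in>I. integral {0..1} (\<lambda>u. (r * u) * S i x (r * u) l))"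
    by (cases "finite I") (auto intro: integral_sum)
  then show ?thesis by (simp add: radial_moment_def sum_distrib_left)
qed

lemma radial_moment_by_parts:
  assumes "dominated_data \<delta> S''" "l > 0" "S x 0 l = 0"
    and d1: "\<And>r. ((\<lambda>r. S x r l) has_real_derivative S' x r l) (at r)"
    and d2: "\<And>r. ((\<lambda>r. S' x r l) has_real_derivative S'' x r l) (at r)"
  shows "radial_moment S'' x r l = r * S' x r l - S x r l"
proof -
  have "((\<lambda>r. radial_moment S'' x r l - (r * S' x r l - S x r l)) has_real_derivative 0) (at r)" for r
    by (auto intro!: derivative_eq_intros radial_moment_deriv_r[OF assms(1,2)] d1 d2)
  then have "radial_moment S'' x r l - (r * S' x r l - S x r l) = radial_moment S'' x 0 l - (0 * S' x 0 l - S x 0 l)"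
    by (intro DERIV_isconst_all) auto
  then show ?thesis using assms(3) by (simp add: radial_moment_zero)
qed

text \<open>There is no boundary term: at l = t the kernel is evaluated at r = 0, where both
  \<open>S\<close> and its moment vanish.\<close>

lemma duhamel_int_Wop_has_dt:
  fixes S :: "'a::euclidean_space \<Rightarrow> real \<Rightarrow> real \<Rightarrow> real"
  assumes "\<delta> > 0" "dominated_data \<delta> S" "dominated_data \<delta> S'" "t > 0"
    and "\<And>x r l. 0 < l \<Longrightarrow> ((\<lambda>r. S x r l) has_real_derivative S' x r l) (at r)"
    and "\<And>x l. 0 < l \<Longrightarrow> S x 0 l = 0"
  shows "((\<lambda>s. duhamel_int (wave_kernel S) x s) has_real_derivative duhamel_int (wave_kernel_dt S S') x t) (at t)"
proof -
  have "((\<lambda>s. duhamel_int (wave_kernel S) x s) has_real_derivative duhamel_int (wave_kernel_dt S S') x t + wave_kernel S (x, t) t) (at t)"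
    by (rule duhamel_int_has_dt[OF assms(1) dominated_Wop dominated_Wtop]) (use assms in \<open>auto intro: wave_kernel_has_dt\<close>)
  then show ?thesis using assms by (simp add: wave_kernel_def radial_moment_zero)
qed

lemma has_pd_unique: "has_pd b g d x \<Longrightarrow> has_pd b g e x \<Longrightarrow> d = e"
  unfolding has_pd_def by (rule DERIV_unique)

section \<open>The Duhamel integral solves the inhomogeneous equation\<close>

text \<open>\<open>S\<close> solves the wave equation in \<open>(x, r)\<close> with \<open>S = 0\<close> and \<open>S\<^sub>r = F\<close> at \<open>r = 0\<close>, and it is defined for negative \<open>r\<close> too, so the
  kernel is smooth across \<open>l = t\<close>.\<close>

locale duhamel =
  fixes \<delta> :: real and S Sr Srr :: "'a::euclidean_space \<Rightarrow> real \<Rightarrow> real \<Rightarrow> real"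
    and Sb Sbr :: "'a \<Rightarrow> 'a \<Rightarrow> real \<Rightarrow> real \<Rightarrow> real" and Sbc :: "'a \<Rightarrow> 'a \<Rightarrow> 'a \<Rightarrow> real \<Rightarrow> real \<Rightarrow> real"
  assumes d: "\<delta> > 0"
    and gS: "dominated_data \<delta> S" "dominated_data \<delta> Sr" "dominated_data \<delta> Srr" "\<And>b. b \<in> Basis \<Longrightarrow> dominated_data \<delta> (Sb b)"
      "\<And>b. b \<in> Basis \<Longrightarrow> dominated_data \<delta> (Sbr b)" "\<And>b c. b \<in> Basis \<Longrightarrow> c \<in> Basis \<Longrightarrow> dominated_data \<delta> (Sbc b c)"
    and dr: "\<And>x r l. 0 < l \<Longrightarrow> ((\<lambda>r. S x r l) has_real_derivative Sr x r l) (at r)"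
      "\<And>x r l. 0 < l \<Longrightarrow> ((\<lambda>r. Sr x r l) has_real_derivative Srr x r l) (at r)"
      "\<And>b x r l. b \<in> Basis \<Longrightarrow> 0 < l \<Longrightarrow> ((\<lambda>r. Sb b x r l) has_real_derivative Sbr b x r l) (at r)"
    and db: "\<And>b x r l. b \<in> Basis \<Longrightarrow> 0 < l \<Longrightarrow> has_pd b (\<lambda>x. S x r l) (Sb b x r l) x"
      "\<And>b x r l. b \<in> Basis \<Longrightarrow> 0 < l \<Longrightarrow> has_pd b (\<lambda>x. Sr x r l) (Sbr b x r l) x"
      "\<And>b c x r l. b \<in> Basis \<Longrightarrow> c \<in> Basis \<Longrightarrow> 0 < l \<Longrightarrow> has_pd c (\<lambda>x. Sb b x r l) (Sbc b c x r l) x"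
    and S0: "\<And>x l. 0 < l \<Longrightarrow> S x 0 l = 0"
    and wave: "\<And>x r l. 0 < l \<Longrightarrow> Srr x r l = (\<Sum>b\<in>Basis. Sbc b b x r l)"
begin

definition "w = duhamel_int (wave_kernel S)"
definition "wt = duhamel_int (wave_kernel_dt S Sr)"
text \<open>The t-derivative of \<open>wave_kernel_dt S Sr\<close>, expanded so that every summand
  is a time coefficient times a dominated function.\<close>

definition "Wtt = (\<lambda>p l. (- (snd p powr (-4/3)) / 9) * S (fst p) (phi (snd p) - phi l) l
   + (- (snd p powr (-4/3)) / 9) * phi l * Sr (fst p) (phi (snd p) - phi l) l
   + (phi (snd p) * snd p powr (-4/3) / 9) * Sr (fst p) (phi (snd p) - phi l) l
   + (phi (snd p) * snd p powr (-4/3) / 9) * phi l * Srr (fst p) (phi (snd p) - phi l) l)"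

lemma Sb0: "b \<in> Basis \<Longrightarrow> 0 < l \<Longrightarrow> Sb b x 0 l = 0"
  using db(1)[of b l 0 x] has_pd_const[of b 0 x] S0 by (auto intro: has_pd_unique)

lemma dominated_Wtt: "dominated \<delta> halfspace Wtt"
proof -
  have c1: "continuous_on halfspace (\<lambda>p::'a \<times> real. - (snd p powr (-4/3)) / 9)"
    by (rule continuous_time_coeff[where c = "\<lambda>t. - (t powr (-4/3)) / 9"]) (intro continuous_intros continuous_powr_pos; simp)
  have c2: "continuous_on halfspace (\<lambda>p::'a \<times> real. phi (snd p) * snd p powr (-4/3) / 9)"
    by (rule continuous_time_coeff[where c = "\<lambda>t. phi t * t powr (-4/3) / 9"])
       (intro continuous_intros continuous_powr_pos phi_continuous_pos; simp)
  note m = dominated_mult[OF _ _ phi_continuous_pos phi_bounded] and g = dominated_data_good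
  from dominated_add[OF dominated_add[OF dominated_add[OF dominated_mult_left[OF g[OF gS(1)] c1] m[OF g[OF gS(2)] c1]]
      dominated_mult_left[OF g[OF gS(2)] c2]] m[OF g[OF gS(3)] c2]]
  show ?thesis unfolding Wtt_def .
qed

lemma w_dt: "t > 0 \<Longrightarrow> ((\<lambda>s. w x s) has_real_derivative wt x t) (at t)"
  unfolding w_def wt_def by (rule duhamel_int_Wop_has_dt[OF d gS(1,2) _ dr(1) S0])

lemma w_dx: "t > 0 \<Longrightarrow> b \<in> Basis \<Longrightarrow> has_pd b (\<lambda>x. w x t) (duhamel_int (wave_kernel (Sb b)) x t) x"
  unfolding w_def by (rule duhamel_int_has_dx[OF d dominated_Wop dominated_Wop]) (auto intro!: gS wave_kernel_has_dx[OF gS(1) gS(4)] db)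

lemma wb_dt: "t > 0 \<Longrightarrow> b \<in> Basis \<Longrightarrow> ((\<lambda>s. duhamel_int (wave_kernel (Sb b)) x s) has_real_derivative duhamel_int (wave_kernel_dt (Sb b) (Sbr b)) x t) (at t)"
  by (rule duhamel_int_Wop_has_dt[OF d gS(4,5)]) (auto intro: dr Sb0)

lemma wb_dx: "t > 0 \<Longrightarrow> b \<in> Basis \<Longrightarrow> c \<in> Basis \<Longrightarrow> has_pd c (\<lambda>x. duhamel_int (wave_kernel (Sb b)) x t) (duhamel_int (wave_kernel (Sbc b c)) x t) x"
  by (rule duhamel_int_has_dx[OF d dominated_Wop dominated_Wop]) (auto intro!: gS wave_kernel_has_dx[OF gS(4) gS(6)] db)

lemma wt_dx: "t > 0 \<Longrightarrow> b \<in> Basis \<Longrightarrow> has_pd b (\<lambda>x. wt x t) (duhamel_int (wave_kernel_dt (Sb b) (Sbr b)) x t) x"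
  unfolding wt_def by (rule duhamel_int_has_dx[OF d dominated_Wtop dominated_Wtop]) (auto intro!: gS wave_kernel_dt_has_dx db)

lemma wave_kernel_dt_dt:
  assumes t: "t > 0" and l: "l > 0"
  shows "((\<lambda>s. wave_kernel_dt S Sr (x, s) l) has_real_derivative Wtt (x, t) l) (at t)"
proof -
  let ?R = "phi t - phi l"
  have R: "((\<lambda>s. phi s - phi l) has_real_derivative t powr (-2/3)) (at t)"
    using DERIV_diff[OF phi_has_derivative[OF t] DERIV_const, of "phi l"] by simp
  have S1: "((\<lambda>s. S x (phi s - phi l) l) has_real_derivative Sr x ?R l * t powr (-2/3)) (at t)"
    by (rule DERIV_chain2[OF dr(1)[OF l] R])
  have S2: "((\<lambda>s. Sr x (phi s - phi l) l) has_real_derivative Srr x ?R l * t powr (-2/3)) (at t)"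
    by (rule DERIV_chain2[OF dr(2)[OF l] R])
  have p: "((\<lambda>s. s powr (-1/3) / 3) has_real_derivative - (t powr (-4/3)) / 9) (at t)"
    using t by (auto intro!: derivative_eq_intros)
  have d0: "((\<lambda>s. wave_kernel_dt S Sr (x, s) l) has_real_derivative
     ((- (t powr (-4/3)) / 9) * S x ?R l + (Sr x ?R l * t powr (-2/3)) * (t powr (-1/3) / 3))
     + ((- (t powr (-4/3)) / 9 * phi l) * Sr x ?R l + (Srr x ?R l * t powr (-2/3)) * (t powr (-1/3) / 3 * phi l))) (at t)"
    unfolding wave_kernel_dt_def fst_conv snd_conv
    by (intro DERIV_add DERIV_mult S1 S2 p DERIV_cmult_right)
  have e: "(Sr x ?R l * t powr (-2/3)) * (t powr (-1/3) / 3) = (phi t * t powr (-4/3) / 9) * Sr x ?R l"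
    "(Srr x ?R l * t powr (-2/3)) * (t powr (-1/3) / 3 * phi l) = (phi t * t powr (-4/3) / 9) * phi l * Srr x ?R l"
  proof -
    have "t powr (-2/3) * t powr (-1/3) = phi t * t powr (-4/3) / 3" using phi_powr(3)[OF t] by (simp add: mult.commute)
    then have "(a * t powr (-2/3)) * (t powr (-1/3) / 3 * b) = a * b * (phi t * t powr (-4/3) / 9)" for a b
    proof -
      assume X: "t powr (-2/3) * t powr (-1/3) = phi t * t powr (-4/3) / 3"
      have "(a * t powr (-2/3)) * (t powr (-1/3) / 3 * b) = a * b * ((t powr (-2/3) * t powr (-1/3)) / 3)" by simp
      then show ?thesis unfolding X by simp
    qed
    from this[of "Sr x ?R l" 1] this[of "Srr x ?R l" "phi l"]
    show "(Sr x ?R l * t powr (-2/3)) * (t powr (-1/3) / 3) = (phi t * t powr (-4/3) / 9) * Sr x ?R l"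
    "(Srr x ?R l * t powr (-2/3)) * (t powr (-1/3) / 3 * phi l) = (phi t * t powr (-4/3) / 9) * phi l * Srr x ?R l"
      by (simp_all add: mult_ac)
  qed
  have "((- (t powr (-4/3)) / 9) * S x ?R l + (Sr x ?R l * t powr (-2/3)) * (t powr (-1/3) / 3))
     + ((- (t powr (-4/3)) / 9 * phi l) * Sr x ?R l + (Srr x ?R l * t powr (-2/3)) * (t powr (-1/3) / 3 * phi l)) = Wtt (x, t) l"
    unfolding e Wtt_def fst_conv snd_conv by (simp only: add_ac)
  with d0 show ?thesis by simp
qed

text \<open>The source enters here. At l = t the term with \<open>S\<close> vanishes, and the other
  has the coefficient t^(-1/3) phi(t) / 3 = 1, which fixes the normalisation of the kernel.\<close>

lemma wt_dt: "t > 0 \<Longrightarrow> ((\<lambda>s. wt x s) has_real_derivative duhamel_int Wtt x t + Sr x 0 t) (at t)"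
proof -
  assume t: "t > 0"
  have "((\<lambda>s. wt x s) has_real_derivative duhamel_int Wtt x t + wave_kernel_dt S Sr (x, t) t) (at t)"
    unfolding wt_def by (rule duhamel_int_has_dt[OF d dominated_Wtop dominated_Wtt t wave_kernel_dt_dt]) (auto intro: gS)
  moreover have "wave_kernel_dt S Sr (x, t) t = Sr x 0 t"
    using phi_powr(1)[OF t] S0[OF t] by (simp add: wave_kernel_dt_def)
  ultimately show ?thesis by simp
qed

text \<open>The equation already holds for each l under the integral. As the Laplacian of S is S_rr,
  its moment integrates by parts to r S_r - S with r = phi t - phi l, and this reproduces the lower
  order terms of \<open>Wtt\<close>.\<close>

lemma Wtt_eq:
  assumes t: "t > 0" and l: "l > 0"
  shows "Wtt (x, t) l = t powr (-4/3) * (\<Sum>b\<in>Basis. wave_kernel (Sbc b b) (x, t) l)"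
proof -
  let ?R = "phi t - phi l"
  have w: "(\<Sum>b\<in>Basis. Sbc b b x r l) = Srr x r l" for r by (rule wave[OF l, symmetric])
  have q: "(\<Sum>b\<in>Basis. radial_moment (Sbc b b) x ?R l) = ?R * Sr x ?R l - S x ?R l"
  proof -
    have "(\<Sum>b\<in>Basis. radial_moment (Sbc b b) x ?R l) = radial_moment (\<lambda>x r l. \<Sum>b\<in>Basis. Sbc b b x r l) x ?R l"
      by (rule radial_moment_sum[symmetric, OF gS(6) l]) auto
    also have "\<dots> = radial_moment Srr x ?R l" unfolding radial_moment_def w ..
    also have "\<dots> = ?R * Sr x ?R l - S x ?R l" by (rule radial_moment_by_parts[where S = S and S' = Sr and S'' = Srr, OF gS(3) l S0[OF l] dr(1)[OF l] dr(2)[OF l]])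
    finally show ?thesis .
  qed
  have "(\<Sum>b\<in>Basis. wave_kernel (Sbc b b) (x, t) l) = phi t / 9 * phi l * Srr x ?R l + 1/9 * (?R * Sr x ?R l - S x ?R l)"
    unfolding wave_kernel_def fst_conv snd_conv sum.distrib sum_distrib_left[symmetric] w q ..
  then show ?thesis unfolding Wtt_def fst_conv snd_conv by (simp only:) (simp add: field_simps)
qed

lemma w_Ck: "Ck 2 halfspace (\<lambda>(x, t). w x t)"
proof -
  have c: "continuous_on halfspace (\<lambda>(x, t). duhamel_int G x t)" if "dominated \<delta> halfspace G" for G :: "'a \<times> real \<Rightarrow> real \<Rightarrow> real"
    by (rule duhamel_int_continuous[OF that d])
  have cF: "continuous_on halfspace (\<lambda>(x, t). Sr x 0 t)"
  proof -
    have c: "continuous_on (UNIV \<times> UNIV \<times> {0<..}) (\<lambda>(x, r, l). Sr x r l)" using gS by (simp add: dominated_data_def)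
    have i: "continuous_on halfspace (\<lambda>p::'a \<times> real. (fst p, 0::real, snd p))" by (intro continuous_intros)
    have "continuous_on halfspace (\<lambda>p::'a \<times> real. (\<lambda>(x, r, l). Sr x r l) (fst p, 0, snd p))"
      by (rule continuous_on_compose2[OF c i]) auto
    then show ?thesis by (simp add: case_prod_unfold)
  qed
  have ctt: "continuous_on halfspace (\<lambda>(x, t). duhamel_int Wtt x t + Sr x 0 t)"
    using c[OF dominated_Wtt] cF by (auto simp: case_prod_unfold intro!: continuous_intros)
  have ct: "Ck (Suc 0) halfspace (\<lambda>(x, t). wt x t)"
    by (rule Ck_prodI[OF open_halfspace, where vt = "\<lambda>x t. duhamel_int Wtt x t + Sr x 0 t" and vx = "\<lambda>b x t. duhamel_int (wave_kernel_dt (Sb b) (Sbr b)) x t"])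
       (use ctt in \<open>auto simp: Ck_0 wt_def intro!: c dominated_Wtop gS wt_dt[unfolded wt_def] wt_dx[unfolded wt_def]\<close>)
  have cx: "Ck (Suc 0) halfspace (\<lambda>(x, t). duhamel_int (wave_kernel (Sb b)) x t)" if b: "b \<in> Basis" for b
    by (rule Ck_prodI[OF open_halfspace, where vt = "\<lambda>x t. duhamel_int (wave_kernel_dt (Sb b) (Sbr b)) x t" and vx = "\<lambda>c x t. duhamel_int (wave_kernel (Sbc b c)) x t"])
       (use b in \<open>auto simp: Ck_0 intro!: c dominated_Wtop dominated_Wop gS wb_dt wb_dx\<close>)
  have "continuous_on halfspace (\<lambda>(x, t). w x t)" unfolding w_def by (rule c[OF dominated_Wop[OF gS(1)]])
  then have "Ck (Suc (Suc 0)) halfspace (\<lambda>(x, t). w x t)"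
    by (rule Ck_prodI[OF open_halfspace, where vt = wt and vx = "\<lambda>b. duhamel_int (wave_kernel (Sb b))"])
       (use ct cx in \<open>auto intro!: w_dt w_dx\<close>)
  then show ?thesis by (simp add: numeral_2_eq_2)
qed

lemma w_lapx: "t > 0 \<Longrightarrow> lapx w x t = (\<Sum>b\<in>Basis. duhamel_int (wave_kernel (Sbc b b)) x t)"
proof -
  assume t: "t > 0"
  have "dx b (dx b w) x t = duhamel_int (wave_kernel (Sbc b b)) x t" if b: "b \<in> Basis" for b
  proof (rule dx_eqI)
    have "dx b w y t = duhamel_int (wave_kernel (Sb b)) y t" for y by (rule dx_eqI) (rule w_dx[OF t b])
    then show "has_pd b (\<lambda>y. dx b w y t) (duhamel_int (wave_kernel (Sbc b b)) x t) x" using wb_dx[OF t b b] by simp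
  qed
  then show ?thesis by (simp add: lapx_def)
qed

lemma w_eq:
  assumes t: "t > 0"
  shows "duhamel_int Wtt x t = t powr (-4/3) * lapx w x t"
proof -
  have g: "dominated \<delta> halfspace (wave_kernel (Sbc b b))" if "b \<in> Basis" for b by (rule dominated_Wop[OF gS(6)[OF that that]])
  have "duhamel_int Wtt x t = kernel_int (\<lambda>p l. t powr (-4/3) * (\<Sum>b\<in>Basis. wave_kernel (Sbc b b) p l)) t (x, t)"
    unfolding duhamel_int_def by (rule kernel_int_cong) (simp add: Wtt_eq t)
  also have "\<dots> = t powr (-4/3) * kernel_int (\<lambda>p l. \<Sum>b\<in>Basis. wave_kernel (Sbc b b) p l) t (x, t)"
    unfolding kernel_int_def integral_mult_right_zero[symmetric] by (rule Bochner_Integration.integral_cong) (auto simp: mult_ac)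
  also have "kernel_int (\<lambda>p l. \<Sum>b\<in>Basis. wave_kernel (Sbc b b) p l) t (x, t) = (\<Sum>b\<in>Basis. duhamel_int (wave_kernel (Sbc b b)) x t)"
    unfolding duhamel_int_def by (rule kernel_int_sum[OF g _ d]) (use t in auto)
  finally show ?thesis by (simp add: w_lapx[OF t])
qed

text \<open>The factor t^(-1/3) of the time derivative is singular at 0. It is compensated because S
  vanishes at r = 0, so that |S| is at most phi t times a bound for S_r; also phi l is at most phi
  t, and t^(-1/3) phi t = 3.\<close>

lemma kernel_bounds:
  obtains C where "C \<ge> 0" "\<And>t l. 0 < l \<Longrightarrow> l \<le> t \<Longrightarrow> t \<le> 1 \<Longrightarrow> \<bar>wave_kernel S (x, t) l\<bar> \<le> C * l powr (\<delta> - 1) \<and> \<bar>wave_kernel_dt S Sr (x, t) l\<bar> \<le> C * l powr (\<delta> - 1)"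
proof -
  \<comment> \<open>3 is the value of \<open>phi\<close> at 1 and bounds every r that occurs for t
    up to 1.\<close>
  define R where "R = max (norm x) 3"
  obtain C1 where C1: "C1 \<ge> 0" "\<And>x r l. norm x \<le> R \<Longrightarrow> \<bar>r\<bar> \<le> R \<Longrightarrow> 0 < l \<Longrightarrow> l \<le> 1 \<Longrightarrow> \<bar>S x r l\<bar> \<le> C1 * l powr (\<delta> - 1)"
    by (rule dominated_data_bound[OF gS(1), of R 1]) blast
  obtain C2 where C2: "C2 \<ge> 0" "\<And>x r l. norm x \<le> R \<Longrightarrow> \<bar>r\<bar> \<le> R \<Longrightarrow> 0 < l \<Longrightarrow> l \<le> 1 \<Longrightarrow> \<bar>Sr x r l\<bar> \<le> C2 * l powr (\<delta> - 1)"
    by (rule dominated_data_bound[OF gS(2), of R 1]) blast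
  show ?thesis
  proof (rule that[of "2 * (C1 + C2)"])
    fix t l :: real assume l: "0 < l" "l \<le> t" and t: "t \<le> 1"
    define k where "k = l powr (\<delta> - 1)"
    define r where "r = phi t - phi l"
    have k: "k \<ge> 0" by (simp add: k_def)
    have t0: "t > 0" using l by simp
    have p: "0 \<le> phi l" "phi l \<le> phi t" "phi t \<le> 3"
      using phi_nonneg[of l] phi_mono[of l t] phi_mono[of t 1] l t by (auto simp: phi_def)
    have r: "0 \<le> r" "r \<le> phi t" "r \<le> 3" using p by (auto simp: r_def)
    have b1: "\<bar>S x s l\<bar> \<le> C1 * k" if "\<bar>s\<bar> \<le> 3" for s unfolding k_def using that l t by (intro C1(2)) (auto simp: R_def)
    have b2: "\<bar>Sr x s l\<bar> \<le> C2 * k" if "\<bar>s\<bar> \<le> 3" for s unfolding k_def using that l t by (intro C2(2)) (auto simp: R_def)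
    have "\<bar>radial_moment S x r l\<bar> \<le> r\<^sup>2 * (C1 * k)" by (rule radial_moment_bound[OF gS(1) l(1)]) (use r in \<open>auto intro!: b1\<close>)
    also have "\<dots> \<le> 3\<^sup>2 * (C1 * k)" using r C1 k by (intro mult_right_mono power_mono) auto
    finally have bQ: "\<bar>radial_moment S x r l\<bar> \<le> 9 * (C1 * k)" by simp
    have "\<bar>phi t * phi l * S x r l\<bar> \<le> 3 * 3 * (C1 * k)"
      unfolding abs_mult using p r by (intro mult_mono b1) auto
    then have "\<bar>wave_kernel S (x, t) l\<bar> \<le> 1 / 9 * (9 * (C1 * k)) + 1 / 9 * (9 * (C1 * k))"
      using bQ unfolding wave_kernel_def fst_conv snd_conv r_def[symmetric] by (auto simp: abs_le_iff)
    then have 1: "\<bar>wave_kernel S (x, t) l\<bar> \<le> 2 * C1 * k" by simp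
    have "\<bar>S x r l\<bar> \<le> phi t * (C2 * k)"
    proof (cases "r = 0")
      case True then show ?thesis using S0[OF l(1)] p C2(1) k by simp
    next
      case False
      then have r0: "0 < r" using r by simp
      obtain s where s: "0 < s" "s < r" "S x r l - S x 0 l = (r - 0) * Sr x s l"
        using MVT2[OF r0, of "\<lambda>r. S x r l" "\<lambda>r. Sr x r l"] dr(1)[OF l(1)] by auto
      then have "\<bar>S x r l\<bar> = r * \<bar>Sr x s l\<bar>" using S0[OF l(1)] r by (simp add: abs_mult)
      also have "\<dots> \<le> phi t * (C2 * k)" using r s by (intro mult_mono b2) auto
      finally show ?thesis .
    qed
    moreover have "\<bar>phi l * Sr x r l\<bar> \<le> phi t * (C2 * k)" unfolding abs_mult using p r by (intro mult_mono b2) auto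
    ultimately have "\<bar>S x r l + phi l * Sr x r l\<bar> \<le> 2 * (phi t * (C2 * k))" by linarith
    then have "t powr (-1/3) / 3 * \<bar>S x r l + phi l * Sr x r l\<bar> \<le> t powr (-1/3) / 3 * (2 * (phi t * (C2 * k)))"
      by (rule mult_left_mono) simp
    also have "\<dots> = (t powr (-1/3) * phi t) * (2 / 3 * (C2 * k))" by simp
    also have "\<dots> = 2 * C2 * k" using phi_powr(1)[OF t0] by simp
    finally have "t powr (-1/3) / 3 * \<bar>S x r l + phi l * Sr x r l\<bar> \<le> 2 * C2 * k" .
    moreover have "wave_kernel_dt S Sr (x, t) l = t powr (-1/3) / 3 * (S x r l + phi l * Sr x r l)"
      unfolding wave_kernel_dt_def fst_conv snd_conv r_def[symmetric] by (simp add: algebra_simps)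
    ultimately have 2: "\<bar>wave_kernel_dt S Sr (x, t) l\<bar> \<le> 2 * C2 * k" by (simp only: abs_mult) simp
    have "2 * C1 * k \<le> 2 * (C1 + C2) * k" "2 * C2 * k \<le> 2 * (C1 + C2) * k" using C1 C2 k by (auto intro!: mult_right_mono)
    with 1 2 show "\<bar>wave_kernel S (x, t) l\<bar> \<le> 2 * (C1 + C2) * l powr (\<delta> - 1) \<and> \<bar>wave_kernel_dt S Sr (x, t) l\<bar> \<le> 2 * (C1 + C2) * l powr (\<delta> - 1)"
      unfolding k_def[symmetric] by linarith
  qed (use C1 C2 in simp)
qed

lemma limits: "((\<lambda>t. w x t) \<longlongrightarrow> 0) (at_right 0)" "((\<lambda>t. wt x t) \<longlongrightarrow> 0) (at_right 0)"
proof -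
  obtain C where C: "C \<ge> 0" "\<And>t l. 0 < l \<Longrightarrow> l \<le> t \<Longrightarrow> t \<le> 1 \<Longrightarrow> \<bar>wave_kernel S (x, t) l\<bar> \<le> C * l powr (\<delta> - 1) \<and> \<bar>wave_kernel_dt S Sr (x, t) l\<bar> \<le> C * l powr (\<delta> - 1)"
    by (rule kernel_bounds) blast
  have l0: "((\<lambda>t. C * (t powr \<delta> / \<delta>)) \<longlongrightarrow> C * (0 powr \<delta> / \<delta>)) (at_right 0)"
    using d by (intro tendsto_intros tendsto_powr') (auto simp: eventually_at intro!: exI[of _ 1])
  have l: "((\<lambda>t. C * (t powr \<delta> / \<delta>)) \<longlongrightarrow> 0) (at_right 0)" using l0 by simp
  have ev: "\<forall>\<^sub>F t in at_right 0. 0 < t \<and> t \<le> (1::real)"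
    by (auto simp: eventually_at intro!: exI[of _ 1])
  show "((\<lambda>t. w x t) \<longlongrightarrow> 0) (at_right 0)"
  proof (rule Lim_null_comparison[OF _ l])
    show "\<forall>\<^sub>F t in at_right 0. norm (w x t) \<le> C * (t powr \<delta> / \<delta>)"
      using ev
    proof eventually_elim
      case (elim t)
      then show ?case unfolding w_def duhamel_int_def real_norm_def by (intro kernel_int_bound[OF dominated_Wop[OF gS(1)] _ d]) (use C(2) in auto)
    qed
  qed
  show "((\<lambda>t. wt x t) \<longlongrightarrow> 0) (at_right 0)"
  proof (rule Lim_null_comparison[OF _ l])
    show "\<forall>\<^sub>F t in at_right 0. norm (wt x t) \<le> C * (t powr \<delta> / \<delta>)"
      using ev
    proof eventually_elim
      case (elim t)
      then show ?case unfolding wt_def duhamel_int_def real_norm_def by (intro kernel_int_bound[OF dominated_Wtop[OF gS(1,2)] _ d]) (use C(2) in auto)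
    qed
  qed
qed

text \<open>Integration by parts in r. At the upper limit the bracket becomes phi(t)^2 + phi(l)^2 -
  (phi t - phi l)^2 = 2 phi t phi l, and together with the 9 in the kernel this 2 accounts for the
  factor 18.\<close>

lemma inner_integral:
  assumes t: "t > 0" and l: "0 < l" "l \<le> t"
  shows "integral {0..phi t - phi l} (\<lambda>r. (phi t ^ 2 + phi l ^ 2 - r ^ 2) * Sr x r l) = 18 * wave_kernel S (x, t) l"
proof -
  let ?R = "phi t - phi l"
  let ?H = "\<lambda>r. (phi t ^ 2 + phi l ^ 2 - r ^ 2) * S x r l + 2 * radial_moment S x r l"
  have "(?H has_real_derivative (phi t ^ 2 + phi l ^ 2 - r ^ 2) * Sr x r l) (at r)" for r
    by (auto intro!: derivative_eq_intros dr(1)[OF l(1)] radial_moment_deriv_r[OF gS(1) l(1)])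
  then have "(?H has_vector_derivative (phi t ^ 2 + phi l ^ 2 - r ^ 2) * Sr x r l) (at r within {0..?R})" for r
    by (simp add: has_real_derivative_iff_has_vector_derivative has_vector_derivative_at_within)
  then have "((\<lambda>r. (phi t ^ 2 + phi l ^ 2 - r ^ 2) * Sr x r l) has_integral ?H ?R - ?H 0) {0..?R}"
    using phi_mono[of l t] l by (intro fundamental_theorem_of_calculus) auto
  then have "integral {0..?R} (\<lambda>r. (phi t ^ 2 + phi l ^ 2 - r ^ 2) * Sr x r l) = ?H ?R - ?H 0" by (rule integral_unique)
  also have "?H 0 = 0" using S0[OF l(1)] by (simp add: radial_moment_zero)
  also have "?H ?R - 0 = 18 * wave_kernel S (x, t) l" by (simp add: wave_kernel_def power2_eq_square algebra_simps)
  finally show ?thesis .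
qed

lemma outer_integral:
  assumes t: "t > 0"
  shows "integral {0..t} (\<lambda>l. integral {0..phi t - phi l} (\<lambda>r. (phi t ^ 2 + phi l ^ 2 - r ^ 2) * Sr x r l)) = 18 * w x t"
proof -
  have "((\<lambda>l. 18 * wave_kernel S (x, t) l) has_integral 18 * kernel_int (wave_kernel S) t (x, t)) {0..t}"
    by (intro has_integral_mult_right kernel_int_has_integral[OF dominated_Wop[OF gS(1)] _ d]) (use t in auto)
  then have "((\<lambda>l. integral {0..phi t - phi l} (\<lambda>r. (phi t ^ 2 + phi l ^ 2 - r ^ 2) * Sr x r l)) has_integral 18 * kernel_int (wave_kernel S) t (x, t)) {0..t}"
    \<comment> \<open>At l = 0 the data are not controlled; one point does not change the
      integral.\<close>
    by (rule has_integral_spike_finite[rotated 2, of _ _ _ "{0}"]) (use inner_integral[OF t] in auto)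
  then show ?thesis by (simp add: integral_unique w_def duhamel_int_def)
qed

end

section \<open>The source term\<close>

text \<open>The exponent 1/6 is a choice: with it tau is O(l^(5/6)) and l^(-4/3) tau is O(l^(-1/2)),
  which is integrable. The constant 7 is 6 for the logarithm plus 1.\<close>

lemma ln_bound_near_zero:
  fixes l :: real
  assumes "0 < l" "l \<le> 1"
  shows "\<bar>ln l - 1\<bar> \<le> 7 * l powr (-1/6)"
proof -
  have "ln (1 / l) \<le> (1 / l) powr (1/6) / (1/6)" by (rule ln_powr_bound) (use assms in auto)
  then have 1: "- ln l \<le> 6 * l powr (-1/6)" using assms by (simp add: ln_div powr_divide powr_minus_divide)
  have 2: "1 \<le> l powr (-1/6)" using assms powr_mono'[of "-1/6" 0 l] by simp
  have "ln l \<le> 0" using assms by simp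
  with 1 2 show ?thesis by simp
qed

lemma tau_bound_near_zero:
  fixes l :: real
  assumes "0 < l" "l \<le> 1"
  shows "\<bar>l * ln l - l\<bar> \<le> 7 * l powr (5/6)"
proof -
  have "l * ln l - l = l * (ln l - 1)" by (simp add: algebra_simps)
  then have "\<bar>l * ln l - l\<bar> = l * \<bar>ln l - 1\<bar>" using assms by (simp add: abs_mult)
  also have "\<dots> \<le> l * (7 * l powr (-1/6))" using ln_bound_near_zero[OF assms] assms by (intro mult_left_mono) auto
  also have "\<dots> = 7 * (l powr 1 * l powr (-1/6))" using assms by simp
  also have "l powr 1 * l powr (-1/6) = l powr (5/6)" by (subst powr_add[symmetric]) simp
  finally show ?thesis .
qed

lemma l_ln_l_tendsto: "((\<lambda>l::real. l * ln l - l) \<longlongrightarrow> 0) (at_right 0)"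
proof (rule Lim_null_comparison)
  show "\<forall>\<^sub>F l in at_right 0. norm (l * ln l - l) \<le> 7 * l powr (5/6)"
    using tau_bound_near_zero by (auto simp: eventually_at intro!: exI[of _ 1])
  have "((\<lambda>l::real. 7 * l powr (5/6)) \<longlongrightarrow> 7 * 0 powr (5/6)) (at_right 0)"
    by (intro tendsto_intros tendsto_powr') (auto simp: eventually_at intro!: exI[of _ 1])
  then show "((\<lambda>l::real. 7 * l powr (5/6)) \<longlongrightarrow> 0) (at_right 0)" by simp
qed

lemma tau_eq:
  assumes "t > 0"
  shows "tau t = t * ln t - t"
proof -
  \<comment> \<open>The logarithm is unbounded at 0, so the fundamental theorem is used in the form
    that needs derivatives in the interior only and continuity of the primitive up to the
    endpoint.\<close>
  have "continuous_on {0..t} (\<lambda>l. l * ln l - l)"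
    unfolding continuous_on_eq_continuous_within
  proof
    fix l assume l: "l \<in> {0..t}"
    show "continuous (at l within {0..t}) (\<lambda>l. l * ln l - l)"
    proof (cases "l = 0")
      case True
      have "((\<lambda>l. l * ln l - l) \<longlongrightarrow> 0) (at 0 within {0..t})"
        using l_ln_l_tendsto assms by (simp add: at_within_Icc_at_right)
      then show ?thesis using True by (simp add: continuous_within)
    next
      case False
      then have "isCont (\<lambda>l. l * ln l - l) l" using l by (intro continuous_intros) auto
      then show ?thesis by (rule continuous_at_imp_continuous_at_within)
    qed
  qed
  moreover have "((\<lambda>l. l * ln l - l) has_vector_derivative ln l) (at l)" if "l \<in> {0<..<t}" for l
    using that by (auto simp: has_real_derivative_iff_has_vector_derivative[symmetric] intro!: derivative_eq_intros)
  ultimately have "(ln has_integral (t * ln t - t) - (0 * ln 0 - 0)) {0..t}"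
    using assms by (intro fundamental_theorem_of_calculus_interior) auto
  then show ?thesis by (simp add: tau_def integral_unique)
qed

lemma tau_has_derivative:
  assumes "t > 0"
  shows "(tau has_real_derivative ln t) (at t)"
proof -
  have "((\<lambda>l. l * ln l - l) has_real_derivative ln t) (at t)"
    using assms by (auto intro!: derivative_eq_intros)
  moreover have "\<forall>\<^sub>F l in nhds t. l * ln l - l = tau l"
    using eventually_nhds_in_open[of "{0<..}" t] assms by (auto elim!: eventually_mono simp: tau_eq)
  ultimately show ?thesis using DERIV_cong_ev[of t t "\<lambda>l. l * ln l - l" tau] by blast
qed

lemma tau_tendsto: "(tau \<longlongrightarrow> 0) (at_right 0)"
proof (rule Lim_transform_eventually[OF l_ln_l_tendsto])
  show "\<forall>\<^sub>F l in at_right 0. l * ln l - l = tau l"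
    by (auto simp: eventually_at tau_eq intro!: exI[of _ 1])
qed

definition beta :: "real \<Rightarrow> real" where "beta l = l powr (-4/3) * tau l"

lemma tau_continuous: "continuous_on {0<..} tau"
  using tau_has_derivative by (intro DERIV_continuous_on) (auto intro: has_field_derivative_at_within)

lemma beta_continuous: "continuous_on {0<..} beta"
  unfolding beta_def[abs_def] by (intro continuous_intros continuous_powr_pos tau_continuous)

text \<open>Near 0 the bound is given. Away from 0 the function times l^(1 - delta) is continuous on
  a compact set, so the same form of bound holds up to any \<open>L\<close>, with a larger
  constant.\<close>

lemma extend_bound:
  fixes k :: "'b::euclidean_space \<times> real \<Rightarrow> real"
  assumes k: "continuous_on (UNIV \<times> {0<..}) k" and c: "c > 0"
    and b: "\<And>y l. y \<in> cball 0 \<rho> \<Longrightarrow> 0 < l \<Longrightarrow> l < c \<Longrightarrow> \<bar>k (y, l)\<bar> \<le> C * l powr (\<delta> - 1)"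
  shows "\<exists>C\<ge>0. \<forall>y\<in>cball 0 \<rho>. \<forall>l\<in>{0<..L}. \<bar>k (y, l)\<bar> \<le> C * l powr (\<delta> - 1)"
proof -
  have "continuous_on (UNIV \<times> {0<..}) (\<lambda>z::'b \<times> real. snd z powr (1 - \<delta>))"
    by (rule continuous_on_compose2[OF continuous_powr_pos]) (auto intro!: continuous_intros)
  from continuous_on_mult[OF k this] have "continuous_on (UNIV \<times> {0<..}) (\<lambda>z. k z * snd z powr (1 - \<delta>))" .
  then have "continuous_on (cball 0 \<rho> \<times> {c/2..L}) (\<lambda>z. k z * snd z powr (1 - \<delta>))"
    by (rule continuous_on_subset) (use c in auto)
  then have "compact ((\<lambda>z. k z * snd z powr (1 - \<delta>)) ` (cball 0 \<rho> \<times> {c/2..L}))"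
    by (intro compact_continuous_image compact_Times) auto
  then obtain B where B: "\<And>z. z \<in> cball 0 \<rho> \<times> {c/2..L} \<Longrightarrow> \<bar>k z * snd z powr (1 - \<delta>)\<bar> \<le> B"
    using compact_imp_bounded bounded_iff by (metis (mono_tags, lifting) image_eqI real_norm_def)
  show ?thesis
  proof (intro exI[of _ "\<bar>B\<bar> + \<bar>C\<bar>"] conjI ballI)
    fix y :: 'b and l assume y: "y \<in> cball 0 \<rho>" and l: "l \<in> {0<..L}"
    show "\<bar>k (y, l)\<bar> \<le> (\<bar>B\<bar> + \<bar>C\<bar>) * l powr (\<delta> - 1)"
    proof (cases "l < c")
      case True
      then have "\<bar>k (y, l)\<bar> \<le> C * l powr (\<delta> - 1)" using b[OF y] l by auto
      also have "\<dots> \<le> (\<bar>B\<bar> + \<bar>C\<bar>) * l powr (\<delta> - 1)" by (intro mult_right_mono) auto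
      finally show ?thesis .
    next
      case False
      then have "\<bar>k (y, l) * l powr (1 - \<delta>)\<bar> \<le> B" using B[of "(y, l)"] y l c by auto
      then have "\<bar>k (y, l)\<bar> * l powr (1 - \<delta>) \<le> B" by (simp add: abs_mult)
      then have "(\<bar>k (y, l)\<bar> * l powr (1 - \<delta>)) * l powr (\<delta> - 1) \<le> B * l powr (\<delta> - 1)" by (rule mult_right_mono) simp
      moreover have "l powr (1 - \<delta>) * l powr (\<delta> - 1) = 1" using l by (simp add: powr_add[symmetric])
      ultimately have "\<bar>k (y, l)\<bar> \<le> B * l powr (\<delta> - 1)" by (simp add: mult.assoc)
      also have "\<dots> \<le> (\<bar>B\<bar> + \<bar>C\<bar>) * l powr (\<delta> - 1)" by (intro mult_right_mono) auto
      finally show ?thesis .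
    qed
  qed simp
qed

lemma beta_bound:
  assumes d: "\<delta> \<le> 1/2"
  shows "\<exists>C\<ge>0. \<forall>l\<in>{0<..L}. \<bar>beta l\<bar> \<le> C * l powr (\<delta> - 1)"
proof -
  \<comment> \<open>A dummy first coordinate brings a function of time alone into the form required
    by \<open>extend_bound\<close>.\<close>
  have k: "continuous_on (UNIV \<times> {0<..}) (\<lambda>z::real \<times> real. beta (snd z))"
    by (rule continuous_on_compose2[OF beta_continuous]) (auto intro!: continuous_intros)
  have "\<exists>C\<ge>0. \<forall>y\<in>cball (0::real) 1. \<forall>l\<in>{0<..L}. \<bar>beta (snd (y, l))\<bar> \<le> C * l powr (\<delta> - 1)"
  proof (rule extend_bound[OF k, of 1])
    fix y l :: real assume l: "0 < l" "l < 1"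
    have "\<bar>beta l\<bar> = l powr (-4/3) * \<bar>l * ln l - l\<bar>" using l by (simp add: beta_def tau_eq abs_mult)
    also have "\<dots> \<le> l powr (-4/3) * (7 * l powr (5/6))" using tau_bound_near_zero[of l] l by (intro mult_left_mono) auto
    also have "\<dots> = 7 * l powr (-1/2)" by (simp add: powr_add[symmetric])
    also have "\<dots> \<le> 7 * l powr (\<delta> - 1)" using l d by (intro mult_left_mono powr_mono') auto
    finally show "\<bar>beta (snd (y, l))\<bar> \<le> 7 * l powr (\<delta> - 1)" by simp
  qed auto
  then obtain C where C: "C \<ge> 0" "\<And>y l. y \<in> cball (0::real) 1 \<Longrightarrow> l \<in> {0<..L} \<Longrightarrow> \<bar>beta (snd (y, l))\<bar> \<le> C * l powr (\<delta> - 1)"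
    by blast
  then show ?thesis using C(2)[of 0] by (intro exI[of _ C]) auto
qed

section \<open>Regularity of time slices and of functions of space or time alone\<close>

lemma diter_slice: "diter bs (\<lambda>y. F (y, l)) y = diter (map (\<lambda>b. (b, 0)) bs) F (y, l :: real)"
proof (induction bs arbitrary: y)
  case (Cons b bs)
  have "diter bs (\<lambda>y. F (y, l)) = (\<lambda>y. diter (map (\<lambda>b. (b, 0)) bs) F (y, l))" by (rule ext) (rule Cons)
  then show ?case by (simp add: pdir_def)
qed simp

lemma Ck_slice: "Ck k halfspace F \<Longrightarrow> l > 0 \<Longrightarrow> Ck k UNIV (\<lambda>y. F (y, l))"
proof (induction k arbitrary: F)
  case 0
  then have "continuous_on UNIV (\<lambda>y. F (y, l))"
    unfolding Ck_0 by (elim continuous_on_compose2) (auto intro!: continuous_intros)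
  then show ?case by (simp add: Ck_0)
next
  case (Suc k)
  have c: "continuous_on UNIV (\<lambda>y. F (y, l))"
    using Ck_continuous[OF Suc(2)] by (rule continuous_on_compose2) (use Suc in \<open>auto intro!: continuous_intros\<close>)
  show ?case
  proof (rule Ck_SucI[OF open_UNIV c])
    fix b y :: 'a assume b: "b \<in> Basis"
    show "has_pd b (\<lambda>y. F (y, l)) (pdir (b, 0) F (y, l)) y"
      using Ck_has_pd[OF Suc(2) space_Basis[OF b], of "(y, l)"] Suc(3) by (simp add: has_pd_def)
    show "Ck k UNIV (\<lambda>y. pdir (b, 0) F (y, l))"
      by (rule Suc.IH) (use Suc(2,3) space_Basis[OF b] in \<open>auto simp: Ck_Suc\<close>)
  qed
qed

lemma Ck_space:
  fixes h :: "'a::euclidean_space \<Rightarrow> real"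
  shows "Ck k UNIV h \<Longrightarrow> Ck k halfspace (\<lambda>(x, t::real). h x)"
proof (induction k arbitrary: h)
  case 0
  then have "continuous_on halfspace (\<lambda>p::'a \<times> real. h (fst p))"
    unfolding Ck_0 by (elim continuous_on_compose2) (auto intro!: continuous_intros)
  then show ?case by (simp add: Ck_0 case_prod_unfold)
next
  case (Suc k)
  have "continuous_on halfspace (\<lambda>p::'a \<times> real. h (fst p))"
    using Ck_continuous[OF Suc(2)] by (rule continuous_on_compose2) (auto intro!: continuous_intros)
  then have c: "continuous_on halfspace (\<lambda>(x, t::real). h x)" by (simp add: case_prod_unfold)
  show ?case
    by (rule Ck_prodI[OF open_halfspace c, where vt = "\<lambda>x t. 0" and vx = "\<lambda>b x t. pdir b h x"])
       (use Suc Ck_const[of k _ 0] Ck_has_pd[OF Suc(2)] in \<open>auto simp: case_prod_unfold Ck_Suc\<close>)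
qed

lemma Ck_time_Suc:
  fixes q q' :: "real \<Rightarrow> real"
  assumes "\<And>t. t > 0 \<Longrightarrow> (q has_real_derivative q' t) (at t)" "Ck k halfspace (\<lambda>(x::'a::euclidean_space, t). q' t)"
  shows "Ck (Suc k) halfspace (\<lambda>(x::'a, t). q t)"
proof -
  have "continuous_on {0<..} q" using assms(1) by (intro DERIV_continuous_on) (auto intro: has_field_derivative_at_within)
  then have c: "continuous_on halfspace (\<lambda>(x::'a, t). q t)"
    using continuous_time_coeff[of q] by (simp add: case_prod_unfold)
  show ?thesis
    by (rule Ck_prodI[OF open_halfspace c, where vt = "\<lambda>x t. q' t" and vx = "\<lambda>b x t. 0"])
       (use assms Ck_const[of k _ 0] in \<open>auto simp: case_prod_unfold intro: has_pd_const\<close>)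
qed

lemma Ck_time_0:
  fixes q :: "real \<Rightarrow> real"
  shows "continuous_on {0<..} q \<Longrightarrow> Ck 0 halfspace (\<lambda>(x::'a::euclidean_space, t). q t)"
  using continuous_time_coeff[of q] by (simp add: Ck_0 case_prod_unfold)

lemma Ck_tau: "Ck 2 halfspace (\<lambda>(x::'a::euclidean_space, t). tau t)"
  unfolding numeral_2_eq_2
  by (rule Ck_time_Suc[OF tau_has_derivative], assumption, rule Ck_time_Suc[where q' = "\<lambda>t. 1 / t"])
     (auto intro!: derivative_eq_intros Ck_time_0 continuous_intros)

lemma Ck_inverse_time: "Ck 2 halfspace (\<lambda>(x::'a::euclidean_space, t). 1 / t)"
  unfolding numeral_2_eq_2
  by (rule Ck_time_Suc[where q' = "\<lambda>t. - 1 / t\<^sup>2"], goal_cases, (auto intro!: derivative_eq_intros simp: power2_eq_square)[1],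
      rule Ck_time_Suc[where q' = "\<lambda>t. 2 / t ^ 3"])
     (auto intro!: derivative_eq_intros Ck_time_0 continuous_intros simp: power2_eq_square power3_eq_cube field_simps)

text \<open>Derivatives of \<open>A h\<close> formed with \<open>dt\<close> and \<open>dx\<close>
  are averages only when the data are smooth enough, since otherwise \<open>deriv\<close> has no
  meaning; hence agreement is asked on C^N data only.\<close>

definition averaging :: "nat \<Rightarrow> (('a::euclidean_space \<Rightarrow> real) \<Rightarrow> 'a \<Rightarrow> real \<Rightarrow> real) \<Rightarrow> bool" where
  "averaging N A \<longleftrightarrow> (\<exists>D. avgop N D \<and> (\<forall>h. Ck N UNIV h \<longrightarrow> A h = D h))"

lemma averaging_avgop: "avgop N A \<Longrightarrow> averaging N A"
  by (auto simp: averaging_def)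

lemma averaging_mono: "averaging N A \<Longrightarrow> N \<le> M \<Longrightarrow> averaging M A"
  unfolding averaging_def using avgop_mono Ck_mono by metis

lemma averaging_dt: "averaging N A \<Longrightarrow> averaging (Suc N) (\<lambda>h. dt (A h))"
proof -
  assume "averaging N A"
  then obtain D where D: "avgop N D" "\<And>h. Ck N UNIV h \<Longrightarrow> A h = D h" by (auto simp: averaging_def)
  obtain E where E: "avgop (Suc N) E" "\<And>h x r. Ck (Suc N) UNIV h \<Longrightarrow> ((\<lambda>r. D h x r) has_real_derivative E h x r) (at r)"
    using avgop_deriv_r[OF D(1)] by blast
  have "dt (A h) = E h" if h: "Ck (Suc N) UNIV h" for h
    using D(2)[OF Ck_mono[OF h]] by (intro ext) (auto intro: dt_eqI E(2)[OF h])
  then show ?thesis using E(1) unfolding averaging_def by blast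
qed

lemma averaging_dx: "averaging N A \<Longrightarrow> b \<in> Basis \<Longrightarrow> averaging (Suc N) (\<lambda>h. dx b (A h))"
proof -
  assume "averaging N A" and b: "b \<in> Basis"
  then obtain D where D: "avgop N D" "\<And>h. Ck N UNIV h \<Longrightarrow> A h = D h" by (auto simp: averaging_def)
  obtain E where E: "avgop (Suc N) E" "\<And>h x r. Ck (Suc N) UNIV h \<Longrightarrow> has_pd b (\<lambda>x. D h x r) (E h x r) x"
    using avgop_deriv_x[OF D(1) b] by blast
  have "dx b (A h) = E h" if h: "Ck (Suc N) UNIV h" for h
    using D(2)[OF Ck_mono[OF h]] by (intro ext) (auto intro: dx_eqI E(2)[OF h])
  then show ?thesis using E(1) unfolding averaging_def by blast
qed

lemma averaging_Ck: "averaging N A \<Longrightarrow> Ck (N + k) UNIV h \<Longrightarrow> Ck k UNIV (\<lambda>(x, r). A h x r)"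
  unfolding averaging_def using avgop_Ck Ck_mono[of "N + k" UNIV h N] by fastforce

text \<open>In terms of \<open>m\<close>, the order [n/2] + 4 of the regularity is
  \<open>m + 3\<close> and the order [n/2] + 2 of the second bound is \<open>m + 1\<close>.\<close>

locale source =
  fixes f :: "'a::euclidean_space \<Rightarrow> real \<Rightarrow> real" and f0 :: "'a \<Rightarrow> real" and \<epsilon> T :: real and m :: nat
  defines "m \<equiv> DIM('a) div 2 + 1"
  assumes f_reg: "Ck (m + 3) halfspace (\<lambda>(x, t). f x t)"
    and f0_reg: "Ck (m + 3) UNIV f0"
    and T_pos: "T > 0" and eps_pos: "\<epsilon> > 0"
    and g_bd: "\<exists>C. \<forall>bs t x. set bs \<subseteq> Basis \<longrightarrow> length bs \<le> m + 1 \<longrightarrow> 0 < t \<longrightarrow> t < T \<longrightarrow>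
       \<bar>diter bs (\<lambda>y. t * f y t - f0 y / t) x\<bar> \<le> C * t powr (\<epsilon> - 1)"
begin

text \<open>One exponent for both parts of the source: \<open>\<epsilon>\<close> from the bound on t
  f - f0/t, and 1/2 from the bound l^(-1/2) for the coefficient \<open>beta\<close>.\<close>

definition "\<delta> = min \<epsilon> (1/2)"
text \<open>Written as a combination with explicit coefficients so that the linearity lemmas for
  \<open>diter\<close> and for averages apply directly.\<close>

definition "g l = (\<lambda>y. l * f y l + (- 1 / l) * f0 y)"

lemma delta: "\<delta> > 0" "\<delta> \<le> 1/2" "\<delta> \<le> \<epsilon>"
  using eps_pos by (auto simp: \<delta>_def)

lemma fl_reg: "l > 0 \<Longrightarrow> Ck (m + 3) UNIV (\<lambda>y. f y l)"
  using Ck_slice[OF f_reg] by simp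

lemma g_reg: "l > 0 \<Longrightarrow> Ck (m + 3) UNIV (g l)"
  unfolding g_def by (intro Ck_add Ck_mult Ck_const open_UNIV fl_reg f0_reg)

lemma g_diter: "l > 0 \<Longrightarrow> set bs \<subseteq> Basis \<Longrightarrow> length bs \<le> m + 3 \<Longrightarrow>
   diter bs (g l) y = l * diter bs (\<lambda>y. f y l) y + (- 1 / l) * diter bs f0 y"
  unfolding g_def by (rule diter_linear[OF fl_reg f0_reg])

lemma g_continuous:
  assumes "set bs \<subseteq> Basis" "length bs \<le> m + 3"
  shows "continuous_on (UNIV \<times> {0<..}) (\<lambda>(y, l). diter bs (g l) y)"
proof -
  have "continuous_on halfspace (diter (map (\<lambda>b. (b, 0)) bs) (\<lambda>(x, t). f x t))"
    by (rule Ck_diter_continuous[OF f_reg]) (use assms space_Basis in auto)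
  then have 1: "continuous_on halfspace (\<lambda>p. diter bs (\<lambda>y. f y (snd p)) (fst p))"
    using diter_slice[of bs "\<lambda>(x, t). f x t"] by simp
  have 2: "continuous_on halfspace (\<lambda>p::'a \<times> real. diter bs f0 (fst p))"
    by (rule continuous_on_compose2[OF Ck_diter_continuous[OF f0_reg assms]]) (auto intro!: continuous_intros)
  have "continuous_on halfspace (\<lambda>p. snd p * diter bs (\<lambda>y. f y (snd p)) (fst p) + (- 1 / snd p) * diter bs f0 (fst p))"
    by (intro continuous_intros 1 2) auto
  moreover have "continuous_on halfspace (\<lambda>p. snd p * diter bs (\<lambda>y. f y (snd p)) (fst p) + (- 1 / snd p) * diter bs f0 (fst p))
     = continuous_on halfspace (\<lambda>(y, l). diter bs (g l) y)"
    by (rule continuous_on_cong) (auto simp: g_diter[OF _ assms])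
  ultimately show ?thesis by simp
qed

text \<open>There are finitely many lists of basis vectors of bounded length, so the sum of their
  constants serves for all of them.\<close>

lemma g_bound_all:
  "\<exists>C\<ge>0. \<forall>bs y l. set bs \<subseteq> Basis \<longrightarrow> length bs \<le> m + 1 \<longrightarrow> y \<in> cball 0 \<rho> \<longrightarrow> l \<in> {0<..L} \<longrightarrow>
     \<bar>diter bs (g l) y\<bar> \<le> C * l powr (\<delta> - 1)"
proof -
  obtain C0 where C0: "\<And>bs t x. set bs \<subseteq> Basis \<Longrightarrow> length bs \<le> m + 1 \<Longrightarrow> 0 < t \<Longrightarrow> t < T \<Longrightarrow>
       \<bar>diter bs (\<lambda>y. t * f y t - f0 y / t) x\<bar> \<le> C0 * t powr (\<epsilon> - 1)" using g_bd by metis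
  let ?I = "{bs :: 'a list. set bs \<subseteq> Basis \<and> length bs \<le> m + 1}"
  have fin: "finite ?I" by (rule finite_lists_length_le) simp
  have "\<exists>C\<ge>0. \<forall>y\<in>cball 0 \<rho>. \<forall>l\<in>{0<..L}. \<bar>diter bs (g l) y\<bar> \<le> C * l powr (\<delta> - 1)" if "bs \<in> ?I" for bs
  proof -
    have bs: "set bs \<subseteq> Basis" "length bs \<le> m + 1" "length bs \<le> m + 3" using that by auto
    have "\<exists>C\<ge>0. \<forall>y\<in>cball 0 \<rho>. \<forall>l\<in>{0<..L}. \<bar>(\<lambda>(y, l). diter bs (g l) y) (y, l)\<bar> \<le> C * l powr (\<delta> - 1)"
    proof (rule extend_bound[OF g_continuous[OF bs(1,3)], of "min T 1"])
      show "min T 1 > 0" using T_pos by simp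
      fix y l assume l: "0 < l" "l < min T 1"
      have "g l = (\<lambda>y. l * f y l - f0 y / l)" by (simp add: g_def)
      then have "\<bar>diter bs (g l) y\<bar> \<le> C0 * l powr (\<epsilon> - 1)" using C0[OF bs(1,2), of l y] l by simp
      also have "\<dots> \<le> \<bar>C0\<bar> * l powr (\<delta> - 1)"
        using l delta by (intro mult_mono powr_mono') auto
      finally show "\<bar>(\<lambda>(y, l). diter bs (g l) y) (y, l)\<bar> \<le> \<bar>C0\<bar> * l powr (\<delta> - 1)" by simp
    qed
    then show ?thesis by simp
  qed
  then have "\<forall>bs\<in>?I. \<exists>C. C \<ge> 0 \<and> (\<forall>y\<in>cball 0 \<rho>. \<forall>l\<in>{0<..L}. \<bar>diter bs (g l) y\<bar> \<le> C * l powr (\<delta> - 1))" by blast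
  from bchoice[OF this] obtain C where C': "\<forall>bs\<in>?I. C bs \<ge> 0 \<and> (\<forall>y\<in>cball 0 \<rho>. \<forall>l\<in>{0<..L}. \<bar>diter bs (g l) y\<bar> \<le> C bs * l powr (\<delta> - 1))"
    by blast
  have C: "C bs \<ge> 0" "\<And>y l. y \<in> cball 0 \<rho> \<Longrightarrow> l \<in> {0<..L} \<Longrightarrow> \<bar>diter bs (g l) y\<bar> \<le> C bs * l powr (\<delta> - 1)"
    if "bs \<in> ?I" for bs using C' that by blast+
  show ?thesis
  proof (intro exI[of _ "sum C ?I"] conjI allI impI)
    show "sum C ?I \<ge> 0" by (rule sum_nonneg) (rule C(1))
    fix bs :: "'a list" and y :: 'a and l assume *: "set bs \<subseteq> Basis" "length bs \<le> m + 1" "y \<in> cball 0 \<rho>" "l \<in> {0<..L}"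
    then have bs: "bs \<in> ?I" by simp
    have "\<bar>diter bs (g l) y\<bar> \<le> C bs * l powr (\<delta> - 1)" by (rule C(2)[OF bs *(3,4)])
    also have "\<dots> \<le> sum C ?I * l powr (\<delta> - 1)"
      by (intro mult_right_mono member_le_sum fin bs) (use C(1) in auto)
    finally show "\<bar>diter bs (g l) y\<bar> \<le> sum C ?I * l powr (\<delta> - 1)" .
  qed
qed

text \<open>Applied with \<open>X h\<close> the primitive of the wave of \<open>h\<close> and \<open>Y h\<close> its time derivative: as \<open>\<Delta>v = v\<^sub>r\<^sub>r\<close>, this is the
  primitive of the integrand of the theorem. Only derivatives of \<open>g l\<close> up to the order covered by the second hypothesis enter.\<close>

definition superpose :: "(('a \<Rightarrow> real) \<Rightarrow> 'a \<Rightarrow> real \<Rightarrow> real) \<Rightarrow> (('a \<Rightarrow> real) \<Rightarrow> 'a \<Rightarrow> real \<Rightarrow> real) \<Rightarrow> 'a \<Rightarrow> real \<Rightarrow> real \<Rightarrow> real" where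
  "superpose X Y x r l = X (g l) x r + beta l * Y f0 x r"

lemma superpose_dr:
  assumes "l > 0" "Ck (Suc k) UNIV (\<lambda>(x, r). X (g l) x r)" "Ck (Suc k) UNIV (\<lambda>(x, r). Y f0 x r)"
  shows "((\<lambda>r. superpose X Y x r l) has_real_derivative superpose (\<lambda>h. dt (X h)) (\<lambda>h. dt (Y h)) x r l) (at r)"
  unfolding superpose_def by (intro DERIV_add DERIV_cmult Ck_has_dt[OF assms(2)] Ck_has_dt[OF assms(3)]) auto

lemma superpose_dx:
  assumes "l > 0" "b \<in> Basis" "Ck (Suc k) UNIV (\<lambda>(x, r). X (g l) x r)" "Ck (Suc k) UNIV (\<lambda>(x, r). Y f0 x r)"
  shows "has_pd b (\<lambda>x. superpose X Y x r l) (superpose (\<lambda>h. dx b (X h)) (\<lambda>h. dx b (Y h)) x r l) x"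
proof -
  have "has_pd b (\<lambda>x. superpose X Y x r l) (dx b (X (g l)) x r + (0 * Y f0 x r + beta l * dx b (Y f0) x r)) x"
    unfolding superpose_def by (intro has_pd_add has_pd_mult has_pd_const Ck_has_dx[OF assms(3)] Ck_has_dx[OF assms(4)] assms(2)) auto
  then show ?thesis by (simp add: superpose_def)
qed

text \<open>The admissible orders differ because the two parts are estimated differently. For
  \<open>g l\<close> the derivatives must be controlled as l tends to 0, which is known up to order
  m + 1. The data \<open>f0\<close> do not depend on l, so compactness suffices up to the full order
  m + 3, and the singularity sits in \<open>beta\<close>.\<close>

lemma dominated_data_tot:
  assumes "averaging (m + 1) X" "averaging (m + 3) Y"
  shows "dominated_data \<delta> (superpose X Y)"
  unfolding dominated_data_def
proof (intro conjI allI)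
  obtain A where A: "avgop (m + 1) A" "\<And>h. Ck (m + 1) UNIV h \<Longrightarrow> X h = A h" using assms(1) by (auto simp: averaging_def)
  obtain B where B: "avgop (m + 3) B" "\<And>h. Ck (m + 3) UNIV h \<Longrightarrow> Y h = B h" using assms(2) by (auto simp: averaging_def)
  have XA: "X (g l) = A (g l)" if "l > 0" for l by (rule A(2)[OF Ck_mono[OF g_reg[OF that]]]) simp
  have YB: "Y f0 = B f0" by (rule B(2)[OF f0_reg])
  have cB: "continuous_on UNIV (\<lambda>(x, r). B f0 x r)" by (rule avgop_continuous_single[OF B(1) f0_reg])
  have c1: "continuous_on (UNIV \<times> UNIV \<times> {0<..}) (\<lambda>(x, r, l). A (g l) x r)"
    by (rule avgop_continuous[OF A(1)]) (auto intro!: g_continuous)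
  have i: "continuous_on (UNIV \<times> UNIV \<times> {0<..}) (\<lambda>p::'a \<times> real \<times> real. (fst p, fst (snd p)))" by (intro continuous_intros)
  have c2: "continuous_on (UNIV \<times> UNIV \<times> {0<..}) (\<lambda>p::'a \<times> real \<times> real. (\<lambda>(x, r). B f0 x r) (fst p, fst (snd p)))"
    by (rule continuous_on_compose2[OF cB i]) auto
  have c3: "continuous_on (UNIV \<times> UNIV \<times> {0<..}) (\<lambda>p::'a \<times> real \<times> real. beta (snd (snd p)))"
    by (rule continuous_on_compose2[OF beta_continuous]) (auto intro!: continuous_intros)
  have "continuous_on (UNIV \<times> UNIV \<times> {0<..}) (\<lambda>p. A (g (snd (snd p))) (fst p) (fst (snd p)) + beta (snd (snd p)) * B f0 (fst p) (fst (snd p)))"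
    using c1 c2 c3 by (intro continuous_intros) (auto simp: case_prod_unfold)
  moreover have "continuous_on (UNIV \<times> UNIV \<times> {0<..}) (\<lambda>p. A (g (snd (snd p))) (fst p) (fst (snd p)) + beta (snd (snd p)) * B f0 (fst p) (fst (snd p)))
     = continuous_on (UNIV \<times> UNIV \<times> {0<..}) (\<lambda>(x, r, l). superpose X Y x r l)"
    by (rule continuous_on_cong) (auto simp: superpose_def XA YB)
  ultimately show "continuous_on (UNIV \<times> UNIV \<times> {0<..}) (\<lambda>(x, r, l). superpose X Y x r l)" by simp
  fix R L :: real
  obtain C1 where C1: "C1 \<ge> 0" "\<And>h x r B. 0 \<le> B \<Longrightarrow> \<bar>r\<bar> \<le> R \<Longrightarrow> Ck (m + 1) UNIV h \<Longrightarrow>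
     (\<forall>bs y. set bs \<subseteq> Basis \<longrightarrow> length bs \<le> m + 1 \<longrightarrow> y \<in> cball x R \<longrightarrow> \<bar>diter bs h y\<bar> \<le> B) \<Longrightarrow> \<bar>A h x r\<bar> \<le> C1 * B"
    using avgop_bound[OF A(1), of R] by metis
  \<comment> \<open>The averages at x reach points at distance \<open>R\<close> from x, and |x| is
    at most \<open>R\<close>; this gives the radius R + R.\<close>
  obtain C2 where C2: "C2 \<ge> 0" "\<And>bs y l. set bs \<subseteq> Basis \<Longrightarrow> length bs \<le> m + 1 \<Longrightarrow> y \<in> cball 0 (R + R) \<Longrightarrow> l \<in> {0<..L} \<Longrightarrow>
     \<bar>diter bs (g l) y\<bar> \<le> C2 * l powr (\<delta> - 1)"
    using g_bound_all[of "R + R" L] by metis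
  obtain C3 where C3: "C3 \<ge> 0" "\<And>l. l \<in> {0<..L} \<Longrightarrow> \<bar>beta l\<bar> \<le> C3 * l powr (\<delta> - 1)"
    using beta_bound[OF delta(2), of L] by metis
  have "compact ((\<lambda>(x, r). B f0 x r) ` (cball 0 R \<times> cball 0 R))"
    by (intro compact_continuous_image continuous_on_subset[OF cB] compact_Times) auto
  then obtain C4 where C4: "\<And>z. z \<in> cball 0 R \<times> cball 0 R \<Longrightarrow> \<bar>(\<lambda>(x, r). B f0 x r) z\<bar> \<le> C4"
    using compact_imp_bounded bounded_iff by (metis image_eqI real_norm_def)
  show "\<exists>C. \<forall>x r l. norm x \<le> R \<longrightarrow> \<bar>r\<bar> \<le> R \<longrightarrow> 0 < l \<longrightarrow> l \<le> L \<longrightarrow> \<bar>superpose X Y x r l\<bar> \<le> C * l powr (\<delta> - 1)"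
  proof (intro exI[of _ "C1 * C2 + C3 * C4"] allI impI)
    fix x :: 'a and r l :: real assume *: "norm x \<le> R" "\<bar>r\<bar> \<le> R" "0 < l" "l \<le> L"
    let ?k = "l powr (\<delta> - 1)"
    have "y \<in> cball 0 (R + R)" if "y \<in> cball x R" for y
      using that *(1) norm_triangle_sub[of y x] by (auto simp: dist_norm norm_minus_commute)
    then have "\<bar>A (g l) x r\<bar> \<le> C1 * (C2 * ?k)"
      using C2 * by (intro C1(2) Ck_mono[OF g_reg]) auto
    moreover have "\<bar>beta l * B f0 x r\<bar> \<le> (C3 * ?k) * C4"
      unfolding abs_mult using C3 C4[of "(x, r)"] * by (intro mult_mono) auto
    ultimately show "\<bar>superpose X Y x r l\<bar> \<le> (C1 * C2 + C3 * C4) * ?k"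
      using XA[OF *(3)] YB by (simp add: superpose_def algebra_simps)
  qed
qed

end

section \<open>The solution\<close>

locale source_operators = source +
  fixes A V :: "('a \<Rightarrow> real) \<Rightarrow> 'a \<Rightarrow> real \<Rightarrow> real"
  assumes opA: "avgop (m - 1) A" and opV: "avgop m V"
    and A_dt: "\<And>h x r. Ck m UNIV h \<Longrightarrow> ((\<lambda>r. r * A h x r) has_real_derivative V h x r) (at r)"
    and V_dt: "\<And>h x r. Ck (m + 2) UNIV h \<Longrightarrow> ((\<lambda>r. V h x r) has_real_derivative r * lapx (A h) x r) (at r)"
    and V_wave: "\<And>h x r. Ck (m + 2) UNIV h \<Longrightarrow> dt (dt (V h)) x r = lapx (V h) x r"
    and V_0: "\<And>h x. Ck (m + 2) UNIV h \<Longrightarrow> V h x 0 = h x"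
    and V_sol: "\<And>h. Ck (m + 2) UNIV h \<Longrightarrow> is_wave_sol h (V h)"
begin

definition "X h = (\<lambda>x r. r * A h x r)"
definition "Y h = dt (V h)"

lemma m1: "m - 1 + 4 = m + 3"
  by (simp add: m_def)

lemma averaging_X: "averaging (m - 1) X"
  unfolding X_def[abs_def] by (intro averaging_avgop avgop.mult_r opA)

lemma averaging_Y: "averaging (m + 1) Y"
  using averaging_dt[OF averaging_avgop[OF opV]] by (simp add: Y_def[abs_def])

lemma reg:
  assumes "Ck (m + 3) UNIV h"
  shows "Ck (Suc (Suc 0)) UNIV (\<lambda>(x, r). X h x r)" "Ck (Suc (Suc 0)) UNIV (\<lambda>(x, r). Y h x r)"
    "Ck 3 UNIV (\<lambda>(x, r). V h x r)" "Ck 2 UNIV (\<lambda>(x, r). A h x r)"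
proof -
  have "Ck 4 UNIV (\<lambda>(x, r). X h x r)" by (rule averaging_Ck[OF averaging_X]) (use assms in \<open>simp only: m1\<close>)
  then show "Ck (Suc (Suc 0)) UNIV (\<lambda>(x, r). X h x r)" by (rule Ck_mono) simp
  show "Ck (Suc (Suc 0)) UNIV (\<lambda>(x, r). Y h x r)" by (rule averaging_Ck[OF averaging_Y]) (use assms in \<open>simp add: numeral_3_eq_3\<close>)
  show "Ck 3 UNIV (\<lambda>(x, r). V h x r)" by (rule avgop_Ck[OF opV assms])
  have "Ck 4 UNIV (\<lambda>(x, r). A h x r)" by (rule avgop_Ck[OF opA]) (use assms in \<open>simp only: m1\<close>)
  then show "Ck 2 UNIV (\<lambda>(x, r). A h x r)" by (rule Ck_mono) simp
qed

lemma dt_X: "Ck (m + 3) UNIV h \<Longrightarrow> dt (X h) = V h"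
  unfolding X_def by (intro ext dt_eqI A_dt) (auto elim: Ck_mono)

text \<open>The derivative of the wave is r times the Laplacian of \<open>A h\<close>, and a factor
  depending on r alone commutes with the spatial Laplacian.\<close>

lemma X_wave:
  assumes h: "Ck (m + 3) UNIV h"
  shows "dt (dt (X h)) x r = lapx (X h) x r"
proof -
  have "dt (V h) x r = r * lapx (A h) x r" by (rule dt_eqI, rule V_dt) (rule Ck_mono[OF h], simp)
  also have "\<dots> = lapx (\<lambda>x r. 0 + r * A h x r) x r"
  proof -
    have z: "dx b (\<lambda>x r. 0) = (\<lambda>x r. 0)" for b :: 'a by (intro ext dx_eqI has_pd_const)
    have "Ck 2 UNIV (\<lambda>(x::'a, r::real). 0)" using Ck_const[of 2 UNIV 0] by (simp add: case_prod_unfold)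
    from lapx_linear[OF this reg(4)[OF h], where c = "\<lambda>r. r"] show ?thesis by (simp add: lapx_def z)
  qed
  finally show ?thesis by (simp add: dt_X[OF h]) (simp add: X_def)
qed

lemma Y_wave:
  assumes h: "Ck (m + 3) UNIV h"
  shows "dt (dt (Y h)) x r = lapx (Y h) x r"
proof -
  have "dt (Y h) = lapx (V h)" unfolding Y_def by (intro ext V_wave Ck_mono[OF h]) simp
  then show ?thesis using dt_eqI[where w = "lapx (V h)", OF lapx_has_dt[OF reg(3)[OF h], of x r]] by (simp add: Y_def)
qed

text \<open>At r = 0 the velocities are h and its Laplacian. The superposition therefore starts with
  velocity g + beta * Laplace f0, the source of the equation for w.\<close>

lemma initial:
  assumes h: "Ck (m + 3) UNIV h"
  shows "X h x 0 = 0" "Y h x 0 = 0" "dt (X h) x 0 = h x" "dt (Y h) x 0 = lap h x"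
proof -
  have h2: "Ck (m + 2) UNIV h" by (rule Ck_mono[OF h]) simp
  show "X h x 0 = 0" by (simp add: X_def)
  show "Y h x 0 = 0" unfolding Y_def using dt_eqI[where w = "V h", OF V_dt[OF h2, of x 0]] by simp
  show "dt (X h) x 0 = h x" by (simp add: dt_X[OF h] V_0[OF h2])
  show "dt (Y h) x 0 = lap h x"
    using V_wave[OF h2, of x 0] lap_eq_lapx[of "V h" 0 x] V_0[OF h2] by (simp add: Y_def)
qed

lemma superpose_dt_dx:
  assumes l: "l > 0" and b: "b \<in> Basis"
  shows "((\<lambda>r. superpose (\<lambda>h. dx b (X h)) (\<lambda>h. dx b (Y h)) x r l) has_real_derivative
     superpose (\<lambda>h. dx b (dt (X h))) (\<lambda>h. dx b (dt (Y h))) x r l) (at r)"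
proof -
  note gX = reg(1)[OF g_reg[OF l]] and fY = reg(2)[OF f0_reg]
  have "((\<lambda>r. superpose (\<lambda>h. dx b (X h)) (\<lambda>h. dx b (Y h)) x r l) has_real_derivative
     superpose (\<lambda>h. dt (dx b (X h))) (\<lambda>h. dt (dx b (Y h))) x r l) (at r)"
    by (rule superpose_dr[where X = "\<lambda>h. dx b (X h)" and Y = "\<lambda>h. dx b (Y h)", OF l Ck_dx[OF gX b] Ck_dx[OF fY b]])
  moreover have "dx b (dt (X (g l))) x r = dt (dx b (X (g l))) x r" "dx b (dt (Y f0)) x r = dt (dx b (Y f0)) x r"
    using gX fY by (auto intro!: dx_dt_commute b simp: numeral_2_eq_2)
  ultimately show ?thesis by (simp add: superpose_def)
qed

text \<open>The orders fit without slack: two derivatives raise \<open>X\<close> from m - 1 to m + 1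
  and \<open>Y\<close> from m + 1 to m + 3, the limits set by
  \<open>dominated_data_tot\<close>.\<close>

sublocale D: duhamel \<delta> "superpose X Y" "superpose (\<lambda>h. dt (X h)) (\<lambda>h. dt (Y h))" "superpose (\<lambda>h. dt (dt (X h))) (\<lambda>h. dt (dt (Y h)))"
  "\<lambda>b. superpose (\<lambda>h. dx b (X h)) (\<lambda>h. dx b (Y h))" "\<lambda>b. superpose (\<lambda>h. dx b (dt (X h))) (\<lambda>h. dx b (dt (Y h)))"
  "\<lambda>b c. superpose (\<lambda>h. dx c (dx b (X h))) (\<lambda>h. dx c (dx b (Y h)))"
proof
  have mm: "Suc (m - 1) = m" "Suc (Suc (m - 1)) = m + 1" "m - 1 \<le> m + 1" "m \<le> m + 1" by (auto simp: m_def)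
  note X0 = averaging_X and Y0 = averaging_Y
  show "\<delta> > 0" by (rule delta)
  show "dominated_data \<delta> (superpose X Y)"
    by (intro dominated_data_tot averaging_mono[OF X0] averaging_mono[OF Y0]) auto
  show "dominated_data \<delta> (superpose (\<lambda>h. dt (X h)) (\<lambda>h. dt (Y h)))"
    by (intro dominated_data_tot averaging_mono[OF averaging_dt[OF X0]] averaging_mono[OF averaging_dt[OF Y0]]) (auto simp: m_def)
  show "dominated_data \<delta> (superpose (\<lambda>h. dt (dt (X h))) (\<lambda>h. dt (dt (Y h))))"
    by (intro dominated_data_tot averaging_mono[OF averaging_dt[OF averaging_dt[OF X0]]] averaging_mono[OF averaging_dt[OF averaging_dt[OF Y0]]]) (auto simp: m_def)
  show "dominated_data \<delta> (superpose (\<lambda>h. dx b (X h)) (\<lambda>h. dx b (Y h)))" if "b \<in> Basis" for b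
    by (intro dominated_data_tot averaging_mono[OF averaging_dx[OF X0 that]] averaging_mono[OF averaging_dx[OF Y0 that]]) (auto simp: m_def)
  show "dominated_data \<delta> (superpose (\<lambda>h. dx b (dt (X h))) (\<lambda>h. dx b (dt (Y h))))" if "b \<in> Basis" for b
    by (intro dominated_data_tot averaging_mono[OF averaging_dx[OF averaging_dt[OF X0] that]] averaging_mono[OF averaging_dx[OF averaging_dt[OF Y0] that]]) (auto simp: m_def)
  show "dominated_data \<delta> (superpose (\<lambda>h. dx c (dx b (X h))) (\<lambda>h. dx c (dx b (Y h))))" if "b \<in> Basis" "c \<in> Basis" for b c
    by (intro dominated_data_tot averaging_mono[OF averaging_dx[OF averaging_dx[OF X0 that(1)] that(2)]] averaging_mono[OF averaging_dx[OF averaging_dx[OF Y0 that(1)] that(2)]]) (auto simp: m_def)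
  fix x :: 'a and r l :: real assume l: "0 < l"
  note gX = reg(1)[OF g_reg[OF l]] and fY = reg(2)[OF f0_reg]
  show "((\<lambda>r. superpose X Y x r l) has_real_derivative superpose (\<lambda>h. dt (X h)) (\<lambda>h. dt (Y h)) x r l) (at r)"
    by (rule superpose_dr[where X = X and Y = Y, OF l gX fY])
  show "((\<lambda>r. superpose (\<lambda>h. dt (X h)) (\<lambda>h. dt (Y h)) x r l) has_real_derivative superpose (\<lambda>h. dt (dt (X h))) (\<lambda>h. dt (dt (Y h))) x r l) (at r)"
    by (rule superpose_dr[where X = "\<lambda>h. dt (X h)" and Y = "\<lambda>h. dt (Y h)", OF l Ck_dt[OF gX] Ck_dt[OF fY]])
  show "superpose X Y x 0 l = 0" using initial[OF g_reg[OF l]] initial[OF f0_reg] by (simp add: superpose_def)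
  show "superpose (\<lambda>h. dt (dt (X h))) (\<lambda>h. dt (dt (Y h))) x r l = (\<Sum>b\<in>Basis. superpose (\<lambda>h. dx b (dx b (X h))) (\<lambda>h. dx b (dx b (Y h))) x r l)"
    by (simp add: superpose_def X_wave[OF g_reg[OF l]] Y_wave[OF f0_reg] lapx_def sum.distrib sum_distrib_left)
  fix b :: 'a assume b: "b \<in> Basis"
  show "((\<lambda>r. superpose (\<lambda>h. dx b (X h)) (\<lambda>h. dx b (Y h)) x r l) has_real_derivative
     superpose (\<lambda>h. dx b (dt (X h))) (\<lambda>h. dx b (dt (Y h))) x r l) (at r)"
    by (rule superpose_dt_dx[OF l b])
  show "has_pd b (\<lambda>x. superpose X Y x r l) (superpose (\<lambda>h. dx b (X h)) (\<lambda>h. dx b (Y h)) x r l) x"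
    by (rule superpose_dx[where X = X and Y = Y, OF l b gX fY])
  show "has_pd b (\<lambda>x. superpose (\<lambda>h. dt (X h)) (\<lambda>h. dt (Y h)) x r l) (superpose (\<lambda>h. dx b (dt (X h))) (\<lambda>h. dx b (dt (Y h))) x r l) x"
    by (rule superpose_dx[where X = "\<lambda>h. dt (X h)" and Y = "\<lambda>h. dt (Y h)", OF l b Ck_dt[OF gX] Ck_dt[OF fY]])
  show "has_pd c (\<lambda>x. superpose (\<lambda>h. dx b (X h)) (\<lambda>h. dx b (Y h)) x r l) (superpose (\<lambda>h. dx c (dx b (X h))) (\<lambda>h. dx c (dx b (Y h))) x r l) x"
    if "c \<in> Basis" for c
    by (rule superpose_dx[where X = "\<lambda>h. dx b (X h)" and Y = "\<lambda>h. dx b (Y h)", OF l that Ck_dx[OF gX b] Ck_dx[OF fY b]])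
qed

section \<open>The formula for psi and the verification of the equation\<close>

lemma kernel_eq:
  assumes l: "l > 0"
  shows "l * wave_sol (\<lambda>y. f y l) x r - 1 / l * wave_sol f0 x r + l powr (-4/3) * tau l * lap (\<lambda>y. wave_sol f0 y r) x
    = superpose (\<lambda>h. dt (X h)) (\<lambda>h. dt (Y h)) x r l"
proof -
  have fl: "Ck (m + 2) UNIV (\<lambda>y. f y l)" "Ck m UNIV (\<lambda>y. f y l)" and f0: "Ck (m + 2) UNIV f0" "Ck m UNIV f0"
    using Ck_mono[OF fl_reg[OF l]] Ck_mono[OF f0_reg] by auto
  \<comment> \<open>Linearity in the data merges the waves of f and of f0 into the wave of their
    combination, the only one whose data are controlled by the second bound.\<close>
  have "V (g l) x r = l * V (\<lambda>y. f y l) x r + (- 1 / l) * V f0 x r"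
    unfolding g_def by (rule avgop_linear[OF opV fl(2) f0(2)])
  \<comment> \<open>By the wave equation the Laplacian is the second r-derivative, so v_r is a
    primitive of the correction term.\<close>
  moreover have "lap (\<lambda>y. V f0 y r) x = dt (Y f0) x r"
    unfolding lap_eq_lapx Y_def by (rule V_wave[OF f0(1), symmetric])
  ultimately show ?thesis
    by (simp add: superpose_def dt_X[OF g_reg[OF l]] wave_sol_eq[OF V_sol[OF fl(1)]] wave_sol_eq[OF V_sol[OF f0(1)]] beta_def)
qed

lemma psi_eq:
  assumes t: "t > 0"
  shows "psi f f0 x t = (1 / t) * (f0 x * tau t + D.w x t)"
proof -
  have "integral {0..t} (\<lambda>l. integral {0..phi t - phi l} (\<lambda>r. (phi t ^ 2 + phi l ^ 2 - r ^ 2) *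
         (l * wave_sol (\<lambda>y. f y l) x r - 1 / l * wave_sol f0 x r + l powr (-4/3) * tau l * lap (\<lambda>y. wave_sol f0 y r) x)))
      = integral {0..t} (\<lambda>l. integral {0..phi t - phi l} (\<lambda>r. (phi t ^ 2 + phi l ^ 2 - r ^ 2) * superpose (\<lambda>h. dt (X h)) (\<lambda>h. dt (Y h)) x r l))"
  proof (rule integral_spike[of "{0}"])
    fix l assume "l \<in> {0..t} - {0}"
    then have "l > 0" by auto
    then show "integral {0..phi t - phi l} (\<lambda>r. (phi t ^ 2 + phi l ^ 2 - r ^ 2) * superpose (\<lambda>h. dt (X h)) (\<lambda>h. dt (Y h)) x r l)
      = integral {0..phi t - phi l} (\<lambda>r. (phi t ^ 2 + phi l ^ 2 - r ^ 2) *
         (l * wave_sol (\<lambda>y. f y l) x r - 1 / l * wave_sol f0 x r + l powr (-4/3) * tau l * lap (\<lambda>y. wave_sol f0 y r) x))"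
      by (simp only: kernel_eq)
  qed simp
  also have "\<dots> = 18 * D.w x t" by (rule D.outer_integral[OF t])
  finally show ?thesis using t by (simp add: psi_def field_simps)
qed

text \<open>\<open>U\<close> is t psi and \<open>Ut\<close> its time derivative. Multiplication by t
  removes the first-order term, because (t psi)_tt = t (psi_tt + (2/t) psi_t).\<close>

definition "U x t = f0 x * tau t + D.w x t"
definition "Ut x t = f0 x * ln t + D.wt x t"

lemma psi_U: "t > 0 \<Longrightarrow> psi f f0 x t = U x t / t"
  by (simp add: psi_eq U_def)

lemma U_dt: "t > 0 \<Longrightarrow> ((\<lambda>s. U x s) has_real_derivative Ut x t) (at t)"
  unfolding U_def Ut_def by (intro DERIV_add DERIV_cmult tau_has_derivative D.w_dt)

text \<open>The two purposes of the correction show here: f0/t from differentiating f0 ln t cancels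
  the f0/t subtracted in the source, and beta * Laplace f0 supplies the Laplacian of f0 tau.\<close>

lemma Ut_dt:
  assumes t: "t > 0"
  shows "((\<lambda>s. Ut x s) has_real_derivative t powr (-4/3) * (tau t * lap f0 x + lapx D.w x t) + t * f x t) (at t)"
proof -
  have "((\<lambda>s. Ut x s) has_real_derivative f0 x * (1 / t) + (duhamel_int D.Wtt x t + superpose (\<lambda>h. dt (X h)) (\<lambda>h. dt (Y h)) x 0 t)) (at t)"
    unfolding Ut_def using t D.wt_dt[OF t, of x] by (auto intro!: derivative_eq_intros)
  moreover have "superpose (\<lambda>h. dt (X h)) (\<lambda>h. dt (Y h)) x 0 t = g t x + beta t * lap f0 x"
    using initial[OF g_reg[OF t]] initial[OF f0_reg] by (simp add: superpose_def)
  ultimately show ?thesis using t by (simp add: D.w_eq g_def beta_def algebra_simps)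
qed

lemma psi_dt:
  assumes t: "t > 0"
  shows "((\<lambda>s. psi f f0 x s) has_real_derivative Ut x t / t - U x t / t\<^sup>2) (at t)"
proof -
  have "((\<lambda>s. U x s / s) has_real_derivative Ut x t / t - U x t / t\<^sup>2) (at t)"
    using t by (auto intro!: derivative_eq_intros U_dt simp: field_simps power2_eq_square)
  moreover have "\<forall>\<^sub>F s in nhds t. U x s / s = psi f f0 x s"
    using eventually_nhds_in_open[of "{0<..}" t] t by (auto elim!: eventually_mono simp: psi_U)
  ultimately show ?thesis using DERIV_cong_ev[of t t "\<lambda>s. U x s / s" "\<lambda>s. psi f f0 x s"] by blast
qed

lemma psi_dtt:
  assumes t: "t > 0"
  shows "deriv (\<lambda>s. deriv (\<lambda>s'. psi f f0 x s') s) t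
    = (t powr (-4/3) * (tau t * lap f0 x + lapx D.w x t) + t * f x t) / t - 2 * Ut x t / t\<^sup>2 + 2 * U x t / t ^ 3"
proof (rule DERIV_imp_deriv)
  have "((\<lambda>s. Ut x s / s - U x s / s\<^sup>2) has_real_derivative
     ((t powr (-4/3) * (tau t * lap f0 x + lapx D.w x t) + t * f x t) * t - Ut x t * 1) / (t * t)
     - (Ut x t * t\<^sup>2 - U x t * (2 * t)) / (t\<^sup>2 * t\<^sup>2)) (at t)"
  proof (intro DERIV_diff DERIV_divide Ut_dt U_dt t)
    show "((\<lambda>s. s) has_real_derivative 1) (at t)" by simp
    show "((\<lambda>s. s\<^sup>2) has_real_derivative 2 * t) (at t)" by (auto intro!: derivative_eq_intros)
  qed (use t in auto)
  moreover have "((t powr (-4/3) * (tau t * lap f0 x + lapx D.w x t) + t * f x t) * t - Ut x t * 1) / (t * t)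
     - (Ut x t * t\<^sup>2 - U x t * (2 * t)) / (t\<^sup>2 * t\<^sup>2)
     = (t powr (-4/3) * (tau t * lap f0 x + lapx D.w x t) + t * f x t) / t - 2 * Ut x t / t\<^sup>2 + 2 * U x t / t ^ 3"
  proof -
    have "(E * t - Ut x t * 1) / (t * t) - (Ut x t * t\<^sup>2 - U x t * (2 * t)) / (t\<^sup>2 * t\<^sup>2)
       = E / t - 2 * Ut x t / t\<^sup>2 + 2 * U x t / t ^ 3" for E
      using t by (simp add: field_simps power2_eq_square power3_eq_cube)
    then show ?thesis .
  qed
  moreover have "\<forall>\<^sub>F s in nhds t. Ut x s / s - U x s / s\<^sup>2 = deriv (\<lambda>s'. psi f f0 x s') s"
    using eventually_nhds_in_open[of "{0<..}" t] t
    by (auto elim!: eventually_mono simp: DERIV_imp_deriv[OF psi_dt])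
  ultimately show "((\<lambda>s. deriv (\<lambda>s'. psi f f0 x s') s) has_real_derivative
     (t powr (-4/3) * (tau t * lap f0 x + lapx D.w x t) + t * f x t) / t - 2 * Ut x t / t\<^sup>2 + 2 * U x t / t ^ 3) (at t)"
    using DERIV_cong_ev[of t t "\<lambda>s. Ut x s / s - U x s / s\<^sup>2" "\<lambda>s. deriv (\<lambda>s'. psi f f0 x s') s"] by simp
qed

lemma psi_lap:
  assumes t: "t > 0"
  shows "lap (\<lambda>y. psi f f0 y t) x = (tau t * lap f0 x + lapx D.w x t) / t"
proof -
  have e: "(\<lambda>y. psi f f0 y t) = (\<lambda>y. (tau t / t) * f0 y + (1 / t) * D.w y t)"
    using t by (simp add: psi_U U_def field_simps)
  have f2: "Ck (Suc (Suc 0)) UNIV f0" by (rule Ck_mono[OF f0_reg]) simp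
  have w2: "Ck (Suc (Suc 0)) halfspace (\<lambda>(x, t). D.w x t)" using D.w_Ck by (simp add: numeral_2_eq_2)
  have lin: "has_pd b (\<lambda>y. a * p y + c * q y) (a * p' + c * q') y" if "has_pd b p p' y" "has_pd b q q' y" for a c p q p' q' and b y :: 'a
    using has_pd_add[OF has_pd_mult[OF has_pd_const[of b a] that(1)] has_pd_mult[OF has_pd_const[of b c] that(2)]] by simp
  have "pdir b (pdir b (\<lambda>y. psi f f0 y t)) x = (tau t / t) * pdir b (pdir b f0) x + (1 / t) * dx b (dx b D.w) x t" if b: "b \<in> Basis" for b
  proof (rule has_pd_pdir)
    have 1: "pdir b (\<lambda>y. psi f f0 y t) = (\<lambda>y. (tau t / t) * pdir b f0 y + (1 / t) * dx b D.w y t)"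
      unfolding e by (intro ext has_pd_pdir lin Ck_has_pd[OF f2 b] Ck_has_dx[OF w2 _ b]) (use t in auto)
    have p: "Ck (Suc 0) UNIV (pdir b f0)" using f2 b by (simp add: Ck_Suc[of "Suc 0"])
    show "has_pd b (pdir b (\<lambda>y. psi f f0 y t)) ((tau t / t) * pdir b (pdir b f0) x + (1 / t) * dx b (dx b D.w) x t) x"
      unfolding 1 by (intro lin Ck_has_pd[OF p b] Ck_has_dx[OF Ck_dx[OF w2 b] _ b]) (use t in auto)
  qed
  then show ?thesis
    by (simp add: lap_def lapx_def sum.distrib sum_distrib_left add_divide_distrib sum_divide_distrib)
qed

lemma psi_Ck: "Ck 2 halfspace (\<lambda>(x, t). psi f f0 x t)"
proof -
  have "Ck 2 halfspace (\<lambda>p. (\<lambda>(x, t). 1 / t) p * ((\<lambda>(x, t). f0 x) p * (\<lambda>(x, t). tau t) p + (\<lambda>(x, t). D.w x t) p))"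
    by (intro Ck_mult Ck_add open_halfspace Ck_inverse_time Ck_tau D.w_Ck Ck_space Ck_mono[OF f0_reg]) simp
  then show ?thesis
    by (rule Ck_cong_open[OF open_halfspace, rotated]) (auto simp: psi_eq)
qed

text \<open>The second initial condition reduces to that of the Duhamel integral: t psi_t + psi is
  the derivative of t psi, and removing f0 ln t leaves exactly \<open>D.wt\<close>.\<close>

theorem psi_solves:
  "Ck 2 halfspace (\<lambda>(x, t). psi f f0 x t)"
  "t > 0 \<Longrightarrow> deriv (\<lambda>s. deriv (\<lambda>s'. psi f f0 x s') s) t - t powr (-4/3) * lap (\<lambda>y. psi f f0 y t) x
     + 2 / t * deriv (\<lambda>s. psi f f0 x s) t = f x t"
  "((\<lambda>t. t * psi f f0 x t) \<longlongrightarrow> 0) (at_right 0)"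
  "((\<lambda>t. t * deriv (\<lambda>s. psi f f0 x s) t + psi f f0 x t - f0 x * ln t) \<longlongrightarrow> 0) (at_right 0)"
proof -
  show "Ck 2 halfspace (\<lambda>(x, t). psi f f0 x t)" by (rule psi_Ck)
  show "deriv (\<lambda>s. deriv (\<lambda>s'. psi f f0 x s') s) t - t powr (-4/3) * lap (\<lambda>y. psi f f0 y t) x
     + 2 / t * deriv (\<lambda>s. psi f f0 x s) t = f x t" if t: "t > 0"
  proof -
    define E where "E = tau t * lap f0 x + lapx D.w x t"
    have "(P * E + t * F) / t - 2 * a / t\<^sup>2 + 2 * b / t ^ 3 - P * (E / t) + 2 / t * (a / t - b / t\<^sup>2) = F" for P F a b
      using t by (simp add: field_simps power2_eq_square power3_eq_cube)
    then show ?thesis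
      unfolding psi_dtt[OF t] psi_lap[OF t] DERIV_imp_deriv[OF psi_dt[OF t]] E_def[symmetric] .
  qed
  have pos: "\<forall>\<^sub>F t in at_right (0::real). 0 < t" by (auto simp: eventually_at intro!: exI[of _ 1])
  have "((\<lambda>t. f0 x * tau t + D.w x t) \<longlongrightarrow> f0 x * 0 + 0) (at_right 0)"
    by (intro tendsto_intros tau_tendsto D.limits)
  then have "((\<lambda>t. f0 x * tau t + D.w x t) \<longlongrightarrow> 0) (at_right 0)" by simp
  then show "((\<lambda>t. t * psi f f0 x t) \<longlongrightarrow> 0) (at_right 0)"
    by (rule Lim_transform_eventually) (use pos in eventually_elim, simp add: psi_eq)
  show "((\<lambda>t. t * deriv (\<lambda>s. psi f f0 x s) t + psi f f0 x t - f0 x * ln t) \<longlongrightarrow> 0) (at_right 0)"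
  proof (rule Lim_transform_eventually[OF D.limits(2)])
    show "\<forall>\<^sub>F t in at_right 0. D.wt x t = t * deriv (\<lambda>s. psi f f0 x s) t + psi f f0 x t - f0 x * ln t"
      using pos
    proof eventually_elim
      case (elim t)
      have "t * (Ut x t / t - U x t / t\<^sup>2) + U x t / t = Ut x t" using elim by (simp add: field_simps power2_eq_square)
      then show ?case by (simp add: DERIV_imp_deriv[OF psi_dt[OF elim]] psi_U[OF elim] Ut_def)
    qed
  qed
qed

end

theorem theorem2p1:
  fixes f :: "real^'n \<Rightarrow> real \<Rightarrow> real" and f0 :: "real^'n \<Rightarrow> real"
    and T \<epsilon> :: real
  defines "K \<equiv> CARD('n) div 2 + 4"
  assumes f_reg: "Ck K (UNIV \<times> {0<..}) (\<lambda>(x, t). f x t)"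
    and f_cont: "continuous_on (UNIV \<times> {0..}) (\<lambda>(x, t). if t = 0 then f0 x else t\<^sup>2 * f x t)"
    and T_pos: "T > 0"
    and f_bd: "\<exists>C. \<forall>as bs. set as \<subseteq> Basis \<and> length as \<le> K \<and> set bs \<subseteq> Basis \<and> length bs \<le> K - 1 \<longrightarrow>
                 (\<forall>t\<in>{0<..<T}. \<forall>x.
                    \<bar>diter as (\<lambda>y. f y t) x\<bar> + \<bar>t * deriv (\<lambda>s. diter bs (\<lambda>y. f y s) x) t\<bar>
                      \<le> C * t powr (-2))"
    and f0_reg: "Ck K UNIV f0"
    and eps_pos: "\<epsilon> > 0"
    and g_bd: "\<exists>C. \<forall>as bs. set as \<subseteq> Basis \<and> length as \<le> K - 2 \<and> set bs \<subseteq> Basis \<and> length bs \<le> K - 3 \<longrightarrow>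
                 (\<forall>t\<in>{0<..<T}. \<forall>x.
                    \<bar>diter as (\<lambda>y. t * f y t - f0 y / t) x\<bar>
                    + \<bar>t * deriv (\<lambda>s. diter bs (\<lambda>y. s * f y s - f0 y / s) x) t\<bar>
                      \<le> C * t powr (\<epsilon> - 1))"
  shows "Ck 2 (UNIV \<times> {0<..}) (\<lambda>(x, t). psi f f0 x t)
    \<and> (\<forall>x. \<forall>t>0.
          deriv (\<lambda>s. deriv (\<lambda>s'. psi f f0 x s') s) t
          - t powr (-4/3) * lap (\<lambda>y. psi f f0 y t) x
          + 2 / t * deriv (\<lambda>s. psi f f0 x s) t = f x t)
    \<and> (\<forall>x. ((\<lambda>t. t * psi f f0 x t) \<longlongrightarrow> 0) (at_right 0))
    \<and> (\<forall>x. ((\<lambda>t. t * deriv (\<lambda>s. psi f f0 x s) t + psi f f0 x t - f0 x * ln t) \<longlongrightarrow> 0) (at_right 0))"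
proof -
  define m where "m = DIM(real^'n) div 2 + 1"
  have K: "K = m + 3" by (simp add: K_def m_def)
  obtain C where C: "\<forall>as bs. set as \<subseteq> Basis \<and> length as \<le> K - 2 \<and> set bs \<subseteq> Basis \<and> length bs \<le> K - 3 \<longrightarrow>
                 (\<forall>t\<in>{0<..<T}. \<forall>x.
                    \<bar>diter as (\<lambda>y. t * f y t - f0 y / t) x\<bar>
                    + \<bar>t * deriv (\<lambda>s. diter bs (\<lambda>y. s * f y s - f0 y / s) x) t\<bar>
                      \<le> C * t powr (\<epsilon> - 1))"
    using g_bd ..
  \<comment> \<open>The time-derivative summand is nonnegative, so specialising it to the empty list
    leaves the bound on the spatial derivatives.\<close>
  have g_bd': "\<bar>diter as (\<lambda>y. t * f y t - f0 y / t) x\<bar> \<le> C * t powr (\<epsilon> - 1)"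
    if "set as \<subseteq> Basis" "length as \<le> m + 1" "0 < t" "t < T" for as t x
    using C[rule_format, of as "[]" t x] that K by simp
  obtain A V :: "(real^'n \<Rightarrow> real) \<Rightarrow> real^'n \<Rightarrow> real \<Rightarrow> real" where AV: "avgop (m - 1) A" "avgop m V"
    "\<And>h x r. Ck m UNIV h \<Longrightarrow> ((\<lambda>r. r * A h x r) has_real_derivative V h x r) (at r)"
    "\<And>h x r. Ck (m + 2) UNIV h \<Longrightarrow> ((\<lambda>r. V h x r) has_real_derivative r * lapx (A h) x r) (at r)"
    "\<And>h x r. Ck (m + 2) UNIV h \<Longrightarrow> dt (dt (V h)) x r = lapx (V h) x r"
    "\<And>h x. Ck (m + 2) UNIV h \<Longrightarrow> V h x 0 = h x"
    "\<And>h. Ck (m + 2) UNIV h \<Longrightarrow> is_wave_sol h (V h)"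
    by (rule wave_operators[where 'a = "real^'n", folded m_def], rule that) assumption+
  interpret source_operators f f0 \<epsilon> T m A V
  proof (unfold_locales, unfold m_def[symmetric])
    show "\<exists>C. \<forall>bs t x. set bs \<subseteq> Basis \<longrightarrow> length bs \<le> m + 1 \<longrightarrow> 0 < t \<longrightarrow> t < T \<longrightarrow>
       \<bar>diter bs (\<lambda>y. t * f y t - f0 y / t) x\<bar> \<le> C * t powr (\<epsilon> - 1)" using g_bd' by blast
  qed (fact f_reg[unfolded K] f0_reg[unfolded K] T_pos eps_pos AV)+
  show ?thesis using psi_solves by blast
qed

end
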